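(* Let $\mathcal{H}$ be the diagrammatic Hecke category attached to a realization $V$ of a Coxeter system $(W,S)$ over a commutative ring $\Bbbk$ (assumed to be well-defined). Then $\mathcal{H}$ can be given the structure of a $\mathbb{Z}^2$-graded $\Bbbk$-linear monoidal category in which the generating morphisms are homogeneous of the following bidegrees, for every $s\in S$ and all distinct $s,t\in S$ with $m_{st}<\infty$: $$\deg(\mathrm{start}_s)=(1,0),\quad \deg(\mathrm{end}_s)=(0,1),\quad \deg(\mathrm{split}_s)=(0,-1),\quad \deg(\mathrm{merge}_s)=(-1,0),\quad \deg(\mathsf{V}_{s,t})=(0,0),$$ and in which every element of $V$, viewed as a linear polynomial in $R=\operatorname{Sym}(V)\cong\operatorname{End}(\mathbb{1})$, has bidegree $(1,1)$. The original $\mathbb{Z}$-grading on $\mathcal{H}$ is obtained from this $\mathbb{Z}^2$-grading via the homomorphism $\mathbb{Z}^2\to\mathbb{Z}$, $(m,n)\mapsto m+n$.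
   Context: **Realization.** $(W,S)$ is a Coxeter system with Coxeter matrix $(m_{st})$ and $\Bbbk$ is a commutative ring. A realization is a free $\Bbbk$-module $V$ of finite rank with simple roots $\alpha_s\in V$ and simple coroots $\alpha_s^\vee\in\operatorname{Hom}_\Bbbk(V,\Bbbk)$ ($s\in S$), such that $\langle\alpha_s^\vee,\alpha_s\rangle=2$, and $s(v)=v-\langle\alpha_s^\vee,v\rangle\alpha_s$ defines an action of $W$ on $V$ (plus the standard technical conditions for $\mathcal H$ to be well-defined, see below). $R=\operatorname{Sym}(V)$ has the induced $W$-action; $\partial_s(p)=(p-s(p))/\alpha_s$ is the Demazure operator, so $\partial_s(v)=\langle\alpha_s^\vee,v\rangle$ for $v\in V$. **The category $\mathcal{H}$.** $\mathcal{H}$ is the strict $\Bbbk$-linear monoidal category whose objects are finite words in $S$, i.e. tensor products $B_{s_1}B_{s_2}\cdots B_{s_k}$ (the empty word is the identity object $\mathbb{1}$). Its morphisms are generated, under composition and tensor product, by: - for $p\in R$, a morphism $p:\mathbb{1}\to\mathbb{1}$ (so that $R\to\operatorname{End}(\mathbb{1})$ is a ring homomorphism); - for $s\in S$: $\mathrm{start}_s:\mathbb{1}\to B_s$, $\mathrm{end}_s:B_s\to\mathbb{1}$ (univalent vertices), $\mathrm{split}_s:B_s\to B_sB_s$, $\mathrm{merge}_s:B_sB_s\to B_s$ (trivalent vertices); - for $s\ne t$ with $m=m_{st}<\infty$: the $2m$-valent vertex $\mathsf V_{s,t}:w_s\to w_t$, where $w_s=B_sB_tB_s\cdots$ and $w_t=B_tB_sB_t\cdots$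 ($m$ alternating factors each). Write $\mathrm{cup}_s=\mathrm{split}_s\circ\mathrm{start}_s$, $\mathrm{cap}_s=\mathrm{end}_s\circ\mathrm{merge}_s$. The relations are: 1. *One color.* $(B_s,\mathrm{merge}_s,\mathrm{start}_s,\mathrm{split}_s,\mathrm{end}_s)$ is a Frobenius algebra object (unit, counit, associativity, coassociativity, Frobenius relation); $\mathrm{merge}_s\circ\mathrm{split}_s=0$; $\mathrm{end}_s\circ\mathrm{start}_s=\alpha_s$; and polynomial forcing $p\otimes\mathrm{id}_{B_s}=\mathrm{id}_{B_s}\otimes s(p)+\partial_s(p)\cdot(\mathrm{start}_s\circ\mathrm{end}_s)$ for $p\in R$, where $\partial_s(p)$ is placed to the left. 2. *Isotopy.* Diagrams are considered up to isotopy with respect to the cups and caps; in particular rotating $\mathsf V_{s,t}$ by one strand (moving the leftmost bottom strand to the top left by a cup and the rightmost top strand to the bottom right by a cap) gives $\mathsf V_{t,s}$. 3. *Two-color associativity.* With $d$ the last letter of $w_t$: $\mathsf V_{s,t}\circ(\mathrm{merge}_s\otimes\mathrm{id})=(\mathrm{id}\otimes\mathrm{merge}_d)\circ(\mathsf V_{s,t}\otimes\mathrm{id}_{B_d})\circ(\mathrm{id}_{B_s}\otimes\mathsf V_{s,t})$. 4. *Jones–Wenzl.* $\mathsf V_{t,s}\circ\mathsf V_{s,t}=\mathrm{JW}_{s,t}$, and $(\mathrm{id}\otimes\mathrm{end}_d)\circ\mathsf V_{s,t}=(\mathrm{end}_s\otimes\mathrm{id})\circ\mathrm{JW}_{s,t}$.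 Here $\mathrm{JW}_{s,t}\in\operatorname{End}(w_s)$ is obtained from the two-colored Jones–Wenzl projector on $m-1$ strands: in the Temperley–Lieb category whose planar regions are colored alternately $s$ and $t$, and where a circle with interior colored $s$ (resp. $t$) evaluates to $\partial_t(\alpha_s)$ (resp. $\partial_s(\alpha_t)$), it is the idempotent with leftmost region colored $s$, with identity coefficient $1$, and killed by all caps on top and cups on bottom. Each crossingless matching is turned into a morphism of $\mathcal{H}$ by replacing every colored region by its deformation retract (a graph of that color made of univalent and trivalent vertices and strands). 5. *Zamolodchikov.* For every finite rank-three parabolic subgroup, one relation: (i) if $m_{su}=m_{tu}=2$, the $u$-strand slides through $\mathsf V_{s,t}$: ($\mathsf V_{s,t}\otimes\mathrm{id}_{B_u}$) composed after the 4-valent vertices moving $u$ from left to right past $w_s$ equals the 4-valent vertices moving $u$ from left to right past $w_t$ composed after ($\mathrm{id}_{B_u}\otimes\mathsf V_{s,t}$); (ii) type $A_3$ ($m_{12}=m_{23}=3$, $m_{13}=2$): the composites of vertices along the two paths of words $121321\to123121\to123212\to132312\to312312\to312132\to321232\to321323\to323123$ and $121321\to212321\to213231\to231231\to231213\to232123\to323123$ are equal; (iii) type $B_3$ ($m_{12}=3,m_{23}=4,m_{13}=2$): up to commutations $13\leftrightarrow31$, the reduced words of the longest element form a 14-cycle, half of which is $121321323,\,123212323,\,123213232,\,132321232,\,132312132,\,321232132,\,321323212,\,323123121$, the other half consisting of the reversed words; the relation equates the two composites of vertices along the two paths from a word to its reverse, the starting word being the one chosen by Elias–Williamson, i.e.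 such that the equality holds for the corresponding maps of Bott–Samelson bimodules. **Well-definedness (standing assumption).** $\mathcal H$ is assumed well-defined: no parabolic subgroup is of type $H_3$, $\partial_s:V\to\Bbbk$ is surjective for all $s$, and the two-colored Jones–Wenzl projectors exist over $\Bbbk$ and are rotatable, so that Hom spaces are free left $R$-modules with the usual (double leaves) bases. **Original grading.** $\mathcal{H}$ is $\mathbb{Z}$-graded: $\mathrm{start}_s,\mathrm{end}_s$ have degree $1$, $\mathrm{split}_s,\mathrm{merge}_s$ degree $-1$, $\mathsf V_{s,t}$ degree $0$, elements of $V$ degree $2$. **Graded monoidal category.** For an abelian group $A$, an $A$-graded $\Bbbk$-linear monoidal category has Hom spaces $\operatorname{Hom}(X,Y)=\bigoplus_{a\in A}\operatorname{Hom}_a(X,Y)$ as $\Bbbk$-modules ($\Bbbk$ in degree $0$), with identities of degree $0$ and degrees adding under composition and tensor product. *)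

theory Defs
  imports
    "HOL-Algebra.Module"
    "HOL-Algebra.Group_Action"
    "HOL-Algebra.Generated_Groups"
    "HOL-Library.Poly_Mapping"
    "HOL-Library.Product_Plus"
    "HOL-Library.Extended_Nat"
    "HOL-Library.Disjoint_Sets"
    "HOL-Computational_Algebra.Polynomial"
begin

(* the records and datatypes below contain types of finitely supported functions *)
declare [[typedef_overloaded]]

section \<open>Linear monoidal categories and gradings\<close>

definition scalar_ring :: "'k::comm_ring_1 ring" where
  "scalar_ring = \<lparr>carrier = UNIV, monoid.mult = (*), one = 1, zero = 0, add = (+)\<rparr>"

text \<open>The multiplicative fields of the records \<open>Hom C X Y\<close> (inherited from the
  record type of modules) are never used. \<open>Comp\<close> is written in the usual order:
  \<open>ccomp C g f\<close> is \<open>g\<close> after \<open>f\<close>.\<close>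

record ('o, 'm, 'k) linear_monoidal_cat =
  Obj :: "'o set"
  Hom :: "'o \<Rightarrow> 'o \<Rightarrow> ('k, 'm) module"
  ident :: "'o \<Rightarrow> 'm"
  ccomp :: "'m \<Rightarrow> 'm \<Rightarrow> 'm"
  munit :: "'o"
  otens :: "'o \<Rightarrow> 'o \<Rightarrow> 'o"
  mtens :: "'m \<Rightarrow> 'm \<Rightarrow> 'm"

abbreviation hom_set :: "('o, 'm, 'k) linear_monoidal_cat \<Rightarrow> 'o \<Rightarrow> 'o \<Rightarrow> 'm set" where
  "hom_set C X Y \<equiv> carrier (Hom C X Y)"

locale strict_linear_monoidal_category =
  fixes C :: "('o, 'm, 'k::comm_ring_1) linear_monoidal_cat"
  assumes hom_module:
      "\<lbrakk>X \<in> Obj C; Y \<in> Obj C\<rbrakk> \<Longrightarrow> Module.module scalar_ring (Hom C X Y)"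
    and ident_closed: "X \<in> Obj C \<Longrightarrow> ident C X \<in> hom_set C X X"
    and ccomp_closed:
      "\<lbrakk>X \<in> Obj C; Y \<in> Obj C; Z \<in> Obj C; f \<in> hom_set C X Y; g \<in> hom_set C Y Z\<rbrakk>
        \<Longrightarrow> ccomp C g f \<in> hom_set C X Z"
    and ccomp_ident:
      "\<lbrakk>X \<in> Obj C; Y \<in> Obj C; f \<in> hom_set C X Y\<rbrakk> \<Longrightarrow> ccomp C f (ident C X) = f"
      "\<lbrakk>X \<in> Obj C; Y \<in> Obj C; f \<in> hom_set C X Y\<rbrakk> \<Longrightarrow> ccomp C (ident C Y) f = f"
    and ccomp_assoc:
      "\<lbrakk>X \<in> Obj C; Y \<in> Obj C; Z \<in> Obj C; U \<in> Obj C;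
        f \<in> hom_set C X Y; g \<in> hom_set C Y Z; h \<in> hom_set C Z U\<rbrakk>
        \<Longrightarrow> ccomp C (ccomp C h g) f = ccomp C h (ccomp C g f)"
    and ccomp_bilinear:
      "\<lbrakk>X \<in> Obj C; Y \<in> Obj C; Z \<in> Obj C; f \<in> hom_set C X Y;
        g \<in> hom_set C Y Z; g' \<in> hom_set C Y Z\<rbrakk>
        \<Longrightarrow> ccomp C (g \<oplus>\<^bsub>Hom C Y Z\<^esub> g') f = ccomp C g f \<oplus>\<^bsub>Hom C X Z\<^esub> ccomp C g' f"
      "\<lbrakk>X \<in> Obj C; Y \<in> Obj C; Z \<in> Obj C; f \<in> hom_set C X Y;
        f' \<in> hom_set C X Y; g \<in> hom_set C Y Z\<rbrakk>
        \<Longrightarrow> ccomp C g (f \<oplus>\<^bsub>Hom C X Y\<^esub> f') = ccomp C g f \<oplus>\<^bsub>Hom C X Z\<^esub> ccomp C g f'"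
      "\<lbrakk>X \<in> Obj C; Y \<in> Obj C; Z \<in> Obj C; f \<in> hom_set C X Y; g \<in> hom_set C Y Z\<rbrakk>
        \<Longrightarrow> ccomp C (c \<odot>\<^bsub>Hom C Y Z\<^esub> g) f = c \<odot>\<^bsub>Hom C X Z\<^esub> ccomp C g f"
      "\<lbrakk>X \<in> Obj C; Y \<in> Obj C; Z \<in> Obj C; f \<in> hom_set C X Y; g \<in> hom_set C Y Z\<rbrakk>
        \<Longrightarrow> ccomp C g (c \<odot>\<^bsub>Hom C X Y\<^esub> f) = c \<odot>\<^bsub>Hom C X Z\<^esub> ccomp C g f"
    and munit_closed: "munit C \<in> Obj C"
    and otens_closed: "\<lbrakk>X \<in> Obj C; Y \<in> Obj C\<rbrakk> \<Longrightarrow> otens C X Y \<in> Obj C"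
    and otens_munit:
      "X \<in> Obj C \<Longrightarrow> otens C (munit C) X = X"
      "X \<in> Obj C \<Longrightarrow> otens C X (munit C) = X"
    and otens_assoc:
      "\<lbrakk>X \<in> Obj C; Y \<in> Obj C; Z \<in> Obj C\<rbrakk>
        \<Longrightarrow> otens C (otens C X Y) Z = otens C X (otens C Y Z)"
    and mtens_closed:
      "\<lbrakk>X \<in> Obj C; Y \<in> Obj C; X' \<in> Obj C; Y' \<in> Obj C;
        f \<in> hom_set C X Y; f' \<in> hom_set C X' Y'\<rbrakk>
        \<Longrightarrow> mtens C f f' \<in> hom_set C (otens C X X') (otens C Y Y')"
    and mtens_ident:
      "\<lbrakk>X \<in> Obj C; Y \<in> Obj C\<rbrakk>
        \<Longrightarrow> mtens C (ident C X) (ident C Y) = ident C (otens C X Y)"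
    and mtens_munit:
      "\<lbrakk>X \<in> Obj C; Y \<in> Obj C; f \<in> hom_set C X Y\<rbrakk>
        \<Longrightarrow> mtens C (ident C (munit C)) f = f"
      "\<lbrakk>X \<in> Obj C; Y \<in> Obj C; f \<in> hom_set C X Y\<rbrakk>
        \<Longrightarrow> mtens C f (ident C (munit C)) = f"
    and mtens_assoc:
      "\<lbrakk>X \<in> Obj C; Y \<in> Obj C; X' \<in> Obj C; Y' \<in> Obj C; X'' \<in> Obj C; Y'' \<in> Obj C;
        f \<in> hom_set C X Y; f' \<in> hom_set C X' Y'; f'' \<in> hom_set C X'' Y''\<rbrakk>
        \<Longrightarrow> mtens C (mtens C f f') f'' = mtens C f (mtens C f' f'')"
    and interchange:
      "\<lbrakk>X \<in> Obj C; Y \<in> Obj C; Z \<in> Obj C; X' \<in> Obj C; Y' \<in> Obj C; Z' \<in> Obj C;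
        f \<in> hom_set C X Y; g \<in> hom_set C Y Z; f' \<in> hom_set C X' Y'; g' \<in> hom_set C Y' Z'\<rbrakk>
        \<Longrightarrow> ccomp C (mtens C g g') (mtens C f f') = mtens C (ccomp C g f) (ccomp C g' f')"
    and mtens_bilinear:
      "\<lbrakk>X \<in> Obj C; Y \<in> Obj C; X' \<in> Obj C; Y' \<in> Obj C;
        f \<in> hom_set C X Y; g \<in> hom_set C X Y; f' \<in> hom_set C X' Y'\<rbrakk>
        \<Longrightarrow> mtens C (f \<oplus>\<^bsub>Hom C X Y\<^esub> g) f'
          = mtens C f f' \<oplus>\<^bsub>Hom C (otens C X X') (otens C Y Y')\<^esub> mtens C g f'"
      "\<lbrakk>X \<in> Obj C; Y \<in> Obj C; X' \<in> Obj C; Y' \<in> Obj C;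
        f \<in> hom_set C X Y; f' \<in> hom_set C X' Y'; g' \<in> hom_set C X' Y'\<rbrakk>
        \<Longrightarrow> mtens C f (f' \<oplus>\<^bsub>Hom C X' Y'\<^esub> g')
          = mtens C f f' \<oplus>\<^bsub>Hom C (otens C X X') (otens C Y Y')\<^esub> mtens C f g'"
      "\<lbrakk>X \<in> Obj C; Y \<in> Obj C; X' \<in> Obj C; Y' \<in> Obj C;
        f \<in> hom_set C X Y; f' \<in> hom_set C X' Y'\<rbrakk>
        \<Longrightarrow> mtens C (c \<odot>\<^bsub>Hom C X Y\<^esub> f) f'
          = c \<odot>\<^bsub>Hom C (otens C X X') (otens C Y Y')\<^esub> mtens C f f'"
      "\<lbrakk>X \<in> Obj C; Y \<in> Obj C; X' \<in> Obj C; Y' \<in> Obj C;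
        f \<in> hom_set C X Y; f' \<in> hom_set C X' Y'\<rbrakk>
        \<Longrightarrow> mtens C f (c \<odot>\<^bsub>Hom C X' Y'\<^esub> f')
          = c \<odot>\<^bsub>Hom C (otens C X X') (otens C Y Y')\<^esub> mtens C f f'"

locale graded_linear_monoidal_category = strict_linear_monoidal_category C
  for C :: "('o, 'm, 'k::comm_ring_1) linear_monoidal_cat" +
  fixes G :: "'a::ab_group_add \<Rightarrow> 'o \<Rightarrow> 'o \<Rightarrow> 'm set"
  assumes homogeneous_submodule:
      "\<lbrakk>X \<in> Obj C; Y \<in> Obj C\<rbrakk> \<Longrightarrow> submodule (G a X Y) scalar_ring (Hom C X Y)"
    and direct_sum:
      "\<lbrakk>X \<in> Obj C; Y \<in> Obj C; f \<in> hom_set C X Y\<rbrakk> \<Longrightarrow>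
        \<exists>!h. (\<forall>a. h a \<in> G a X Y) \<and> finite {a. h a \<noteq> \<zero>\<^bsub>Hom C X Y\<^esub>}
          \<and> f = finsum (Hom C X Y) h {a. h a \<noteq> \<zero>\<^bsub>Hom C X Y\<^esub>}"
    and ident_degree: "X \<in> Obj C \<Longrightarrow> ident C X \<in> G 0 X X"
    and ccomp_degree:
      "\<lbrakk>X \<in> Obj C; Y \<in> Obj C; Z \<in> Obj C; f \<in> G a X Y; g \<in> G b Y Z\<rbrakk>
        \<Longrightarrow> ccomp C g f \<in> G (a + b) X Z"
    and mtens_degree:
      "\<lbrakk>X \<in> Obj C; Y \<in> Obj C; X' \<in> Obj C; Y' \<in> Obj C; f \<in> G a X Y; f' \<in> G b X' Y'\<rbrakk>
        \<Longrightarrow> mtens C f f' \<in> G (a + b) (otens C X X') (otens C Y Y')"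

text \<open>The grading induced along a map of degrees: the degree \<open>n\<close> part is
  the sum of the parts whose degree is sent to \<open>n\<close>.\<close>

definition induced_grading ::
    "('a \<Rightarrow> 'c) \<Rightarrow> ('o, 'm, 'k) linear_monoidal_cat \<Rightarrow> ('a \<Rightarrow> 'o \<Rightarrow> 'o \<Rightarrow> 'm set)
      \<Rightarrow> 'c \<Rightarrow> 'o \<Rightarrow> 'o \<Rightarrow> 'm set" where
  "induced_grading \<pi> C G n X Y =
     {finsum (Hom C X Y) h A | h A. finite A \<and> (\<forall>a\<in>A. \<pi> a = n \<and> h a \<in> G a X Y)}"


section \<open>Coxeter systems\<close>

definition coxeter_matrix :: "'s set \<Rightarrow> ('s \<Rightarrow> 's \<Rightarrow> enat) \<Rightarrow> bool" where
  "coxeter_matrix S m \<longleftrightarrow>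
     (\<forall>s\<in>S. m s s = 1) \<and> (\<forall>s\<in>S. \<forall>t\<in>S. m s t = m t s \<and> (s \<noteq> t \<longrightarrow> 2 \<le> m s t))"

text \<open>The congruence on words generated by \<open>(s t)^m(s,t) = 1\<close>; since it contains
  \<open>s s = 1\<close>, its quotient monoid is the group presented by these relations.\<close>

inductive coxeter_congruence :: "'s set \<Rightarrow> ('s \<Rightarrow> 's \<Rightarrow> enat) \<Rightarrow> 's list \<Rightarrow> 's list \<Rightarrow> bool"
  for S m where
  "\<lbrakk>s \<in> S; t \<in> S; m s t = enat n\<rbrakk> \<Longrightarrow> coxeter_congruence S m (concat (replicate n [s, t])) []"
| "w \<in> lists S \<Longrightarrow> coxeter_congruence S m w w"
| "coxeter_congruence S m u v \<Longrightarrow> coxeter_congruence S m v u"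
| "\<lbrakk>coxeter_congruence S m u v; coxeter_congruence S m v w\<rbrakk> \<Longrightarrow> coxeter_congruence S m u w"
| "\<lbrakk>coxeter_congruence S m u v; x \<in> lists S; y \<in> lists S\<rbrakk>
    \<Longrightarrow> coxeter_congruence S m (x @ u @ y) (x @ v @ y)"

definition coxeter_system :: "'s monoid \<Rightarrow> 's set \<Rightarrow> ('s \<Rightarrow> 's \<Rightarrow> enat) \<Rightarrow> bool" where
  "coxeter_system W S m \<longleftrightarrow>
     coxeter_matrix S m \<and> Group.group W \<and> S \<subseteq> carrier W \<and> generate W S = carrier W \<and>
     (\<forall>u\<in>lists S. \<forall>v\<in>lists S.
        foldr (monoid.mult W) u (one W) = foldr (monoid.mult W) v (one W) \<longleftrightarrow> coxeter_congruence S m u v)"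


section \<open>Realizations\<close>

text \<open>The free module of finite rank is \<open>V = k^B\<close> for the finite set
  \<open>B = basis D\<close>, and \<open>Sym(V)\<close> is the polynomial ring in the variables \<open>B\<close>.\<close>

type_synonym ('b, 'k) polys = "('b \<Rightarrow>\<^sub>0 nat) \<Rightarrow>\<^sub>0 'k"

record ('s, 'b, 'k) realization =
  simples :: "'s set"
  cox :: "'s \<Rightarrow> 's \<Rightarrow> enat"
  basis :: "'b set"
  simple_root :: "'s \<Rightarrow> ('b \<Rightarrow>\<^sub>0 'k)"
  simple_coroot :: "'s \<Rightarrow> ('b \<Rightarrow>\<^sub>0 'k) \<Rightarrow> 'k"

definition vspace :: "('s, 'b, 'k::comm_ring_1) realization \<Rightarrow> ('b \<Rightarrow>\<^sub>0 'k) set" where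
  "vspace D = {v. Poly_Mapping.keys v \<subseteq> basis D}"

definition vscale :: "'k::comm_ring_1 \<Rightarrow> ('b \<Rightarrow>\<^sub>0 'k) \<Rightarrow> ('b \<Rightarrow>\<^sub>0 'k)" where
  "vscale c v = Poly_Mapping.map ((*) c) v"

definition reflect :: "('s, 'b, 'k::comm_ring_1) realization \<Rightarrow> 's \<Rightarrow> ('b \<Rightarrow>\<^sub>0 'k) \<Rightarrow> ('b \<Rightarrow>\<^sub>0 'k)" where
  "reflect D s v = v - vscale (simple_coroot D s v) (simple_root D s)"

definition is_realization :: "'s monoid \<Rightarrow> ('s, 'b, 'k::comm_ring_1) realization \<Rightarrow> bool" where
  "is_realization W D \<longleftrightarrow>
     finite (basis D) \<and>
     (\<forall>s\<in>simples D.
        simple_root D s \<in> vspace D \<and>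
        (\<forall>v\<in>vspace D. \<forall>w\<in>vspace D. simple_coroot D s (v + w) = simple_coroot D s v + simple_coroot D s w) \<and>
        (\<forall>c. \<forall>v\<in>vspace D. simple_coroot D s (vscale c v) = c * simple_coroot D s v) \<and>
        simple_coroot D s (simple_root D s) = 2) \<and>
     (\<exists>\<phi>. group_action W (vspace D) \<phi> \<and>
        (\<forall>s\<in>simples D. \<forall>v\<in>vspace D. \<phi> s v = reflect D s v))"


subsection \<open>The symmetric algebra\<close>

definition poly_ring :: "('s, 'b, 'k::comm_ring_1) realization \<Rightarrow> ('b, 'k) polys set" where
  "poly_ring D = {p. \<forall>e\<in>Poly_Mapping.keys p. Poly_Mapping.keys e \<subseteq> basis D}"

definition const :: "'k::comm_ring_1 \<Rightarrow> ('b, 'k) polys" where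
  "const c = Poly_Mapping.single 0 c"

definition var :: "'b \<Rightarrow> ('b, 'k::comm_ring_1) polys" where
  "var b = Poly_Mapping.single (Poly_Mapping.single b 1) 1"

definition linear_poly :: "('b \<Rightarrow>\<^sub>0 'k::comm_ring_1) \<Rightarrow> ('b, 'k) polys" where
  "linear_poly v = (\<Sum>b\<in>Poly_Mapping.keys v. const (Poly_Mapping.lookup v b) * var b)"

definition substitute ::
    "('k::comm_ring_1 \<Rightarrow> 'r::comm_ring_1) \<Rightarrow> ('b \<Rightarrow> 'r) \<Rightarrow> ('b, 'k) polys \<Rightarrow> 'r" where
  "substitute h f p = (\<Sum>e\<in>Poly_Mapping.keys p. h (Poly_Mapping.lookup p e) *
     (\<Prod>b\<in>Poly_Mapping.keys e. f b ^ Poly_Mapping.lookup e b))"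

definition reflect_sym ::
    "('s, 'b, 'k::comm_ring_1) realization \<Rightarrow> 's \<Rightarrow> ('b, 'k) polys \<Rightarrow> ('b, 'k) polys" where
  "reflect_sym D s =
     substitute const (\<lambda>b. linear_poly (reflect D s (Poly_Mapping.single b 1)))"

text \<open>The quotient of \<open>p - s(p)\<close> by the root has to make sense also when the root is a
  zero divisor of \<open>Sym(V)\<close>. The reflection on \<open>Sym(V)\<close> is obtained from the ring
  homomorphism \<open>Sym(V) \<rightarrow> Sym(V)[T]\<close>, \<open>v \<mapsto> v - coroot(v) T\<close>, by putting
  \<open>T = root\<close>; division by \<open>T\<close> before putting \<open>T = root\<close> is always possible.\<close>

definition reflect_generic ::
    "('s, 'b, 'k::comm_ring_1) realization \<Rightarrow> 's \<Rightarrow> ('b, 'k) polys \<Rightarrow> ('b, 'k) polys poly" where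
  "reflect_generic D s =
     substitute (\<lambda>c. [:const c:])
       (\<lambda>b. [:var b, - const (simple_coroot D s (Poly_Mapping.single b 1)):])"

definition demazure ::
    "('s, 'b, 'k::comm_ring_1) realization \<Rightarrow> 's \<Rightarrow> ('b, 'k) polys \<Rightarrow> ('b, 'k) polys" where
  "demazure D s p =
     poly (poly_shift 1 ([:p:] - reflect_generic D s p)) (linear_poly (simple_root D s))"

lemma lp_superset: "\<lbrakk>finite A; Poly_Mapping.keys v \<subseteq> A\<rbrakk>
    \<Longrightarrow> linear_poly v = (\<Sum>b\<in>A. const (Poly_Mapping.lookup v b) * var b)"
  unfolding linear_poly_def by (rule sum.mono_neutral_left) (auto simp: in_keys_iff const_def)

lemma const_diff: "const (a - b :: 'k::comm_ring_1) = (const a - const b :: ('b,'k) polys)"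
  by (simp add: const_def single_diff)
lemma const_mult: "const (a * b :: 'k::comm_ring_1) = (const a * const b :: ('b,'k) polys)"
  by (simp add: const_def mult_single)

lemma lookup_vscale: "Poly_Mapping.lookup (vscale c v) b = c * Poly_Mapping.lookup v b"
  by (simp add: vscale_def Poly_Mapping.map.rep_eq when_def)

lemma linear_poly_diff: "linear_poly (v - vscale c w) = linear_poly v - const c * linear_poly w"
proof -
  let ?A = "Poly_Mapping.keys v \<union> Poly_Mapping.keys w \<union> Poly_Mapping.keys (v - vscale c w)"
  show ?thesis
    apply (subst (1 2 3) lp_superset[of ?A])
    apply (auto simp: sum_distrib_left sum_subtractf[symmetric] lookup_minus lookup_vscale const_diff const_mult algebra_simps)
    done
qed

lemma linear_poly_single: "linear_poly (Poly_Mapping.single b 1) = (var b :: ('b,'k::comm_ring_1) polys)"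
  by (simp add: linear_poly_def const_def var_def mult_single)

lemma poly_reflect_generic:
  "poly (reflect_generic D s p) (linear_poly (simple_root D s)) = reflect_sym D s p"
  unfolding reflect_generic_def reflect_sym_def substitute_def
  by (simp add: poly_sum poly_prod reflect_def linear_poly_diff linear_poly_single algebra_simps)

lemma single_prod: fixes e :: "'b \<Rightarrow>\<^sub>0 nat"
  shows "(\<Prod>b\<in>Poly_Mapping.keys e. (var b :: ('b,'k::comm_ring_1) polys) ^ Poly_Mapping.lookup e b) = Poly_Mapping.single e 1"
proof -
  have pw: "(var b :: ('b,'k) polys) ^ n = Poly_Mapping.single (Poly_Mapping.single b n) 1" for b n
    by (induction n) (auto simp: var_def mult_single single_add[symmetric])
  have "(\<Prod>b\<in>A. Poly_Mapping.single (f b) (1::'k)) = Poly_Mapping.single (\<Sum>b\<in>A. f b) 1" if "finite A" for A and f :: "'b \<Rightarrow> 'b \<Rightarrow>\<^sub>0 nat"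
    using that by induction (auto simp: mult_single)
  moreover have "(\<Sum>b\<in>Poly_Mapping.keys e. Poly_Mapping.single b (Poly_Mapping.lookup e b)) = e"
    by (rule poly_mapping_eqI) (auto simp: lookup_sum lookup_single when_def in_keys_iff)
  ultimately show ?thesis by (simp add: pw)
qed

lemma substitute_id: "substitute const var p = (p :: ('b,'k::comm_ring_1) polys)"
proof -
  have "substitute const var p = (\<Sum>e\<in>Poly_Mapping.keys p. Poly_Mapping.single e (Poly_Mapping.lookup p e))"
    unfolding substitute_def single_prod by (simp add: const_def mult_single)
  also have "\<dots> = p" 
    by (rule poly_mapping_eqI) (auto simp: lookup_sum lookup_single when_def in_keys_iff)
  finally show ?thesis .
qed

lemma reflect_generic_0: "poly (reflect_generic D s p) 0 = p"
proof -
  have "poly (reflect_generic D s p) 0 = substitute const var p"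
    unfolding reflect_generic_def substitute_def by (simp add: poly_sum poly_prod)
  then show ?thesis by (simp add: substitute_id)
qed

lemma demazure_quotient:
  "linear_poly (simple_root D s) * demazure D s p = p - reflect_sym D s p"
proof -
  define q where "q = [:p:] - reflect_generic D s p"
  have q0: "coeff q 0 = 0" using reflect_generic_0[of D s p] by (simp add: q_def poly_0_coeff_0)
  have "q = pCons 0 (poly_shift 1 q)" 
    by (rule poly_eqI) (auto simp: coeff_pCons coeff_poly_shift q0 split: nat.split)
  then have "poly q x = x * poly (poly_shift 1 q) x" for x by (metis poly_pCons add_0)
  then show ?thesis unfolding demazure_def q_def[symmetric]
    by (metis q_def poly_diff poly_reflect_generic poly_pCons poly_0 mult_zero_right add_0_right)
qed

definition homogeneous_poly :: "nat \<Rightarrow> ('b, 'k::comm_ring_1) polys \<Rightarrow> bool" where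
  "homogeneous_poly d p \<longleftrightarrow>
     (\<forall>e\<in>Poly_Mapping.keys p. (\<Sum>b\<in>Poly_Mapping.keys e. Poly_Mapping.lookup e b) = d)"


section \<open>The two-colored Temperley--Lieb category\<close>

text \<open>A crossingless matching from \<open>a\<close> bottom points to \<open>b\<close> top points is a partition of
  the points \<open>(0, i)\<close>, \<open>i < a\<close>, and \<open>(1, j)\<close>, \<open>j < b\<close>, into pairs, numbered from
  left to right; \<open>boundary_pos\<close> is the position on the boundary of the strip, walking
  along the bottom from left to right and back along the top. The planar regions
  are colored alternately, so only the color of the leftmost one has to be remembered.\<close>

type_synonym matching = "(nat \<times> nat) set set"

definition tl_points :: "nat \<Rightarrow> nat \<Rightarrow> (nat \<times> nat) set" where
  "tl_points a b = {0} \<times> {..<a} \<union> {1} \<times> {..<b}"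

definition boundary_pos :: "nat \<Rightarrow> nat \<Rightarrow> nat \<times> nat \<Rightarrow> nat" where
  "boundary_pos a b x = (if fst x = 0 then snd x else a + b - 1 - snd x)"

definition crossingless :: "nat \<Rightarrow> nat \<Rightarrow> matching set" where
  "crossingless a b = {M. partition_on (tl_points a b) M \<and> (\<forall>e\<in>M. card e = 2) \<and>
     (\<nexists>x x' y y'. {x, x'} \<in> M \<and> {y, y'} \<in> M \<and>
        boundary_pos a b x < boundary_pos a b y \<and>
        boundary_pos a b y < boundary_pos a b x' \<and>
        boundary_pos a b x' < boundary_pos a b y')}"

definition tl_id :: "nat \<Rightarrow> matching" where
  "tl_id n = {{(0, i), (1, i)} | i. i < n}"

definition tl_cap :: "nat \<Rightarrow> nat \<Rightarrow> matching" where
  "tl_cap n i = {{(0, i), (0, i + 1)}} \<union> {{(0, j), (1, j)} | j. j < i} \<union>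
     {{(0, j + 2), (1, j)} | j. i \<le> j \<and> j + 2 < n}"

definition tl_cup :: "nat \<Rightarrow> nat \<Rightarrow> matching" where
  "tl_cup n i = {{(1, i), (1, i + 1)}} \<union> {{(0, j), (1, j)} | j. j < i} \<union>
     {{(0, j), (1, j + 2)} | j. i \<le> j \<and> j < n}"

text \<open>\<open>E\<close> stacked on top of \<open>D\<close>: the points of level 1 are in the middle. The
  connected components living on level 1 are the circles, the other ones the arcs
  of the composite matching.\<close>

definition tl_stack :: "matching \<Rightarrow> matching \<Rightarrow> matching" where
  "tl_stack E D = D \<union> (\<lambda>e. map_prod Suc id ` e) ` E"

definition tl_components :: "matching \<Rightarrow> matching \<Rightarrow> matching" where
  "tl_components E D =
     \<Union>(tl_stack E D) // {(x, y). \<exists>e\<in>tl_stack E D. x \<in> e \<and> y \<in> e}\<^sup>+"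

definition tl_circles :: "matching \<Rightarrow> matching \<Rightarrow> matching" where
  "tl_circles E D = {Z \<in> tl_components E D. Z \<subseteq> {1} \<times> UNIV}"

definition tl_comp :: "matching \<Rightarrow> matching \<Rightarrow> matching" where
  "tl_comp E D = (\<lambda>Z. map_prod (\<lambda>l. if l = 0 then 0 else 1) id ` (Z - {1} \<times> UNIV)) `
     (tl_components E D - tl_circles E D)"

text \<open>\<open>\<delta> j\<close> is the value of a circle whose interior has the color of the \<open>j\<close>-th region
  (counted from the left, starting with 0) of a horizontal line. On the middle line, the
  interior of a circle lies to the right of its leftmost point.\<close>

definition tl_weight :: "(nat \<Rightarrow> 'k::comm_ring_1) \<Rightarrow> matching \<Rightarrow> matching \<Rightarrow> 'k" where
  "tl_weight \<delta> E D = (\<Prod>Z\<in>tl_circles E D. \<delta> (Suc (Min (snd ` Z))))"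

definition tl_hom :: "nat \<Rightarrow> nat \<Rightarrow> (matching \<Rightarrow> 'k::comm_ring_1) set" where
  "tl_hom a b = {x. \<forall>M. x M \<noteq> 0 \<longrightarrow> M \<in> crossingless a b}"

definition tl_basis :: "matching \<Rightarrow> matching \<Rightarrow> 'k::comm_ring_1" where
  "tl_basis M = (\<lambda>N. if N = M then 1 else 0)"

definition tl_mult ::
    "(nat \<Rightarrow> 'k::comm_ring_1) \<Rightarrow> nat \<Rightarrow> nat \<Rightarrow> nat \<Rightarrow>
      (matching \<Rightarrow> 'k) \<Rightarrow> (matching \<Rightarrow> 'k) \<Rightarrow> matching \<Rightarrow> 'k" where
  "tl_mult \<delta> a b c y x N =
     (\<Sum>(E, D) \<in> {(E, D). E \<in> crossingless b c \<and> D \<in> crossingless a b \<and> tl_comp E D = N}.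
        y E * x D * tl_weight \<delta> E D)"

definition is_jones_wenzl :: "(nat \<Rightarrow> 'k::comm_ring_1) \<Rightarrow> nat \<Rightarrow> (matching \<Rightarrow> 'k) \<Rightarrow> bool" where
  "is_jones_wenzl \<delta> n x \<longleftrightarrow>
     x \<in> tl_hom n n \<and> tl_mult \<delta> n n n x x = x \<and> x (tl_id n) = 1 \<and>
     (\<forall>i. i + 2 \<le> n \<longrightarrow>
        tl_mult \<delta> n n (n - 2) (tl_basis (tl_cap n i)) x = (\<lambda>_. 0) \<and>
        tl_mult \<delta> (n - 2) n n x (tl_basis (tl_cup (n - 2) i)) = (\<lambda>_. 0))"

text \<open>Rotation by one strand: the leftmost bottom point moves to the top left, the
  rightmost top point moves to the bottom right. The two colors are exchanged.\<close>

definition tl_rotate :: "nat \<Rightarrow> matching \<Rightarrow> matching" where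
  "tl_rotate n M = (\<lambda>e. (\<lambda>(l, i). if l = 0 then (if i = 0 then (1, 0) else (0, i - 1))
       else (if i + 1 = n then (0, n - 1) else (1, i + 1))) ` e) ` M"

definition circle_value ::
    "('s, 'b, 'k::comm_ring_1) realization \<Rightarrow> 's \<Rightarrow> 's \<Rightarrow> nat \<Rightarrow> 'k" where
  "circle_value D s t j =
     (if even j then simple_coroot D t (simple_root D s) else simple_coroot D s (simple_root D t))"

definition bond :: "('s, 'b, 'k) realization \<Rightarrow> 's \<Rightarrow> 's \<Rightarrow> nat" where
  "bond D s t = the_enat (cox D s t)"

text \<open>The coefficients of the Jones--Wenzl projector on \<open>m(s,t) - 1\<close> strands whose leftmost
  region is colored \<open>s\<close>.\<close>

definition jones_wenzl ::
    "('s, 'b, 'k::comm_ring_1) realization \<Rightarrow> 's \<Rightarrow> 's \<Rightarrow> (matching \<Rightarrow> 'k) \<Rightarrow> bool" where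
  "jones_wenzl D s t x \<longleftrightarrow> is_jones_wenzl (circle_value D s t) (bond D s t - 1) x"

text \<open>Both rotations by one strand of one projector are multiples of the other one.\<close>

definition rotatable :: "nat \<Rightarrow> (matching \<Rightarrow> 'k::comm_ring_1) \<Rightarrow> (matching \<Rightarrow> 'k) \<Rightarrow> bool" where
  "rotatable n x y \<longleftrightarrow>
     (\<exists>c. \<forall>M\<in>crossingless n n. x M = c * y (tl_rotate n M)) \<and>
     (\<exists>c. \<forall>M\<in>crossingless n n. x (tl_rotate n M) = c * y M)"

definition well_defined :: "('s, 'b, 'k::comm_ring_1) realization \<Rightarrow> bool" where
  "well_defined D \<longleftrightarrow>
     \<not> (\<exists>s\<in>simples D. \<exists>t\<in>simples D. \<exists>u\<in>simples D.
          cox D s t = 5 \<and> cox D t u = 3 \<and> cox D s u = 2) \<and>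
     (\<forall>s\<in>simples D. simple_coroot D s ` vspace D = UNIV) \<and>
     (\<forall>s\<in>simples D. \<forall>t\<in>simples D. s \<noteq> t \<and> cox D s t \<noteq> \<infinity> \<longrightarrow>
        (\<exists>x y. jones_wenzl D s t x \<and> jones_wenzl D t s y \<and> rotatable (bond D s t - 1) x y))"


section \<open>The diagrammatic Hecke category\<close>

subsection \<open>Diagrams\<close>

text \<open>\<open>Comp g f\<close> is \<open>g\<close> on top of \<open>f\<close>, \<open>Tens f g\<close> is \<open>f\<close> to the left of \<open>g\<close>.\<close>

datatype ('s, 'b, 'k::zero) diag =
    Idn "'s list"
  | Box "('b \<Rightarrow>\<^sub>0 nat) \<Rightarrow>\<^sub>0 'k"
  | Start 's
  | End 's
  | Split 's
  | Merge 's
  | Vert 's 's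
  | Comp "('s, 'b, 'k) diag" "('s, 'b, 'k) diag"  (infixr \<open>\<cdot>\<close> 65)
  | Tens "('s, 'b, 'k) diag" "('s, 'b, 'k) diag"  (infixr \<open>\<star>\<close> 70)
  | Zero "'s list" "'s list"
  | Plus "('s, 'b, 'k) diag" "('s, 'b, 'k) diag"
  | Scale 'k "('s, 'b, 'k) diag"

fun alternating :: "'s \<Rightarrow> 's \<Rightarrow> nat \<Rightarrow> 's list" where
  "alternating s t 0 = []"
| "alternating s t (Suc n) = s # alternating t s n"

text \<open>\<open>vword D s t\<close> is the word \<open>s t s \<dots>\<close> of length \<open>m(s,t)\<close>.\<close>

definition vword :: "('s, 'b, 'k) realization \<Rightarrow> 's \<Rightarrow> 's \<Rightarrow> 's list" where
  "vword D s t = alternating s t (bond D s t)"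

inductive has_type ::
    "('s, 'b, 'k::comm_ring_1) realization \<Rightarrow> 's list \<Rightarrow> 's list \<Rightarrow> ('s, 'b, 'k) diag \<Rightarrow> bool"
  for D where
  "X \<in> lists (simples D) \<Longrightarrow> has_type D X X (Idn X)"
| "p \<in> poly_ring D \<Longrightarrow> has_type D [] [] (Box p)"
| "s \<in> simples D \<Longrightarrow> has_type D [] [s] (Start s)"
| "s \<in> simples D \<Longrightarrow> has_type D [s] [] (End s)"
| "s \<in> simples D \<Longrightarrow> has_type D [s] [s, s] (Split s)"
| "s \<in> simples D \<Longrightarrow> has_type D [s, s] [s] (Merge s)"
| "\<lbrakk>s \<in> simples D; t \<in> simples D; s \<noteq> t; cox D s t \<noteq> \<infinity>\<rbrakk>
    \<Longrightarrow> has_type D (vword D s t) (vword D t s) (Vert s t)"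
| "\<lbrakk>has_type D X Y f; has_type D Y Z g\<rbrakk> \<Longrightarrow> has_type D X Z (g \<cdot> f)"
| "\<lbrakk>has_type D X Y f; has_type D X' Y' f'\<rbrakk> \<Longrightarrow> has_type D (X @ X') (Y @ Y') (f \<star> f')"
| "\<lbrakk>X \<in> lists (simples D); Y \<in> lists (simples D)\<rbrakk> \<Longrightarrow> has_type D X Y (Zero X Y)"
| "\<lbrakk>has_type D X Y f; has_type D X Y g\<rbrakk> \<Longrightarrow> has_type D X Y (Plus f g)"
| "has_type D X Y f \<Longrightarrow> has_type D X Y (Scale c f)"

definition Cup :: "'s \<Rightarrow> ('s, 'b, 'k::comm_ring_1) diag" where
  "Cup s = Split s \<cdot> Start s"

definition Cap :: "'s \<Rightarrow> ('s, 'b, 'k::comm_ring_1) diag" where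
  "Cap s = End s \<cdot> Merge s"


subsection \<open>Deformation retracts of crossingless matchings\<close>

text \<open>A matching is drawn as a sequence of slices, read from bottom to top, each having a
  single cap or cup (joining, respectively creating, the strands \<open>i\<close> and
  \<open>i + 1\<close>). In the deformation retract of the regions, a cap ends the region between its
  two strands and merges the regions on both sides; a cup does the opposite.\<close>

datatype slice = SCap nat | SCup nat

fun slice_target :: "nat \<Rightarrow> slice \<Rightarrow> nat" where
  "slice_target n (SCap i) = n - 2"
| "slice_target n (SCup i) = n + 2"

fun slice_matching :: "nat \<Rightarrow> slice \<Rightarrow> matching" where
  "slice_matching n (SCap i) = tl_cap n i"
| "slice_matching n (SCup i) = tl_cup n i"

fun slice_valid :: "nat \<Rightarrow> slice \<Rightarrow> bool" where
  "slice_valid n (SCap i) \<longleftrightarrow> i + 2 \<le> n"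
| "slice_valid n (SCup i) \<longleftrightarrow> i \<le> n"

inductive draws :: "nat \<Rightarrow> nat \<Rightarrow> slice list \<Rightarrow> matching \<Rightarrow> bool" where
  "draws n n [] (tl_id n)"
| "\<lbrakk>slice_valid a g; draws (slice_target a g) b gs M;
    tl_circles M (slice_matching a g) = {}\<rbrakk>
    \<Longrightarrow> draws a b (g # gs) (tl_comp M (slice_matching a g))"

definition region_color :: "'s \<Rightarrow> 's \<Rightarrow> nat \<Rightarrow> 's" where
  "region_color s t j = (if even j then s else t)"

text \<open>A line with \<open>n\<close> strands and leftmost color \<open>s\<close> becomes \<open>alternating s t (n + 1)\<close>.\<close>

fun slice_retract :: "'s \<Rightarrow> 's \<Rightarrow> nat \<Rightarrow> slice \<Rightarrow> ('s, 'b, 'k::comm_ring_1) diag" where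
  "slice_retract s t n (SCap i) =
     (let r = region_color s t i; q = region_color s t (i + 1) in
      Idn (take i (alternating s t (n + 1)))
      \<star> (Merge r \<cdot> (Idn [r] \<star> End q \<star> Idn [r]))
      \<star> Idn (drop (i + 3) (alternating s t (n + 1))))"
| "slice_retract s t n (SCup i) =
     (let r = region_color s t i; q = region_color s t (i + 1) in
      Idn (take i (alternating s t (n + 1)))
      \<star> ((Idn [r] \<star> Start q \<star> Idn [r]) \<cdot> Split r)
      \<star> Idn (drop (i + 1) (alternating s t (n + 1))))"

fun retract :: "'s \<Rightarrow> 's \<Rightarrow> nat \<Rightarrow> slice list \<Rightarrow> ('s, 'b, 'k::comm_ring_1) diag" where
  "retract s t n [] = Idn (alternating s t (n + 1))"
| "retract s t n (g # gs) = retract s t (slice_target n g) gs \<cdot> slice_retract s t n g"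

text \<open>\<open>jw_diagram D s t j\<close>: the linear combination of diagrams \<open>j\<close> represents \<open>JW\<close>. It depends
  on the order \<open>Ms\<close> of the summands and on the drawing \<open>d M\<close> of each matching \<open>M\<close>,
  but its class in the Hecke category does not.\<close>

inductive jw_diagram ::
    "('s, 'b, 'k::comm_ring_1) realization \<Rightarrow> 's \<Rightarrow> 's \<Rightarrow> ('s, 'b, 'k) diag \<Rightarrow> bool" for D where
  "\<lbrakk>jones_wenzl D s t x; n = bond D s t - 1; distinct Ms; set Ms = crossingless n n;
    \<forall>M\<in>set Ms. draws n n (d M) M\<rbrakk>
    \<Longrightarrow> jw_diagram D s t
          (foldr (\<lambda>M. Plus (Scale (x M) (retract s t n (d M)))) Ms
             (Zero (vword D s t) (vword D s t)))"


subsection \<open>Paths of words\<close>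

text \<open>The vertex for a braid move between two words differing by such a move (found at the first
  letter where the words differ), and the composite along a path of words.\<close>

fun move :: "('s, 'b, 'k::comm_ring_1) realization \<Rightarrow> 's list \<Rightarrow> 's list \<Rightarrow> ('s, 'b, 'k) diag" where
  "move D (x # u) (y # v) =
     (if x = y then Idn [x] \<star> move D u v
      else Vert x y \<star> Idn (drop (bond D x y) (x # u)))"
| "move D _ _ = Idn []"

fun path_diag :: "('s, 'b, 'k::comm_ring_1) realization \<Rightarrow> 's list list \<Rightarrow> ('s, 'b, 'k) diag" where
  "path_diag D (u # v # ws) = path_diag D (v # ws) \<cdot> move D u v"
| "path_diag D [w] = Idn w"
| "path_diag D [] = Idn []"

definition slide :: "'s \<Rightarrow> 's list \<Rightarrow> 's list list" where
  "slide u w = map (\<lambda>i. take i w @ u # drop i w) [0..<Suc (length w)]"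

definition A3_path1 :: "'s \<Rightarrow> 's \<Rightarrow> 's \<Rightarrow> 's list list" where
  "A3_path1 s t u =
    [[s, t, s, u, t, s],
     [s, t, u, s, t, s],
     [s, t, u, t, s, t],
     [s, u, t, u, s, t],
     [u, s, t, u, s, t],
     [u, s, t, s, u, t],
     [u, t, s, t, u, t],
     [u, t, s, u, t, u],
     [u, t, u, s, t, u]]"

definition A3_path2 :: "'s \<Rightarrow> 's \<Rightarrow> 's \<Rightarrow> 's list list" where
  "A3_path2 s t u =
    [[s, t, s, u, t, s],
     [t, s, t, u, t, s],
     [t, s, u, t, u, s],
     [t, u, s, t, u, s],
     [t, u, s, t, s, u],
     [t, u, t, s, t, u],
     [u, t, u, s, t, u]]"

text \<open>Type \<open>B3\<close> with \<open>m(s,t) = 3\<close>, \<open>m(t,u) = 4\<close>, \<open>m(s,u) = 2\<close>: the two ways around the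
  14-cycle of reduced words of the longest element, starting from \<open>121321323\<close>.
  Of the 14 possible starting words, precisely \<open>121321323\<close>, \<open>132312132\<close> and their
  reversals give an equality of maps of Bott--Samelson bimodules; up to commutations, the
  boundaries of these four relations are rotations of each other.\<close>

definition B3_path1 :: "'s \<Rightarrow> 's \<Rightarrow> 's \<Rightarrow> 's list list" where
  "B3_path1 s t u =
    [[s, t, s, u, t, s, u, t, u],
     [s, t, u, s, t, s, u, t, u],
     [s, t, u, t, s, t, u, t, u],
     [s, t, u, t, s, u, t, u, t],
     [s, t, u, t, u, s, t, u, t],
     [s, u, t, u, t, s, t, u, t],
     [s, u, t, u, s, t, s, u, t],
     [u, s, t, u, s, t, s, u, t],
     [u, s, t, s, u, t, s, u, t],
     [u, t, s, t, u, t, s, u, t],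
     [u, t, s, t, u, t, u, s, t],
     [u, t, s, u, t, u, t, s, t],
     [u, t, u, s, t, u, t, s, t],
     [u, t, u, s, t, u, s, t, s]]"

definition B3_path2 :: "'s \<Rightarrow> 's \<Rightarrow> 's \<Rightarrow> 's list list" where
  "B3_path2 s t u =
    [[s, t, s, u, t, s, u, t, u],
     [t, s, t, u, t, s, u, t, u],
     [t, s, t, u, t, u, s, t, u],
     [t, s, u, t, u, t, s, t, u],
     [t, u, s, t, u, t, s, t, u],
     [t, u, s, t, u, s, t, s, u],
     [t, u, s, t, u, s, t, u, s],
     [t, u, s, t, s, u, t, u, s],
     [t, u, t, s, t, u, t, u, s],
     [t, u, t, s, u, t, u, t, s],
     [t, u, t, u, s, t, u, t, s],
     [u, t, u, t, s, t, u, t, s],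
     [u, t, u, s, t, s, u, t, s],
     [u, t, u, s, t, u, s, t, s]]"


subsection \<open>Relations\<close>

inductive hecke_rel ::
    "('s, 'b, 'k::comm_ring_1) realization \<Rightarrow> ('s, 'b, 'k) diag \<Rightarrow> ('s, 'b, 'k) diag \<Rightarrow> bool"
  for D where
  box_plus: "hecke_rel D (Plus (Box p) (Box q)) (Box (p + q))"
| box_scale: "hecke_rel D (Scale c (Box p)) (Box (const c * p))"
| box_mult: "hecke_rel D (Box p \<cdot> Box q) (Box (p * q))"
| box_one: "hecke_rel D (Box 1) (Idn [])"

| unit_left: "hecke_rel D (Merge s \<cdot> (Start s \<star> Idn [s])) (Idn [s])"
| unit_right: "hecke_rel D (Merge s \<cdot> (Idn [s] \<star> Start s)) (Idn [s])"
| counit_left: "hecke_rel D ((End s \<star> Idn [s]) \<cdot> Split s) (Idn [s])"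
| counit_right: "hecke_rel D ((Idn [s] \<star> End s) \<cdot> Split s) (Idn [s])"
| associativity:
    "hecke_rel D (Merge s \<cdot> (Merge s \<star> Idn [s])) (Merge s \<cdot> (Idn [s] \<star> Merge s))"
| coassociativity:
    "hecke_rel D ((Split s \<star> Idn [s]) \<cdot> Split s) ((Idn [s] \<star> Split s) \<cdot> Split s)"
| frobenius_left:
    "hecke_rel D ((Merge s \<star> Idn [s]) \<cdot> (Idn [s] \<star> Split s)) (Split s \<cdot> Merge s)"
| frobenius_right:
    "hecke_rel D ((Idn [s] \<star> Merge s) \<cdot> (Split s \<star> Idn [s])) (Split s \<cdot> Merge s)"
| needle: "hecke_rel D (Merge s \<cdot> Split s) (Zero [s] [s])"
| barbell: "hecke_rel D (End s \<cdot> Start s) (Box (linear_poly (simple_root D s)))"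
| forcing:
    "hecke_rel D (Box p \<star> Idn [s])
       (Plus (Idn [s] \<star> Box (reflect_sym D s p)) (Box (demazure D s p) \<star> (Start s \<cdot> End s)))"

| rotation:
    "d = last (vword D t s) \<Longrightarrow>
     hecke_rel D
       ((Idn (s # butlast (vword D t s)) \<star> Cap d)
        \<cdot> (Idn [s] \<star> Vert s t \<star> Idn [d])
        \<cdot> (Cup s \<star> Idn (tl (vword D s t) @ [d])))
       (Vert t s)"

| two_color_associativity:
    "d = last (vword D t s) \<Longrightarrow>
     hecke_rel D
       (Vert s t \<cdot> (Merge s \<star> Idn (tl (vword D s t))))
       ((Idn (butlast (vword D t s)) \<star> Merge d)
        \<cdot> (Vert s t \<star> Idn [d])
        \<cdot> (Idn [s] \<star> Vert s t))"

| jw_composite: "jw_diagram D s t j \<Longrightarrow> hecke_rel D (Vert t s \<cdot> Vert s t) j"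
| jw_end:
    "\<lbrakk>jw_diagram D s t j; d = last (vword D t s)\<rbrakk> \<Longrightarrow>
     hecke_rel D
       ((Idn (butlast (vword D t s)) \<star> End d) \<cdot> Vert s t)
       ((End s \<star> Idn (tl (vword D s t))) \<cdot> j)"

| zamolodchikov_A1_I2:
    "\<lbrakk>s \<noteq> t; cox D s t \<noteq> \<infinity>; cox D s u = 2; cox D t u = 2\<rbrakk> \<Longrightarrow>
     hecke_rel D
       (path_diag D (slide u (vword D s t) @ [vword D t s @ [u]]))
       (path_diag D ((u # vword D s t) # slide u (vword D t s)))"
| zamolodchikov_A3:
    "\<lbrakk>cox D s t = 3; cox D t u = 3; cox D s u = 2\<rbrakk> \<Longrightarrow>
     hecke_rel D (path_diag D (A3_path1 s t u)) (path_diag D (A3_path2 s t u))"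
| zamolodchikov_B3:
    "\<lbrakk>cox D s t = 3; cox D t u = 4; cox D s u = 2\<rbrakk> \<Longrightarrow>
     hecke_rel D (path_diag D (B3_path1 s t u)) (path_diag D (B3_path2 s t u))"

text \<open>The axioms of a strict linear monoidal category (apart from the congruence rules).\<close>

inductive structural_rel ::
    "('s, 'b, 'k::comm_ring_1) diag \<Rightarrow> ('s, 'b, 'k) diag \<Rightarrow> bool" where
  "structural_rel (f \<cdot> Idn X) f"
| "structural_rel (Idn X \<cdot> f) f"
| "structural_rel ((h \<cdot> g) \<cdot> f) (h \<cdot> g \<cdot> f)"
| "structural_rel (Idn [] \<star> f) f"
| "structural_rel (f \<star> Idn []) f"
| "structural_rel (Idn X \<star> Idn Y) (Idn (X @ Y))"
| "structural_rel ((f \<star> g) \<star> h) (f \<star> g \<star> h)"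
| "structural_rel ((g \<star> g') \<cdot> (f \<star> f')) ((g \<cdot> f) \<star> (g' \<cdot> f'))"
| "structural_rel (Plus (Plus f g) h) (Plus f (Plus g h))"
| "structural_rel (Plus f g) (Plus g f)"
| "structural_rel (Plus (Zero X Y) f) f"
| "structural_rel (Plus f (Scale (- 1) f)) (Zero X Y)"
| "structural_rel (Scale (a + b) f) (Plus (Scale a f) (Scale b f))"
| "structural_rel (Scale a (Plus f g)) (Plus (Scale a f) (Scale a g))"
| "structural_rel (Scale (a * b) f) (Scale a (Scale b f))"
| "structural_rel (Scale 1 f) f"
| "structural_rel (Plus g g' \<cdot> f) (Plus (g \<cdot> f) (g' \<cdot> f))"
| "structural_rel (g \<cdot> Plus f f') (Plus (g \<cdot> f) (g \<cdot> f'))"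
| "structural_rel (Scale a g \<cdot> f) (Scale a (g \<cdot> f))"
| "structural_rel (g \<cdot> Scale a f) (Scale a (g \<cdot> f))"
| "structural_rel (Plus f g \<star> h) (Plus (f \<star> h) (g \<star> h))"
| "structural_rel (f \<star> Plus g h) (Plus (f \<star> g) (f \<star> h))"
| "structural_rel (Scale a f \<star> g) (Scale a (f \<star> g))"
| "structural_rel (f \<star> Scale a g) (Scale a (f \<star> g))"

text \<open>Equality of morphisms \<open>X \<rightarrow> Y\<close> of the Hecke category. The generating relations are
  imposed on well-typed diagrams only.\<close>

inductive diag_eq ::
    "('s, 'b, 'k::comm_ring_1) realization \<Rightarrow> 's list \<Rightarrow> 's list
      \<Rightarrow> ('s, 'b, 'k) diag \<Rightarrow> ('s, 'b, 'k) diag \<Rightarrow> bool"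
  for D where
  "\<lbrakk>hecke_rel D f g; has_type D X Y f; has_type D X Y g\<rbrakk> \<Longrightarrow> diag_eq D X Y f g"
| "\<lbrakk>structural_rel f g; has_type D X Y f; has_type D X Y g\<rbrakk> \<Longrightarrow> diag_eq D X Y f g"
| "has_type D X Y f \<Longrightarrow> diag_eq D X Y f f"
| "diag_eq D X Y f g \<Longrightarrow> diag_eq D X Y g f"
| "\<lbrakk>diag_eq D X Y f g; diag_eq D X Y g h\<rbrakk> \<Longrightarrow> diag_eq D X Y f h"
| "\<lbrakk>diag_eq D X Y f f'; diag_eq D Y Z g g'\<rbrakk> \<Longrightarrow> diag_eq D X Z (g \<cdot> f) (g' \<cdot> f')"
| "\<lbrakk>diag_eq D X Y f f'; diag_eq D X' Y' g g'\<rbrakk> \<Longrightarrow> diag_eq D (X @ X') (Y @ Y') (f \<star> g) (f' \<star> g')"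
| "\<lbrakk>diag_eq D X Y f f'; diag_eq D X Y g g'\<rbrakk> \<Longrightarrow> diag_eq D X Y (Plus f g) (Plus f' g')"
| "diag_eq D X Y f f' \<Longrightarrow> diag_eq D X Y (Scale c f) (Scale c f')"


subsection \<open>The category\<close>

type_synonym ('s, 'b, 'k) morphism = "('s, 'b, 'k) diag set"

definition cls :: "('s, 'b, 'k::comm_ring_1) realization \<Rightarrow> ('s, 'b, 'k) diag \<Rightarrow> ('s, 'b, 'k) morphism" where
  "cls D f = {g. \<exists>X Y. diag_eq D X Y f g}"

definition lift1 where
  "lift1 D op F = (\<Union>f\<in>F. cls D (op f))"

definition lift2 where
  "lift2 D op F G = (\<Union>f\<in>F. \<Union>g\<in>G. cls D (op f g))"

definition hecke_hom ::
    "('s, 'b, 'k::comm_ring_1) realization \<Rightarrow> 's list \<Rightarrow> 's list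
      \<Rightarrow> ('k, ('s, 'b, 'k) morphism) module" where
  "hecke_hom D X Y =
     \<lparr>carrier = cls D ` {f. has_type D X Y f}, monoid.mult = undefined, one = undefined,
      zero = cls D (Zero X Y), add = lift2 D Plus, module.smult = (\<lambda>c. lift1 D (Scale c))\<rparr>"

definition hecke ::
    "('s, 'b, 'k::comm_ring_1) realization
      \<Rightarrow> ('s list, ('s, 'b, 'k) morphism, 'k) linear_monoidal_cat" where
  "hecke D =
     \<lparr>Obj = lists (simples D), Hom = hecke_hom D, ident = (\<lambda>X. cls D (Idn X)),
      ccomp = lift2 D Comp, munit = [], otens = (@), mtens = lift2 D Tens\<rparr>"


subsection \<open>The original grading\<close>

inductive has_degree ::
    "('s, 'b, 'k::comm_ring_1) realization \<Rightarrow> int \<Rightarrow> 's list \<Rightarrow> 's list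
      \<Rightarrow> ('s, 'b, 'k) diag \<Rightarrow> bool"
  for D where
  "X \<in> lists (simples D) \<Longrightarrow> has_degree D 0 X X (Idn X)"
| "\<lbrakk>p \<in> poly_ring D; homogeneous_poly d p\<rbrakk> \<Longrightarrow> has_degree D (2 * int d) [] [] (Box p)"
| "s \<in> simples D \<Longrightarrow> has_degree D 1 [] [s] (Start s)"
| "s \<in> simples D \<Longrightarrow> has_degree D 1 [s] [] (End s)"
| "s \<in> simples D \<Longrightarrow> has_degree D (- 1) [s] [s, s] (Split s)"
| "s \<in> simples D \<Longrightarrow> has_degree D (- 1) [s, s] [s] (Merge s)"
| "\<lbrakk>s \<in> simples D; t \<in> simples D; s \<noteq> t; cox D s t \<noteq> \<infinity>\<rbrakk>
    \<Longrightarrow> has_degree D 0 (vword D s t) (vword D t s) (Vert s t)"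
| "\<lbrakk>has_degree D a X Y f; has_degree D b Y Z g\<rbrakk> \<Longrightarrow> has_degree D (a + b) X Z (g \<cdot> f)"
| "\<lbrakk>has_degree D a X Y f; has_degree D b X' Y' f'\<rbrakk>
    \<Longrightarrow> has_degree D (a + b) (X @ X') (Y @ Y') (f \<star> f')"
| "\<lbrakk>X \<in> lists (simples D); Y \<in> lists (simples D)\<rbrakk> \<Longrightarrow> has_degree D a X Y (Zero X Y)"
| "\<lbrakk>has_degree D a X Y f; has_degree D a X Y g\<rbrakk> \<Longrightarrow> has_degree D a X Y (Plus f g)"
| "has_degree D a X Y f \<Longrightarrow> has_degree D a X Y (Scale c f)"

definition original_grading ::
    "('s, 'b, 'k::comm_ring_1) realization \<Rightarrow> int \<Rightarrow> 's list \<Rightarrow> 's list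
      \<Rightarrow> ('s, 'b, 'k) morphism set" where
  "original_grading D n X Y = cls D ` {f. has_degree D n X Y f}"

end

(* All relations of the Hecke category relate diagrams of the same bidegree, so the bidegree
   ought to descend to the quotient. To see that the homogeneous parts of a morphism are
   well-defined, every diagram f is multiplied out into a finite list "expand f" of homogeneous
   diagrams; "component D a f" is the class of the sum of those of bidegree a. Each component is
   invariant under the relations: the components of a composite (or tensor product) depend only
   on the components of its factors, a relation between homogeneous diagrams is its own only
   component, and the relations involving arbitrary polynomials are compatible with the
   decomposition of Sym(V) because the reflections and the Demazure operators are homogeneous of
   degrees 0 and -1. Jones-Wenzl morphisms have bidegree 0: a cap contributes (-1,1), a cup
   contributes (1,-1), and a diagram with as many strands below as above has equally many caps
   and cups. Uniqueness of the decomposition follows since components are additive. *)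
theory Submission
  imports Defs
begin

section \<open>Homogeneous parts of polynomials\<close>

text \<open>The bidegrees are nearly forced. The unit and counit relations ask for
  \<open>Merge\<close> and \<open>Split\<close> to be opposite to \<open>Start\<close> and
  \<open>End\<close>, and the barbell relation asks for the latter two to add up to the bidegree
  (1,1) of a root. Cups and caps then have bidegrees (1,-1) and (-1,1). The sum of the coordinates
  does not see them, so the finer homogeneity requires cups and caps to balance in every relation;
  this is why the drawings of matchings need a count of strands. The obstacle is that a diagram has
  no bidegree of its own: boxes hold arbitrary polynomials, and sums of different degrees may occur
  inside any factor. The relations are imposed on all such diagrams, so comparing the bidegrees of
  two sides is not enough. Components avoid the problem because they are defined by recursion on
  syntax, for every diagram and before any quotient is taken; all that remains is to follow them
  through the inductive generation of \<open>diag_eq\<close>.\<close>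

definition pdeg :: "('b \<Rightarrow>\<^sub>0 nat) \<Rightarrow> nat" where
  "pdeg e = (\<Sum>b\<in>Poly_Mapping.keys e. Poly_Mapping.lookup e b)"

lemma pdeg_superset:
  "\<lbrakk>finite A; Poly_Mapping.keys e \<subseteq> A\<rbrakk> \<Longrightarrow> pdeg e = (\<Sum>b\<in>A. Poly_Mapping.lookup e b)"
  unfolding pdeg_def by (rule sum.mono_neutral_left) (auto simp: in_keys_iff)

lemma pdeg_add: "pdeg (e + e') = pdeg e + pdeg e'"
proof -
  let ?A = "Poly_Mapping.keys e \<union> Poly_Mapping.keys e'"
  have "Poly_Mapping.keys (e + e') \<subseteq> ?A" by (rule Poly_Mapping.keys_add)
  then show ?thesis
    by (simp add: pdeg_superset[of ?A] lookup_add sum.distrib)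
qed

lemma pdeg_zero [simp]: "pdeg 0 = 0"
  by (simp add: pdeg_def)

lemma pdeg_single [simp]: "pdeg (Poly_Mapping.single b n) = n"
  by (cases "n = 0") (auto simp: pdeg_def)

text \<open>Degrees of polynomials are taken in the integers, so that the zero polynomial is the only
  one of negative degree and the Demazure operators have degree \<open>-1\<close> without exception.\<close>

definition homog_poly :: "int \<Rightarrow> ('b, 'k::comm_ring_1) polys \<Rightarrow> bool" where
  "homog_poly d p \<longleftrightarrow> (\<forall>e\<in>Poly_Mapping.keys p. int (pdeg e) = d)"

text \<open>Written as a finite sum of monomials, which gives finite support for free;
  \<open>lookup_homog_part\<close> is the working description.\<close>

definition homog_part :: "int \<Rightarrow> ('b, 'k::comm_ring_1) polys \<Rightarrow> ('b, 'k) polys" where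
  "homog_part d p = (\<Sum>e\<in>Poly_Mapping.keys p.
     if int (pdeg e) = d then Poly_Mapping.single e (Poly_Mapping.lookup p e) else 0)"

lemma lookup_homog_part:
  "Poly_Mapping.lookup (homog_part d p) e = (if int (pdeg e) = d then Poly_Mapping.lookup p e else 0)"
proof -
  have "Poly_Mapping.lookup (homog_part d p) e =
      (\<Sum>e'\<in>Poly_Mapping.keys p. if e' = e then (if int (pdeg e) = d then Poly_Mapping.lookup p e else 0) else 0)"
    unfolding homog_part_def lookup_sum by (rule sum.cong) (auto simp: lookup_single when_def)
  then show ?thesis by (auto simp: in_keys_iff)
qed

lemma homog_part_add: "homog_part d (p + q) = homog_part d p + homog_part d q"
  by (rule poly_mapping_eqI) (simp add: lookup_homog_part lookup_add)

lemma homog_part_zero [simp]: "homog_part d 0 = 0"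
  by (simp add: homog_part_def)

lemma homog_part_sum: "homog_part d (sum f A) = (\<Sum>x\<in>A. homog_part d (f x))"
  by (induction A rule: infinite_finite_induct) (simp_all add: homog_part_add)

lemma keys_homog_part: "Poly_Mapping.keys (homog_part d p) \<subseteq> Poly_Mapping.keys p"
  by (auto simp: in_keys_iff lookup_homog_part split: if_splits)

lemma homog_poly_part: "homog_poly d (homog_part d p)"
  by (auto simp: homog_poly_def in_keys_iff lookup_homog_part split: if_splits)

lemma homog_part_homog: "homog_poly d p \<Longrightarrow> homog_part d' p = (if d' = d then p else 0)"
  by (rule poly_mapping_eqI) (auto simp: homog_poly_def lookup_homog_part in_keys_iff)

text \<open>Natural numbers, although parts are indexed by integers: negative degrees never occur,
  and boxes are graded by the natural degree of \<open>homogeneous_poly\<close>.\<close>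

definition poly_degs :: "('b, 'k::comm_ring_1) polys \<Rightarrow> nat set" where
  "poly_degs p = pdeg ` Poly_Mapping.keys p"

lemma finite_poly_degs [simp]: "finite (poly_degs p)"
  by (simp add: poly_degs_def)

lemma homog_part_outside: "d \<notin> int ` poly_degs p \<Longrightarrow> homog_part d p = 0"
  by (rule poly_mapping_eqI) (auto simp: poly_degs_def lookup_homog_part in_keys_iff)

lemma sum_homog_parts: "(\<Sum>d\<in>poly_degs p. homog_part (int d) p) = p"
proof (rule poly_mapping_eqI)
  fix e
  have "Poly_Mapping.lookup (\<Sum>d\<in>poly_degs p. homog_part (int d) p) e
      = (\<Sum>d\<in>poly_degs p. if d = pdeg e then Poly_Mapping.lookup p e else 0)"
    unfolding lookup_sum by (rule sum.cong) (auto simp: lookup_homog_part)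
  also have "\<dots> = Poly_Mapping.lookup p e"
    by (auto simp: poly_degs_def in_keys_iff)
  finally show "Poly_Mapping.lookup (\<Sum>d\<in>poly_degs p. homog_part (int d) p) e = Poly_Mapping.lookup p e" .
qed

lemma homog_poly_zero [simp]: "homog_poly d 0"
  by (simp add: homog_poly_def)

lemma homog_poly_add: "\<lbrakk>homog_poly d p; homog_poly d q\<rbrakk> \<Longrightarrow> homog_poly d (p + q)"
  using Poly_Mapping.keys_add[of p q] by (auto simp: homog_poly_def)

lemma homog_poly_uminus: "homog_poly d p \<Longrightarrow> homog_poly d (- p)"
  by (simp add: homog_poly_def)

lemma homog_poly_sum: "(\<And>x. x \<in> A \<Longrightarrow> homog_poly d (f x)) \<Longrightarrow> homog_poly d (sum f A)"
  by (induction A rule: infinite_finite_induct) (auto intro: homog_poly_add)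

lemma homog_poly_mult: "\<lbrakk>homog_poly d p; homog_poly d' q\<rbrakk> \<Longrightarrow> homog_poly (d + d') (p * q)"
  using Poly_Mapping.keys_mult[of p q] by (fastforce simp: homog_poly_def pdeg_add)

lemma homog_poly_const: "homog_poly 0 (const c)"
  by (auto simp: homog_poly_def const_def)

lemma homog_poly_one: "homog_poly 0 1"
  by (simp add: homog_poly_def)

lemma homog_poly_var: "homog_poly 1 (var b)"
  by (auto simp: homog_poly_def var_def)

lemma homog_poly_linear: "homog_poly 1 (linear_poly v)"
  unfolding linear_poly_def
  using homog_poly_mult[OF homog_poly_const homog_poly_var] by (intro homog_poly_sum) simp

lemma homog_poly_power: "homog_poly d p \<Longrightarrow> homog_poly (int n * d) (p ^ n)"
proof (induction n)
  case (Suc n)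
  then show ?case using homog_poly_mult[of d p "int n * d" "p ^ n"] by (simp add: algebra_simps)
qed (simp add: homog_poly_one)

lemma homog_poly_prod:
  "finite A \<Longrightarrow> (\<And>x. x \<in> A \<Longrightarrow> homog_poly (d x) (f x)) \<Longrightarrow> homog_poly (\<Sum>x\<in>A. d x) (\<Prod>x\<in>A. f x)"
  by (induction A rule: finite_induct) (auto intro: homog_poly_mult homog_poly_one)

text \<open>An additive operator of degree \<open>- k\<close> sends the parts of \<open>p\<close> to
  polynomials of pairwise different degrees, so the part of degree \<open>d - k\<close> of the image
  can only come from the part of degree \<open>d\<close>. Reflections are the case
  \<open>k = 0\<close>, Demazure operators \<open>k = 1\<close>, and multiplication by a polynomial
  of degree \<open>j\<close> the case \<open>k = - j\<close>.\<close>

lemma homog_part_operator: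
  assumes add: "\<And>p q. F (p + q) = F p + F q"
    and homog: "\<And>d p. homog_poly d p \<Longrightarrow> homog_poly (d - k) (F p)"
  shows "F (homog_part d p) = homog_part (d - k) (F p)"
proof -
  have F0: "F 0 = 0" using add[of 0 0] by simp
  have Fsum: "F (sum f A) = (\<Sum>x\<in>A. F (f x))" for f :: "nat \<Rightarrow> _" and A
    by (induction A rule: infinite_finite_induct) (simp_all add: F0 add)
  have "homog_part (d - k) (F p) = homog_part (d - k) (F (\<Sum>i\<in>poly_degs p. homog_part (int i) p))"
    by (simp add: sum_homog_parts)
  also have "\<dots> = (\<Sum>i\<in>poly_degs p. if d = int i then F (homog_part d p) else 0)"
    unfolding Fsum homog_part_sum
    by (rule sum.cong) (auto simp: homog_part_homog[OF homog[OF homog_poly_part]])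
  also have "\<dots> = F (homog_part d p)"
  proof (cases "d \<in> int ` poly_degs p")
    case True
    then obtain i where i: "d = int i" "i \<in> poly_degs p" by auto
    then have "(\<Sum>j\<in>poly_degs p. if d = int j then F (homog_part d p) else 0)
        = (\<Sum>j\<in>poly_degs p. if i = j then F (homog_part d p) else 0)"
      by (intro sum.cong) auto
    then show ?thesis using i by (simp)
  next
    \<comment> \<open>If \<open>d\<close> does not occur in \<open>p\<close>, in particular if it is
      negative, both sides are \<open>F 0\<close>.\<close>
    case False
    then show ?thesis by (auto simp: homog_part_outside F0 intro!: sum.neutral)
  qed
  finally show ?thesis ..
qed

section \<open>Reflections and Demazure operators on homogeneous polynomials\<close>

lemma substitute_superset:
  assumes "finite A" "Poly_Mapping.keys p \<subseteq> A" "h 0 = 0"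
  shows "substitute h f p = (\<Sum>e\<in>A. h (Poly_Mapping.lookup p e) *
     (\<Prod>b\<in>Poly_Mapping.keys e. f b ^ Poly_Mapping.lookup e b))"
  unfolding substitute_def using assms by (intro sum.mono_neutral_left) (auto simp: in_keys_iff)

text \<open>Cancellation may remove keys from \<open>p + q\<close>. Since \<open>h 0 = 0\<close>,
  all three sums can be taken over the union of the two supports, where additivity is visible
  coefficient by coefficient.\<close>

lemma substitute_add:
  assumes "\<And>a b. h (a + b) = h a + h b"
  shows "substitute h f (p + q) = substitute h f p + substitute h f q"
proof -
  have h0: "h 0 = 0" using assms[of 0 0] by simp
  let ?A = "Poly_Mapping.keys p \<union> Poly_Mapping.keys q"
  have "Poly_Mapping.keys (p + q) \<subseteq> ?A" by (rule Poly_Mapping.keys_add)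
  then show ?thesis
    by (simp add: substitute_superset[of ?A _ h] h0 lookup_add assms distrib_right sum.distrib)
qed

lemma const_add: "const (a + b) = const a + const b"
  by (simp add: const_def single_add)

lemma reflect_sym_add: "reflect_sym D s (p + q) = reflect_sym D s p + reflect_sym D s q"
  unfolding reflect_sym_def by (rule substitute_add) (rule const_add)

lemma demazure_add:
  fixes p q :: "('b, 'k::comm_ring_1) polys"
  shows "demazure D s (p + q) = demazure D s p + demazure D s q"
proof -
  have g: "reflect_generic D s (p + q) = reflect_generic D s p + reflect_generic D s q"
    unfolding reflect_generic_def by (rule substitute_add) (simp add: const_add)
  have sh: "poly_shift n (P + Q) = poly_shift n P + poly_shift n Q" for n and P Q :: "('b, 'k) polys poly"
    by (rule poly_eqI) (simp add: coeff_poly_shift)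
  have "[:p + q:] - reflect_generic D s (p + q)
      = ([:p:] - reflect_generic D s p) + ([:q:] - reflect_generic D s q)"
    by (simp add: g)
  then show ?thesis
    unfolding demazure_def by (simp only: sh poly_add)
qed

text \<open>Each variable is replaced by a linear form, so a monomial of degree \<open>d\<close>
  becomes a constant times a product of \<open>d\<close> linear forms.\<close>

lemma homog_poly_reflect_sym: "homog_poly d p \<Longrightarrow> homog_poly d (reflect_sym D s p)"
  unfolding reflect_sym_def substitute_def
proof (rule homog_poly_sum)
  fix e assume "homog_poly d p" "e \<in> Poly_Mapping.keys p"
  \<comment> \<open>The degree is brought into the shape produced by the product rules: 0 from the
    coefficient, and the exponent times 1 from each power of a linear form.\<close>
  then have d: "d = 0 + (\<Sum>b\<in>Poly_Mapping.keys e. int (Poly_Mapping.lookup e b) * 1)"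
    by (simp add: homog_poly_def pdeg_def)
  show "homog_poly d (const (Poly_Mapping.lookup p e) *
      (\<Prod>b\<in>Poly_Mapping.keys e. linear_poly (reflect D s (Poly_Mapping.single b 1)) ^ Poly_Mapping.lookup e b))"
    unfolding d
    by (intro homog_poly_mult homog_poly_const homog_poly_prod homog_poly_power homog_poly_linear) simp
qed

text \<open>Total degree on \<open>Sym(V)[T]\<close>, where \<open>T\<close> has degree 1.\<close>

definition homog_generic :: "int \<Rightarrow> ('b, 'k::comm_ring_1) polys poly \<Rightarrow> bool" where
  "homog_generic d q \<longleftrightarrow> (\<forall>i. homog_poly (d - int i) (coeff q i))"

lemma homog_generic_const: "homog_poly d p \<Longrightarrow> homog_generic d [:p:]"
  by (simp add: homog_generic_def coeff_pCons split: nat.split)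

lemma homog_generic_mult:
  "\<lbrakk>homog_generic d p; homog_generic d' q\<rbrakk> \<Longrightarrow> homog_generic (d + d') (p * q)"
  unfolding homog_generic_def coeff_mult
proof (intro allI homog_poly_sum)
  fix i j :: nat assume "\<forall>i. homog_poly (d - int i) (coeff p i)" "\<forall>i. homog_poly (d' - int i) (coeff q i)"
    and j: "j \<in> {..i}"
  then have "homog_poly ((d - int j) + (d' - int (i - j))) (coeff p j * coeff q (i - j))"
    by (intro homog_poly_mult) blast+
  then show "homog_poly (d + d' - int i) (coeff p j * coeff q (i - j))"
    using j by (simp add: of_nat_diff algebra_simps)
qed

lemma homog_generic_power: "homog_generic d p \<Longrightarrow> homog_generic (int n * d) (p ^ n)"
proof (induction n)
  case (Suc n)
  then show ?case using homog_generic_mult[of d p "int n * d" "p ^ n"] by (simp add: algebra_simps)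
qed (simp add: homog_generic_const homog_poly_one one_pCons)

lemma homog_generic_prod:
  "finite A \<Longrightarrow> (\<And>x. x \<in> A \<Longrightarrow> homog_generic (d x) (f x)) \<Longrightarrow>
    homog_generic (\<Sum>x\<in>A. d x) (\<Prod>x\<in>A. f x)"
  by (induction A rule: finite_induct)
    (auto intro: homog_generic_mult simp: homog_generic_const homog_poly_one one_pCons)

lemma homog_generic_sum:
  "(\<And>x. x \<in> A \<Longrightarrow> homog_generic d (f x)) \<Longrightarrow> homog_generic d (sum f A)"
  by (auto simp: homog_generic_def coeff_sum intro: homog_poly_sum)

lemma homog_generic_reflect: 
  assumes "homog_poly d p" shows "homog_generic d (reflect_generic D s p)"
  unfolding reflect_generic_def substitute_def
proof (rule homog_generic_sum)
  fix e assume "e \<in> Poly_Mapping.keys p"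
  then have d: "d = 0 + (\<Sum>b\<in>Poly_Mapping.keys e. int (Poly_Mapping.lookup e b) * 1)"
    using assms by (simp add: homog_poly_def pdeg_def)
  \<comment> \<open>The coefficient of \<open>T^0\<close> has degree 1, that of \<open>T^1\<close>
    has degree 0, so \<open>v - coroot(v) T\<close> has total degree 1.\<close>
  have lin: "homog_generic 1 [:var b, - const c:]" for b and c :: 'b
    by (auto simp: homog_generic_def coeff_pCons homog_poly_var homog_poly_const homog_poly_uminus split: nat.split)
  show "homog_generic d ([:const (Poly_Mapping.lookup p e):] * (\<Prod>b\<in>Poly_Mapping.keys e.
      [:var b, - const (simple_coroot D s (Poly_Mapping.single b 1)):] ^ Poly_Mapping.lookup e b))"
    unfolding d
    by (intro homog_generic_mult homog_generic_const homog_poly_const homog_generic_prod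
        homog_generic_power lin) simp
qed

text \<open>Division by \<open>T\<close> lowers the total degree by one, and putting the root, a
  polynomial of degree 1, for \<open>T\<close> preserves it. The argument never divides by the root
  and so covers roots that are zero divisors.\<close>

lemma homog_poly_demazure:
  assumes "homog_poly d p" shows "homog_poly (d - 1) (demazure D s p)"
proof -
  define q where "q = [:p:] - reflect_generic D s p"
  have "homog_poly (d - int i) (coeff q i)" for i
    using homog_generic_const[OF assms] homog_generic_reflect[OF assms, of D s]
    unfolding q_def homog_generic_def
    by (metis coeff_diff diff_conv_add_uminus homog_poly_add homog_poly_uminus)
  note coeff_q = this
  \<comment> \<open>The shifted polynomial has at \<open>T^i\<close> the coefficient of
    \<open>T^(i+1)\<close>, of degree \<open>d - (i+1)\<close>; evaluation gives back
    \<open>i\<close> degrees.\<close>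
  have "homog_poly ((d - int (Suc i)) + int i * 1)
      (coeff (poly_shift 1 q) i * linear_poly (simple_root D s) ^ i)" for i
    unfolding coeff_poly_shift
    using coeff_q[of "Suc i"] by (intro homog_poly_mult homog_poly_power homog_poly_linear) simp
  then show ?thesis
    unfolding demazure_def q_def[symmetric] poly_altdef by (intro homog_poly_sum) (simp add: algebra_simps)
qed

lemma homog_part_reflect_sym: "reflect_sym D s (homog_part d p) = homog_part d (reflect_sym D s p)"
  using homog_part_operator[of "reflect_sym D s" 0]
  by (simp add: reflect_sym_add homog_poly_reflect_sym)

lemma homog_part_demazure: "demazure D s (homog_part d p) = homog_part (d - 1) (demazure D s p)"
  by (rule homog_part_operator) (simp_all add: demazure_add homog_poly_demazure)

text \<open>Multiplication by a homogeneous polynomial is an operator to which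
  \<open>homog_part_operator\<close> applies, so only \<open>q\<close> is decomposed. This one-sided
  form mirrors the formula for the components of a composite in which only the lower diagram is
  expanded.\<close>

lemma homog_part_mult:
  fixes p q :: "('b, 'k::comm_ring_1) polys"
  shows "homog_part n (p * q) = (\<Sum>j\<in>poly_degs q. homog_part (n - int j) p * homog_part (int j) q)"
proof -
  have *: "homog_part n (p * q') = homog_part (n - j) p * q'" if "homog_poly j q'" for j and q' :: "('b, 'k) polys"
  proof -
    have "homog_poly (d - (- j)) (p' * q')" if "homog_poly d p'" for d and p' :: "('b, 'k) polys"
      using homog_poly_mult[OF that \<open>homog_poly j q'\<close>] by simp
    then show ?thesis
      using homog_part_operator[of "\<lambda>p. p * q'" "- j" "n - j" p] by (simp add: distrib_right)
  qed
  have "homog_part n (p * q) = homog_part n (\<Sum>j\<in>poly_degs q. p * homog_part (int j) q)"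
    by (simp add: sum_homog_parts flip: sum_distrib_left)
  also have "\<dots> = (\<Sum>j\<in>poly_degs q. homog_part (n - int j) p * homog_part (int j) q)"
    unfolding homog_part_sum by (intro sum.cong refl * homog_poly_part)
  finally show ?thesis .
qed

lemma homog_part_scale:
  fixes p :: "('b, 'k::comm_ring_1) polys"
  shows "homog_part d (const c * p) = const c * homog_part d p"
proof -
  have "homog_poly (d' - 0) (const c * q)" if "homog_poly d' q" for d' and q :: "('b, 'k) polys"
    using homog_poly_mult[OF homog_poly_const that, of c] by simp
  then show ?thesis
    using homog_part_operator[of "\<lambda>p. const c * p" 0 d p] by (simp add: distrib_left)
qed

section \<open>The Hecke category as a linear monoidal category\<close>

primrec source :: "('s, 'b, 'k::comm_ring_1) realization \<Rightarrow> ('s, 'b, 'k) diag \<Rightarrow> 's list" where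
  "source D (Idn X) = X"
| "source D (Box p) = []"
| "source D (Start s) = []"
| "source D (End s) = [s]"
| "source D (Split s) = [s]"
| "source D (Merge s) = [s, s]"
| "source D (Vert s t) = vword D s t"
| "source D (g \<cdot> f) = source D f"
| "source D (f \<star> g) = source D f @ source D g"
| "source D (Zero X Y) = X"
| "source D (Plus f g) = source D f"
| "source D (Scale c f) = source D f"

primrec target :: "('s, 'b, 'k::comm_ring_1) realization \<Rightarrow> ('s, 'b, 'k) diag \<Rightarrow> 's list" where
  "target D (Idn X) = X"
| "target D (Box p) = []"
| "target D (Start s) = [s]"
| "target D (End s) = []"
| "target D (Split s) = [s, s]"
| "target D (Merge s) = [s]"
| "target D (Vert s t) = vword D t s"
| "target D (g \<cdot> f) = target D g"
| "target D (f \<star> g) = target D f @ target D g"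
| "target D (Zero X Y) = Y"
| "target D (Plus f g) = target D f"
| "target D (Scale c f) = target D f"

primrec well_typed :: "('s, 'b, 'k::comm_ring_1) realization \<Rightarrow> ('s, 'b, 'k) diag \<Rightarrow> bool" where
  "well_typed D (Idn X) \<longleftrightarrow> X \<in> lists (simples D)"
| "well_typed D (Box p) \<longleftrightarrow> p \<in> poly_ring D"
| "well_typed D (Start s) \<longleftrightarrow> s \<in> simples D"
| "well_typed D (End s) \<longleftrightarrow> s \<in> simples D"
| "well_typed D (Split s) \<longleftrightarrow> s \<in> simples D"
| "well_typed D (Merge s) \<longleftrightarrow> s \<in> simples D"
| "well_typed D (Vert s t) \<longleftrightarrow> s \<in> simples D \<and> t \<in> simples D \<and> s \<noteq> t \<and> cox D s t \<noteq> \<infinity>"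
| "well_typed D (g \<cdot> f) \<longleftrightarrow> well_typed D f \<and> well_typed D g \<and> target D f = source D g"
| "well_typed D (f \<star> g) \<longleftrightarrow> well_typed D f \<and> well_typed D g"
| "well_typed D (Zero X Y) \<longleftrightarrow> X \<in> lists (simples D) \<and> Y \<in> lists (simples D)"
| "well_typed D (Plus f g) \<longleftrightarrow> well_typed D f \<and> well_typed D g \<and>
     source D f = source D g \<and> target D f = target D g"
| "well_typed D (Scale c f) \<longleftrightarrow> well_typed D f"

text \<open>A diagram has at most one type, computed by \<open>source\<close> and
  \<open>target\<close>. Typing conditions become equations that simplification can check, and the
  type can be recovered from any member of a class.\<close>

lemma has_type_iff: "has_type D X Y f \<longleftrightarrow> well_typed D f \<and> X = source D f \<and> Y = target D f"
proof
  show "has_type D X Y f \<Longrightarrow> well_typed D f \<and> X = source D f \<and> Y = target D f"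
    by (induction rule: has_type.induct) auto
  have "well_typed D f \<Longrightarrow> has_type D (source D f) (target D f) f"
    by (induction f) (auto intro: has_type.intros)
  then show "well_typed D f \<and> X = source D f \<and> Y = target D f \<Longrightarrow> has_type D X Y f" by simp
qed

lemma alternating_in_lists: "\<lbrakk>s \<in> S; t \<in> S\<rbrakk> \<Longrightarrow> alternating s t n \<in> lists S"
  by (induction n arbitrary: s t) auto

lemma source_target_in_lists:
  "well_typed D f \<Longrightarrow> source D f \<in> lists (simples D) \<and> target D f \<in> lists (simples D)"
  by (induction f) (auto simp: vword_def alternating_in_lists)

lemma diag_eq_type: "diag_eq D X Y f g \<Longrightarrow> has_type D X Y f \<and> has_type D X Y g"
  by (induction rule: diag_eq.induct) (auto intro: has_type.intros)

section \<open>Classes of diagrams and the operations on them\<close>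

lemmas diag_eq_rel = diag_eq.intros(1)
lemmas diag_eq_structural = diag_eq.intros(2)
lemmas diag_eq_refl = diag_eq.intros(3)
lemmas diag_eq_sym = diag_eq.intros(4)
lemmas diag_eq_trans = diag_eq.intros(5)

text \<open>\<open>cls\<close> quantifies over the types away. Before transitivity applies they must
  be identified again, through the diagram that two related pairs have in common.\<close>

lemma cls_eqI: "diag_eq D X Y f g \<Longrightarrow> cls D f = cls D g"
proof -
  have *: "cls D g \<subseteq> cls D f" if "diag_eq D X Y f g" for f g
  proof
    fix h assume "h \<in> cls D g"
    then obtain X' Y' where h: "diag_eq D X' Y' g h" by (auto simp: cls_def)
    then have "X' = X \<and> Y' = Y" using that by (auto dest!: diag_eq_type simp: has_type_iff)
    then show "h \<in> cls D f" using that h diag_eq_trans by (fastforce simp: cls_def)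
  qed
  assume "diag_eq D X Y f g"
  then show ?thesis using * diag_eq_sym by blast
qed

lemma cls_self: "well_typed D f \<Longrightarrow> f \<in> cls D f"
  unfolding cls_def using diag_eq_refl[of D "source D f" "target D f" f] by (auto simp: has_type_iff)

lemma in_clsD:
  assumes "f' \<in> cls D f" shows "diag_eq D (source D f) (target D f) f f'"
proof -
  obtain X Y where h: "diag_eq D X Y f f'" using assms by (auto simp: cls_def)
  then have "X = source D f \<and> Y = target D f" by (auto dest!: diag_eq_type simp: has_type_iff)
  with h show ?thesis by simp
qed

text \<open>Ill-typed diagrams all have the empty class, so equality of classes says something about
  diagrams only once one of them is well typed.\<close>

lemma cls_eqD: "\<lbrakk>cls D f = cls D g; well_typed D g\<rbrakk> \<Longrightarrow> diag_eq D (source D f) (target D f) f g"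
  using cls_self in_clsD by blast

lemma cls_eq_structural:
  "\<lbrakk>structural_rel f g; well_typed D f; well_typed D g; source D f = source D g; target D f = target D g\<rbrakk>
    \<Longrightarrow> cls D f = cls D g"
  by (rule cls_eqI[OF diag_eq_structural]) (auto simp: has_type_iff)

lemma cls_eq_rel:
  "\<lbrakk>hecke_rel D f g; well_typed D f; well_typed D g; source D f = source D g; target D f = target D g\<rbrakk>
    \<Longrightarrow> cls D f = cls D g"
  by (rule cls_eqI[OF diag_eq_rel]) (auto simp: has_type_iff)

text \<open>All members of the union coincide, and there is at least one because a well-typed
  diagram lies in its own class.\<close>

lemma lift1_cls:
  assumes "well_typed D f"
    "\<And>f'. diag_eq D (source D f) (target D f) f f' \<Longrightarrow> diag_eq D U V (op f) (op f')"
  shows "lift1 D op (cls D f) = cls D (op f)"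
proof -
  have "cls D (op f') = cls D (op f)" if "f' \<in> cls D f" for f'
    using cls_eqI[OF assms(2)[OF in_clsD[OF that]]] by simp
  then show ?thesis using cls_self[OF assms(1)] unfolding lift1_def by blast
qed

lemma lift2_cls:
  assumes "well_typed D f" "well_typed D g"
    "\<And>f' g'. \<lbrakk>diag_eq D (source D f) (target D f) f f'; diag_eq D (source D g) (target D g) g g'\<rbrakk>
      \<Longrightarrow> diag_eq D U V (op f g) (op f' g')"
  shows "lift2 D op (cls D f) (cls D g) = cls D (op f g)"
proof -
  have "cls D (op f' g') = cls D (op f g)" if "f' \<in> cls D f" "g' \<in> cls D g" for f' g'
    using cls_eqI[OF assms(3)[OF in_clsD[OF that(1)] in_clsD[OF that(2)]]] by simp
  then show ?thesis using cls_self[OF assms(1)] cls_self[OF assms(2)] unfolding lift2_def by blast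
qed

lemma lift_Plus: "well_typed D (Plus f g) \<Longrightarrow> lift2 D Plus (cls D f) (cls D g) = cls D (Plus f g)"
  by (rule lift2_cls[of D _ _ "source D f" "target D f"]) (auto intro: diag_eq.intros)

lemma lift_Scale: "well_typed D f \<Longrightarrow> lift1 D (Scale c) (cls D f) = cls D (Scale c f)"
  by (rule lift1_cls) (auto intro: diag_eq.intros)

lemma lift_Comp: "well_typed D (g \<cdot> f) \<Longrightarrow> lift2 D Comp (cls D g) (cls D f) = cls D (g \<cdot> f)"
  by (rule lift2_cls[of D _ _ "source D f" "target D g"]) (auto intro: diag_eq.intros)

lemma lift_Tens: "well_typed D (f \<star> g) \<Longrightarrow> lift2 D Tens (cls D f) (cls D g) = cls D (f \<star> g)"
  by (rule lift2_cls[of D _ _ "source D f @ source D g" "target D f @ target D g"])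
    (auto intro: diag_eq.intros)

lemmas lift_simps = lift_Plus lift_Scale lift_Comp lift_Tens

definition diag_hom :: "('s, 'b, 'k::comm_ring_1) realization \<Rightarrow> 's list \<Rightarrow> 's list
    \<Rightarrow> ('s, 'b, 'k) diag set" where
  "diag_hom D X Y = {f. well_typed D f \<and> source D f = X \<and> target D f = Y}"

lemma hecke_hom_simps:
  "carrier (hecke_hom D X Y) = cls D ` diag_hom D X Y"
  "\<zero>\<^bsub>hecke_hom D X Y\<^esub> = cls D (Zero X Y)"
  "add (hecke_hom D X Y) = lift2 D Plus"
  "module.smult (hecke_hom D X Y) = (\<lambda>c. lift1 D (Scale c))"
  by (auto simp: hecke_hom_def diag_hom_def has_type_iff)

lemma hecke_simps [simp]:
  "Obj (hecke D) = lists (simples D)"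
  "Hom (hecke D) = hecke_hom D"
  "ident (hecke D) = (\<lambda>X. cls D (Idn X))"
  "ccomp (hecke D) = lift2 D Comp"
  "munit (hecke D) = []"
  "otens (hecke D) = (@)"
  "mtens (hecke D) = lift2 D Tens"
  by (simp_all add: hecke_def)

lemma scalar_ring_simps [simp]:
  "carrier scalar_ring = UNIV" "\<one>\<^bsub>scalar_ring\<^esub> = 1" "\<zero>\<^bsub>scalar_ring\<^esub> = 0"
  "add scalar_ring = (+)" "monoid.mult scalar_ring = (*)"
  by (simp_all add: scalar_ring_def)

lemma cring_scalar_ring: "cring (scalar_ring :: 'k::comm_ring_1 ring)"
proof (rule cringI)
  show "abelian_group (scalar_ring :: 'k ring)"
  proof (rule abelian_groupI)
    fix x :: 'k
    show "\<exists>y\<in>carrier scalar_ring. y \<oplus>\<^bsub>scalar_ring\<^esub> x = \<zero>\<^bsub>scalar_ring\<^esub>"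
      by (rule bexI[of _ "- x"]) simp_all
  qed (simp_all add: algebra_simps)
  show "Group.comm_monoid (scalar_ring :: 'k ring)"
    by (rule Group.comm_monoidI) (simp_all add: algebra_simps)
qed (simp add: algebra_simps)

section \<open>The axioms of a linear monoidal category\<close>

lemma hom_abelian_group:
  assumes X: "X \<in> lists (simples D)" and Y: "Y \<in> lists (simples D)"
  shows "abelian_group (hecke_hom D X Y)"
proof (rule abelian_groupI, unfold hecke_hom_simps, goal_cases)
  case (6 u)
  then obtain f where f: "f \<in> diag_hom D X Y" "u = cls D f" by auto
  \<comment> \<open>The structural relation has the negative on the right, while the group axiom
    wants a left inverse; hence the detour through commutativity.\<close>
  have "cls D (Plus f (Scale (- 1) f)) = cls D (Zero X Y)"
    using f X Y by (intro cls_eq_structural) (auto intro: structural_rel.intros simp: diag_hom_def)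
  moreover have "cls D (Plus f (Scale (- 1) f)) = cls D (Plus (Scale (- 1) f) f)"
    using f by (intro cls_eq_structural) (auto intro: structural_rel.intros simp: diag_hom_def)
  ultimately show ?case
    using f by (intro bexI[of _ "cls D (Scale (- 1) f)"]) (auto simp: lift_simps diag_hom_def)
\<comment> \<open>On representatives, each remaining axiom is either one structural relation or
  membership of a well-typed diagram.\<close>
qed ((insert X Y, clarsimp simp: hecke_hom_simps lift_simps diag_hom_def in_lists_conv_set;
    (rule cls_eq_structural | rule imageI);
    (rule structural_rel.intros | simp add: diag_hom_def in_lists_conv_set))+)

lemma hom_module:
  assumes X: "X \<in> lists (simples D)" and Y: "Y \<in> lists (simples D)"
  shows "Module.module scalar_ring (hecke_hom D X Y)"
proof (rule Module.moduleI, goal_cases)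
  case 1 show ?case by (rule cring_scalar_ring)
next
  case 2 show ?case by (rule hom_abelian_group[OF X Y])
qed ((clarsimp simp: hecke_hom_simps lift_simps diag_hom_def in_lists_conv_set;
    (rule cls_eq_structural | rule imageI);
    (rule structural_rel.intros | simp add: diag_hom_def in_lists_conv_set))+)

text \<open>\<open>structural_rel\<close> imposes the equational axioms on diagrams and
  \<open>diag_eq\<close> is a congruence, so every axiom can be checked on representatives of the
  classes involved.\<close>

lemma hecke_category: "strict_linear_monoidal_category (hecke D)"
proof (rule strict_linear_monoidal_category.intro, goal_cases)
  case 1 then show ?case by (simp add: hom_module)
qed ((simp add: hecke_hom_simps in_lists_conv_set ball_Un; fail) |
    (clarsimp simp: hecke_hom_simps lift_simps diag_hom_def in_lists_conv_set;
    (rule cls_eq_structural | rule imageI);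
    (rule structural_rel.intros | simp add: diag_hom_def in_lists_conv_set)))+

section \<open>Bihomogeneous components\<close>

text \<open>Lists rather than finite sets of summands: the expansion of a diagram such as
  \<open>Plus f f\<close> contains the same term twice, and both copies count.\<close>

definition lsum :: "('m, 'z) ring_scheme \<Rightarrow> ('x \<Rightarrow> 'm) \<Rightarrow> 'x list \<Rightarrow> 'm" where
  "lsum M f xs = foldr (\<lambda>x u. f x \<oplus>\<^bsub>M\<^esub> u) xs \<zero>\<^bsub>M\<^esub>"

lemma lsum_simps [simp]:
  "lsum M f [] = \<zero>\<^bsub>M\<^esub>"
  "lsum M f (x # xs) = f x \<oplus>\<^bsub>M\<^esub> lsum M f xs"
  by (simp_all add: lsum_def)

lemma lsum_map [simp]: "lsum M f (map g xs) = lsum M (\<lambda>x. f (g x)) xs"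
  by (induction xs) simp_all

lemma lsum_cong: "(\<And>x. x \<in> set xs \<Longrightarrow> f x = g x) \<Longrightarrow> lsum M f xs = lsum M g xs"
  by (induction xs) simp_all

context abelian_monoid
begin

lemma lsum_closed: "(\<And>x. x \<in> set xs \<Longrightarrow> f x \<in> carrier G) \<Longrightarrow> lsum G f xs \<in> carrier G"
  by (induction xs) simp_all

lemma lsum_append:
  "\<lbrakk>\<And>x. x \<in> set xs \<Longrightarrow> f x \<in> carrier G; \<And>x. x \<in> set ys \<Longrightarrow> f x \<in> carrier G\<rbrakk>
    \<Longrightarrow> lsum G f (xs @ ys) = lsum G f xs \<oplus> lsum G f ys"
  by (induction xs) (simp_all add: lsum_closed a_assoc)

lemma lsum_concat:
  "(\<And>x y. \<lbrakk>x \<in> set xs; y \<in> set (g x)\<rbrakk> \<Longrightarrow> f y \<in> carrier G)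
    \<Longrightarrow> lsum G f (concat (map g xs)) = lsum G (\<lambda>x. lsum G f (g x)) xs"
proof (induction xs)
  case (Cons x xs)
  have "lsum G f (g x @ concat (map g xs)) = lsum G f (g x) \<oplus> lsum G f (concat (map g xs))"
    by (rule lsum_append) (use Cons.prems in auto)
  moreover have "lsum G f (concat (map g xs)) = lsum G (\<lambda>x. lsum G f (g x)) xs"
    by (rule Cons.IH) (use Cons.prems in auto)
  ultimately show ?case by simp
qed simp

lemma lsum_zero: "(\<And>x. x \<in> set xs \<Longrightarrow> f x = \<zero>) \<Longrightarrow> lsum G f xs = \<zero>"
  by (induction xs) simp_all

lemma lsum_add:
  "\<lbrakk>\<And>x. x \<in> set xs \<Longrightarrow> f x \<in> carrier G; \<And>x. x \<in> set xs \<Longrightarrow> g x \<in> carrier G\<rbrakk>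
    \<Longrightarrow> lsum G (\<lambda>x. f x \<oplus> g x) xs = lsum G f xs \<oplus> lsum G g xs"
  by (induction xs) (simp_all add: lsum_closed a_ac)

lemma lsum_swap:
  "(\<And>x y. \<lbrakk>x \<in> set xs; y \<in> set ys\<rbrakk> \<Longrightarrow> f x y \<in> carrier G)
    \<Longrightarrow> lsum G (\<lambda>x. lsum G (f x) ys) xs = lsum G (\<lambda>y. lsum G (\<lambda>x. f x y) xs) ys"
  by (induction xs) (simp_all add: lsum_zero lsum_add lsum_closed)

end

lemma lsum_hom:
  assumes "abelian_group M" "abelian_group N"
    and closed: "\<And>u. u \<in> carrier M \<Longrightarrow> \<phi> u \<in> carrier N"
    and add: "\<And>u v. \<lbrakk>u \<in> carrier M; v \<in> carrier M\<rbrakk> \<Longrightarrow> \<phi> (u \<oplus>\<^bsub>M\<^esub> v) = \<phi> u \<oplus>\<^bsub>N\<^esub> \<phi> v"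
    and f: "\<And>x. x \<in> set xs \<Longrightarrow> f x \<in> carrier M"
  shows "\<phi> (lsum M f xs) = lsum N (\<lambda>x. \<phi> (f x)) xs"
proof -
  interpret M: abelian_group M by fact
  interpret N: abelian_group N by fact
  \<comment> \<open>Additivity alone forces zero to go to zero, by cancellation. This settles the
    empty list.\<close>
  have "\<phi> \<zero>\<^bsub>M\<^esub> \<oplus>\<^bsub>N\<^esub> \<phi> \<zero>\<^bsub>M\<^esub> = \<phi> \<zero>\<^bsub>M\<^esub>"
    using add[of "\<zero>\<^bsub>M\<^esub>" "\<zero>\<^bsub>M\<^esub>"] by simp
  then have "\<phi> \<zero>\<^bsub>M\<^esub> = \<zero>\<^bsub>N\<^esub>"
    using closed[of "\<zero>\<^bsub>M\<^esub>"] N.add.l_cancel_one by simp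
  then show ?thesis using f
    by (induction xs) (simp_all add: add M.lsum_closed)
qed

text \<open>Distributivity carried out on syntax, so that no representative has to be chosen. A box
  of degree \<open>d\<close> is put in (d,d), as dictated by the bidegree (1,1) of \<open>V\<close>.
  In both products the first factor to be enumerated is the outer loop; for \<open>Comp\<close> this
  is the lower diagram.\<close>

primrec expand :: "('s, 'b, 'k::comm_ring_1) diag \<Rightarrow> ((int \<times> int) \<times> ('s, 'b, 'k) diag) list" where
  "expand (Idn X) = [(0, Idn X)]"
| "expand (Box p) = map (\<lambda>d. ((int d, int d), Box (homog_part (int d) p))) (sorted_list_of_set (poly_degs p))"
| "expand (Start s) = [((1, 0), Start s)]"
| "expand (End s) = [((0, 1), End s)]"
| "expand (Split s) = [((0, - 1), Split s)]"
| "expand (Merge s) = [((- 1, 0), Merge s)]"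
| "expand (Vert s t) = [(0, Vert s t)]"
| "expand (g \<cdot> f) =
     concat (map (\<lambda>p. map (\<lambda>q. (fst p + fst q, snd q \<cdot> snd p)) (expand g)) (expand f))"
| "expand (f \<star> g) =
     concat (map (\<lambda>p. map (\<lambda>q. (fst p + fst q, snd p \<star> snd q)) (expand g)) (expand f))"
| "expand (Zero X Y) = []"
| "expand (Plus f g) = expand f @ expand g"
| "expand (Scale c f) = map (\<lambda>p. (fst p, Scale c (snd p))) (expand f)"

text \<open>Ill-typed diagrams are sent to zero only to keep the value in the carrier without side
  conditions; \<open>expand\<close> of a well-typed diagram does not produce them.\<close>

definition bigraded_term ::
    "('s, 'b, 'k::comm_ring_1) realization \<Rightarrow> 's list \<Rightarrow> 's list \<Rightarrow> int \<times> int
      \<Rightarrow> (int \<times> int) \<times> ('s, 'b, 'k) diag \<Rightarrow> ('s, 'b, 'k) morphism" where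
  "bigraded_term D X Y a p =
     (if fst p = a \<and> snd p \<in> diag_hom D X Y then cls D (snd p) else cls D (Zero X Y))"

definition component ::
    "('s, 'b, 'k::comm_ring_1) realization \<Rightarrow> int \<times> int \<Rightarrow> ('s, 'b, 'k) diag \<Rightarrow> ('s, 'b, 'k) morphism" where
  "component D a f = lsum (hecke_hom D (source D f) (target D f))
     (bigraded_term D (source D f) (target D f) a) (expand f)"

section \<open>Components and the structural relations\<close>

lemma homog_part_in_poly_ring: "p \<in> poly_ring D \<Longrightarrow> homog_part d p \<in> poly_ring D"
  using keys_homog_part[of d p] by (auto simp: poly_ring_def)

lemma expand_typed:
  "\<lbrakk>well_typed D f; p \<in> set (expand f)\<rbrakk> \<Longrightarrow> snd p \<in> diag_hom D (source D f) (target D f)"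
proof (induction f arbitrary: p)
  case (Comp g f)
  then show ?case by (auto simp: diag_hom_def)
next
  case (Tens f g)
  then show ?case by (auto simp: diag_hom_def)
qed (auto simp: diag_hom_def homog_part_in_poly_ring)

lemma bigraded_term_closed:
  "\<lbrakk>X \<in> lists (simples D); Y \<in> lists (simples D)\<rbrakk> \<Longrightarrow> bigraded_term D X Y a p \<in> carrier (hecke_hom D X Y)"
  by (auto simp: bigraded_term_def diag_hom_def hecke_hom_simps)

lemma bigraded_term_structural:
  "\<lbrakk>structural_rel x y; x \<in> diag_hom D X Y; y \<in> diag_hom D X Y\<rbrakk>
    \<Longrightarrow> bigraded_term D X Y a (b, x) = bigraded_term D X Y a (b, y)"
  using cls_eq_structural[of x y D] by (simp add: bigraded_term_def diag_hom_def)

text \<open>For most structural relations the two expansions correspond term by term, in the same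
  order, and corresponding terms are again related by the same relation. Separate treatment is
  needed where summands get reordered or regrouped, or where one term of one side matches several or
  none of the other.\<close>

lemma component_structural:
  assumes rel: "structural_rel f g" and wt: "well_typed D f" "well_typed D g"
    and st: "source D f = source D g" "target D f = target D g"
  shows "component D a f = component D a g"
proof -
  define X where "X = source D g"
  define Y where "Y = target D g"
  have XY: "X \<in> lists (simples D)" "Y \<in> lists (simples D)"
    using source_target_in_lists[OF wt(2)] by (simp_all add: X_def Y_def)
  interpret H: abelian_group "hecke_hom D X Y" by (rule hom_abelian_group[OF XY])
  let ?T = "bigraded_term D X Y a"
  note T = bigraded_term_closed[OF XY]
  note sums = H.lsum_closed H.lsum_append H.lsum_concat T add.assoc
  have eq: "?T p = ?T q"
    if "structural_rel (snd p) (snd q)" "fst p = fst q" "snd p \<in> diag_hom D X Y" "snd q \<in> diag_hom D X Y" for p q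
    using that bigraded_term_structural[of "snd p" "snd q" D X Y a "fst q"] by (metis prod.collapse)
  have typed: "well_typed D (snd p) \<and> source D (snd p) = source D u \<and> target D (snd p) = target D u"
    if "p \<in> set (expand u)" "well_typed D u" for p u
    using expand_typed that by (fastforce simp: diag_hom_def)
  have st': "source D f = X" "source D g = X" "target D f = Y" "target D g = Y"
    using st by (simp_all add: X_def Y_def)
  have "lsum (hecke_hom D X Y) ?T (expand f) = lsum (hecke_hom D X Y) ?T (expand g)"
    using rel
  proof (cases rule: structural_rel.cases)
    \<comment> \<open>Interchange law: one side enumerates the factors as \<open>f\<close>,
      \<open>f'\<close>, \<open>g\<close>, \<open>g'\<close>, the other as \<open>f\<close>,
      \<open>g\<close>, \<open>f'\<close>, \<open>g'\<close>, so the two middle sums have to be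
      swapped.\<close>
    case (8 g g' f f')
    have "lsum (hecke_hom D X Y) (\<lambda>p. lsum (hecke_hom D X Y) (\<lambda>q.
            lsum (hecke_hom D X Y) (\<lambda>r. lsum (hecke_hom D X Y) (\<lambda>t.
              ?T (fst p + (fst q + (fst r + fst t)), snd r \<star> snd t \<cdot> snd p \<star> snd q))
            (expand g')) (expand g)) (expand f')) (expand f)
        = lsum (hecke_hom D X Y) (\<lambda>p. lsum (hecke_hom D X Y) (\<lambda>r.
            lsum (hecke_hom D X Y) (\<lambda>q. lsum (hecke_hom D X Y) (\<lambda>t.
              ?T (fst p + (fst q + (fst r + fst t)), snd r \<star> snd t \<cdot> snd p \<star> snd q))
            (expand g')) (expand f')) (expand g)) (expand f)"
      by (intro lsum_cong H.lsum_swap H.lsum_closed T)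
    also have "\<dots> = lsum (hecke_hom D X Y) (\<lambda>p. lsum (hecke_hom D X Y) (\<lambda>r.
            lsum (hecke_hom D X Y) (\<lambda>q. lsum (hecke_hom D X Y) (\<lambda>t.
              ?T (fst p + (fst r + (fst q + fst t)), (snd r \<cdot> snd p) \<star> (snd t \<cdot> snd q)))
            (expand g')) (expand f')) (expand g)) (expand f)"
      using 8 wt st by (intro lsum_cong eq) (auto intro: structural_rel.intros dest!: typed
        simp: X_def Y_def diag_hom_def)
    finally show ?thesis using 8 by (simp add: sums)
  next
    \<comment> \<open>\<open>Zero\<close> expands to nothing, so each term has to cancel against its
      own negative; terms of another bidegree contribute zero twice.\<close>
    case (12 f X' Y')
    have "lsum (hecke_hom D X Y) ?T (expand f) \<oplus>\<^bsub>hecke_hom D X Y\<^esub>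
          lsum (hecke_hom D X Y) (\<lambda>p. ?T (fst p, Scale (- 1) (snd p))) (expand f)
        = lsum (hecke_hom D X Y) (\<lambda>p. ?T p \<oplus>\<^bsub>hecke_hom D X Y\<^esub> ?T (fst p, Scale (- 1) (snd p))) (expand f)"
      by (simp add: H.lsum_add T)
    also have "\<dots> = \<zero>\<^bsub>hecke_hom D X Y\<^esub>"
    proof (rule H.lsum_zero)
      fix p assume "p \<in> set (expand f)"
      then have p: "well_typed D (snd p)" "source D (snd p) = X" "target D (snd p) = Y"
        using typed[of p f] 12 wt st by (auto simp: X_def Y_def)
      show "?T p \<oplus>\<^bsub>hecke_hom D X Y\<^esub> ?T (fst p, Scale (- 1) (snd p)) = \<zero>\<^bsub>hecke_hom D X Y\<^esub>"
      proof (cases "fst p = a")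
        case True
        have "cls D (Plus (snd p) (Scale (- 1) (snd p))) = cls D (Zero X Y)"
          using p XY by (intro cls_eq_structural structural_rel.intros) auto
        then show ?thesis using True p
          by (simp add: bigraded_term_def hecke_hom_simps diag_hom_def lift_simps)
      next
        case False
        then show ?thesis using H.r_zero[OF H.zero_closed] by (simp add: bigraded_term_def hecke_hom_simps)
      qed
    qed
    finally show ?thesis using 12 by (simp add: sums)
  next
    \<comment> \<open>One term on the left corresponds to two on the right. They can be compared
      only as classes, where the sum of the two is available.\<close>
    case (13 b c f)
    have "?T (fst p, Scale (b + c) (snd p)) =
        ?T (fst p, Scale b (snd p)) \<oplus>\<^bsub>hecke_hom D X Y\<^esub> ?T (fst p, Scale c (snd p))"
      if "p \<in> set (expand f)" for p
    proof -
      have p: "well_typed D (snd p)" "source D (snd p) = X" "target D (snd p) = Y"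
        using typed[OF that] 13 wt st by (auto simp: X_def Y_def)
      then have "cls D (Scale (b + c) (snd p)) = cls D (Plus (Scale b (snd p)) (Scale c (snd p)))"
        by (intro cls_eq_structural structural_rel.intros) auto
      then show ?thesis using p H.r_zero[OF H.zero_closed]
        by (simp add: bigraded_term_def hecke_hom_simps diag_hom_def lift_simps)
    qed
    then have "lsum (hecke_hom D X Y) (\<lambda>p. ?T (fst p, Scale (b + c) (snd p))) (expand f)
        = lsum (hecke_hom D X Y) (\<lambda>p. ?T (fst p, Scale b (snd p)) \<oplus>\<^bsub>hecke_hom D X Y\<^esub>
            ?T (fst p, Scale c (snd p))) (expand f)"
      by (rule lsum_cong)
    also have "\<dots> = lsum (hecke_hom D X Y) (\<lambda>p. ?T (fst p, Scale b (snd p))) (expand f)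
        \<oplus>\<^bsub>hecke_hom D X Y\<^esub> lsum (hecke_hom D X Y) (\<lambda>p. ?T (fst p, Scale c (snd p))) (expand f)"
      by (rule H.lsum_add) (rule T)+
    finally show ?thesis using 13 by (simp add: sums)
  next
    case (10 f g)
    then show ?thesis by (simp add: sums H.a_comm)
  next
    case (17 g g' f)
    then show ?thesis by (simp add: sums H.lsum_add)
  next
    case (21 g g' f)
    then show ?thesis by (simp add: sums H.lsum_add)
  next
    case (22 g g' f)
    then show ?thesis by (simp add: sums H.lsum_add)
  next
    case 9
    then show ?thesis by (simp add: sums H.a_assoc)
  next
    case 14
    then show ?thesis by (simp add: sums H.a_assoc)
  next
    case 18
    then show ?thesis by (simp add: sums H.a_assoc)
  next
    case 11
    then show ?thesis by (simp add: sums)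
  next
    case (6 U V)
    have "?T (0, Idn U \<star> Idn V) = ?T (0, Idn (U @ V))"
      using 6 wt st' by (intro eq) (auto intro: structural_rel.intros simp: diag_hom_def)
    then show ?thesis using 6 by simp
  \<comment> \<open>The remaining relations keep the order of summation; only the recorded bidegrees
    have to be reassociated.\<close>
  qed (insert wt st', (simp add: sums)?; (rule lsum_cong)+; rule eq;
      (auto intro: structural_rel.intros dest!: typed simp: diag_hom_def; fail))+
  then show ?thesis using assms by (simp add: component_def X_def Y_def)
qed

section \<open>Composites and tensor products of sums\<close>

lemma hom_comp_right_hom:
  assumes "X \<in> lists (simples D)" and x: "x \<in> diag_hom D X Y"
    and f: "\<And>q. q \<in> set qs \<Longrightarrow> f q \<in> carrier (hecke_hom D Y Z)" and "Z \<in> lists (simples D)"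
  shows "lift2 D Comp (lsum (hecke_hom D Y Z) f qs) (cls D x)
    = lsum (hecke_hom D X Z) (\<lambda>q. lift2 D Comp (f q) (cls D x)) qs"
proof -
  interpret C: strict_linear_monoidal_category "hecke D" by (rule hecke_category)
  have Y: "Y \<in> lists (simples D)" using x source_target_in_lists by (auto simp: diag_hom_def)
  have x': "cls D x \<in> hom_set (hecke D) X Y" using x by (simp add: hecke_hom_simps)
  show ?thesis
    by (rule lsum_hom[where \<phi> = "\<lambda>u. lift2 D Comp u (cls D x)"])
      (use assms Y C.ccomp_closed[OF _ _ _ x', of Z]
        C.ccomp_bilinear(1)[OF _ _ _ x', of Z] in \<open>simp_all add: hom_abelian_group\<close>)
qed

lemma hom_comp_left_hom:
  assumes "X \<in> lists (simples D)" and x: "x \<in> diag_hom D Y Z"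
    and f: "\<And>q. q \<in> set qs \<Longrightarrow> f q \<in> carrier (hecke_hom D X Y)"
  shows "lift2 D Comp (cls D x) (lsum (hecke_hom D X Y) f qs)
    = lsum (hecke_hom D X Z) (\<lambda>q. lift2 D Comp (cls D x) (f q)) qs"
proof -
  interpret C: strict_linear_monoidal_category "hecke D" by (rule hecke_category)
  have YZ: "Y \<in> lists (simples D)" "Z \<in> lists (simples D)"
    using x source_target_in_lists by (auto simp: diag_hom_def)
  have x': "cls D x \<in> hom_set (hecke D) Y Z" using x by (simp add: hecke_hom_simps)
  show ?thesis
    by (rule lsum_hom[where \<phi> = "\<lambda>u. lift2 D Comp (cls D x) u"])
      (use assms YZ C.ccomp_closed[OF _ _ _ _ x', of X]
        C.ccomp_bilinear(2)[OF _ _ _ _ _ x', of X] in \<open>simp_all add: hom_abelian_group\<close>)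
qed

lemma hom_tens_right_hom:
  assumes "X \<in> lists (simples D)" "Y \<in> lists (simples D)" and x: "x \<in> diag_hom D X' Y'"
    and f: "\<And>q. q \<in> set qs \<Longrightarrow> f q \<in> carrier (hecke_hom D X Y)"
  shows "lift2 D Tens (lsum (hecke_hom D X Y) f qs) (cls D x)
    = lsum (hecke_hom D (X @ X') (Y @ Y')) (\<lambda>q. lift2 D Tens (f q) (cls D x)) qs"
proof -
  interpret C: strict_linear_monoidal_category "hecke D" by (rule hecke_category)
  have XY': "X' \<in> lists (simples D)" "Y' \<in> lists (simples D)"
    using x source_target_in_lists by (auto simp: diag_hom_def)
  have x': "cls D x \<in> hom_set (hecke D) X' Y'" using x by (simp add: hecke_hom_simps)
  show ?thesis
    by (rule lsum_hom[where \<phi> = "\<lambda>u. lift2 D Tens u (cls D x)"])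
      (use assms XY' C.mtens_closed[OF _ _ _ _ _ x', of X Y]
        C.mtens_bilinear(1)[OF _ _ _ _ _ _ x', of X Y] in \<open>simp_all add: append_in_lists_conv hom_abelian_group\<close>)
qed

lemma hom_tens_left_hom:
  assumes "X \<in> lists (simples D)" "Y \<in> lists (simples D)" and x: "x \<in> diag_hom D X' Y'"
    and f: "\<And>q. q \<in> set qs \<Longrightarrow> f q \<in> carrier (hecke_hom D X Y)"
  shows "lift2 D Tens (cls D x) (lsum (hecke_hom D X Y) f qs)
    = lsum (hecke_hom D (X' @ X) (Y' @ Y)) (\<lambda>q. lift2 D Tens (cls D x) (f q)) qs"
proof -
  interpret C: strict_linear_monoidal_category "hecke D" by (rule hecke_category)
  have XY': "X' \<in> lists (simples D)" "Y' \<in> lists (simples D)"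
    using x source_target_in_lists by (auto simp: diag_hom_def)
  have x': "cls D x \<in> hom_set (hecke D) X' Y'" using x by (simp add: hecke_hom_simps)
  show ?thesis
    by (rule lsum_hom[where \<phi> = "\<lambda>u. lift2 D Tens (cls D x) u"])
      (use assms XY' C.mtens_closed[OF _ _ _ _ x', of X Y]
        C.mtens_bilinear(2)[OF _ _ _ _ x', of X Y] in \<open>simp_all add: append_in_lists_conv hom_abelian_group\<close>)
qed

lemma hom_add_zero:
  assumes "x \<in> diag_hom D X Y"
  shows "lift2 D Plus (cls D x) (cls D (Zero X Y)) = cls D x"
proof -
  have XY: "X \<in> lists (simples D)" "Y \<in> lists (simples D)"
    using assms source_target_in_lists[of D x] by (auto simp: diag_hom_def)
  interpret H: abelian_group "hecke_hom D X Y" by (rule hom_abelian_group[OF XY])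
  show ?thesis using H.r_zero[of "cls D x"] assms by (simp add: hecke_hom_simps)
qed

text \<open>Composition with zero is not among the structural relations. It is additivity of
  composition for the empty sum, and the same holds for the three variants below.\<close>

lemma zero_comp:
  assumes "X \<in> lists (simples D)" "Z \<in> lists (simples D)" "x \<in> diag_hom D X Y"
  shows "lift2 D Comp (cls D (Zero Y Z)) (cls D x) = cls D (Zero X Z)"
  using hom_comp_right_hom[of X D x Y "[]" _ Z] assms by (simp add: hecke_hom_simps)

lemma comp_zero:
  assumes "X \<in> lists (simples D)" "x \<in> diag_hom D Y Z"
  shows "lift2 D Comp (cls D x) (cls D (Zero X Y)) = cls D (Zero X Z)"
  using hom_comp_left_hom[of X D x Y Z "[]"] assms by (simp add: hecke_hom_simps)

lemma zero_tens:
  assumes "X \<in> lists (simples D)" "Y \<in> lists (simples D)" "x \<in> diag_hom D X' Y'"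
  shows "lift2 D Tens (cls D (Zero X Y)) (cls D x) = cls D (Zero (X @ X') (Y @ Y'))"
  using hom_tens_right_hom[of X D Y x X' Y' "[]"] assms by (simp add: hecke_hom_simps)

lemma tens_zero:
  assumes "X \<in> lists (simples D)" "Y \<in> lists (simples D)" "x \<in> diag_hom D X' Y'"
  shows "lift2 D Tens (cls D x) (cls D (Zero X Y)) = cls D (Zero (X' @ X) (Y' @ Y))"
  using hom_tens_left_hom[of X D Y x X' Y' "[]"] assms by (simp add: hecke_hom_simps)

lemma shift_degree: "b + c = a \<longleftrightarrow> c = a - b" "b + c = a \<longleftrightarrow> b = a - c" for a b c :: "'a::ab_group_add"
  by (auto simp: algebra_simps)

text \<open>The first formula depends on the left factor only through its components, the second one on
  the right factor; together they make components compatible with congruence of composites.\<close>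

lemma component_Comp:
  assumes wt: "well_typed D (g \<cdot> f)"
  shows "component D a (g \<cdot> f) = lsum (hecke_hom D (source D f) (target D g))
      (\<lambda>p. lift2 D Comp (component D (a - fst p) g) (cls D (snd p))) (expand f)"
    and "component D a (g \<cdot> f) = lsum (hecke_hom D (source D f) (target D g))
      (\<lambda>q. lift2 D Comp (cls D (snd q)) (component D (a - fst q) f)) (expand g)"
proof -
  let ?X = "source D f" and ?Y = "target D f" and ?Z = "target D g"
  have XYZ: "?X \<in> lists (simples D)" "?Y \<in> lists (simples D)" "?Z \<in> lists (simples D)"
    using wt source_target_in_lists[of D f] source_target_in_lists[of D g] by auto
  have g: "source D g = ?Y" using wt by simp
  interpret H: abelian_group "hecke_hom D ?X ?Z" by (rule hom_abelian_group) fact+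
  note T = bigraded_term_closed[OF XYZ(1,3)]
  have f_typed: "snd p \<in> diag_hom D ?X ?Y" if "p \<in> set (expand f)" for p
    using expand_typed[of D f, OF _ that] wt by simp
  have g_typed: "snd p \<in> diag_hom D ?Y ?Z" if "p \<in> set (expand g)" for p
    using expand_typed[of D g, OF _ that] wt by simp
  have comp: "cls D y \<in> carrier (hecke_hom D U V)" if "y \<in> diag_hom D U V" for y U V
    using that by (simp add: hecke_hom_simps)
  have sum: "component D a (g \<cdot> f) = lsum (hecke_hom D ?X ?Z) (\<lambda>p. lsum (hecke_hom D ?X ?Z)
      (\<lambda>q. bigraded_term D ?X ?Z a (fst p + fst q, snd q \<cdot> snd p)) (expand g)) (expand f)"
    by (simp add: component_def H.lsum_concat T)
  have right: "bigraded_term D ?X ?Z a (fst p + fst q, snd q \<cdot> snd p)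
      = lift2 D Comp (bigraded_term D ?Y ?Z (a - fst p) q) (cls D (snd p))"
    if "p \<in> set (expand f)" "q \<in> set (expand g)" for p q
    using f_typed[OF that(1)] g_typed[OF that(2)] zero_comp[OF XYZ(1,3) f_typed[OF that(1)]]
    by (auto simp: bigraded_term_def shift_degree(1) diag_hom_def lift_simps)
  have left: "bigraded_term D ?X ?Z a (fst p + fst q, snd q \<cdot> snd p)
      = lift2 D Comp (cls D (snd q)) (bigraded_term D ?X ?Y (a - fst q) p)"
    if "p \<in> set (expand f)" "q \<in> set (expand g)" for p q
    using f_typed[OF that(1)] g_typed[OF that(2)] comp_zero[OF XYZ(1) g_typed[OF that(2)]]
    by (auto simp: bigraded_term_def shift_degree(2) diag_hom_def lift_simps)
  show "component D a (g \<cdot> f) = lsum (hecke_hom D ?X ?Z)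
      (\<lambda>p. lift2 D Comp (component D (a - fst p) g) (cls D (snd p))) (expand f)"
    unfolding sum
  proof (rule lsum_cong)
    fix p assume p: "p \<in> set (expand f)"
    show "lsum (hecke_hom D ?X ?Z) (\<lambda>q. bigraded_term D ?X ?Z a (fst p + fst q, snd q \<cdot> snd p)) (expand g)
        = lift2 D Comp (component D (a - fst p) g) (cls D (snd p))"
      unfolding component_def g
      by (subst hom_comp_right_hom[OF XYZ(1) f_typed[OF p]])
        (auto intro!: lsum_cong right p bigraded_term_closed XYZ)
  qed
  show "component D a (g \<cdot> f) = lsum (hecke_hom D ?X ?Z)
      (\<lambda>q. lift2 D Comp (cls D (snd q)) (component D (a - fst q) f)) (expand g)"
    unfolding sum
  \<comment> \<open>After the swap the terms of \<open>f\<close> form the inner sum, which can be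
    collected into a component of \<open>f\<close>.\<close>
  proof (subst H.lsum_swap, rule T, rule lsum_cong)
    fix q assume q: "q \<in> set (expand g)"
    show "lsum (hecke_hom D ?X ?Z) (\<lambda>p. bigraded_term D ?X ?Z a (fst p + fst q, snd q \<cdot> snd p)) (expand f)
        = lift2 D Comp (cls D (snd q)) (component D (a - fst q) f)"
      unfolding component_def
      by (subst hom_comp_left_hom[OF XYZ(1) g_typed[OF q]])
        (auto intro!: lsum_cong left q bigraded_term_closed XYZ)
  qed
qed

lemma component_Tens:
  assumes wt: "well_typed D (f \<star> g)"
  shows "component D a (f \<star> g) = lsum (hecke_hom D (source D f @ source D g) (target D f @ target D g))
      (\<lambda>p. lift2 D Tens (cls D (snd p)) (component D (a - fst p) g)) (expand f)"
    and "component D a (f \<star> g) = lsum (hecke_hom D (source D f @ source D g) (target D f @ target D g))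
      (\<lambda>q. lift2 D Tens (component D (a - fst q) f) (cls D (snd q))) (expand g)"
proof -
  let ?X = "source D f" and ?Y = "target D f" and ?X' = "source D g" and ?Y' = "target D g"
  have XY: "?X \<in> lists (simples D)" "?Y \<in> lists (simples D)" "?X' \<in> lists (simples D)" "?Y' \<in> lists (simples D)"
    using wt source_target_in_lists[of D f] source_target_in_lists[of D g] by auto
  then have XX': "?X @ ?X' \<in> lists (simples D)" "?Y @ ?Y' \<in> lists (simples D)"
    by (simp_all add: append_in_lists_conv)
  let ?H = "hecke_hom D (?X @ ?X') (?Y @ ?Y')" and ?T = "bigraded_term D (?X @ ?X') (?Y @ ?Y')"
  interpret H: abelian_group ?H by (rule hom_abelian_group) fact+
  note T = bigraded_term_closed[OF XX']
  have f_typed: "snd p \<in> diag_hom D ?X ?Y" if "p \<in> set (expand f)" for p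
    using expand_typed[of D f, OF _ that] wt by simp
  have g_typed: "snd p \<in> diag_hom D ?X' ?Y'" if "p \<in> set (expand g)" for p
    using expand_typed[of D g, OF _ that] wt by simp
  have sum: "component D a (f \<star> g) =
      lsum ?H (\<lambda>p. lsum ?H (\<lambda>q. ?T a (fst p + fst q, snd p \<star> snd q)) (expand g)) (expand f)"
    by (simp add: component_def H.lsum_concat T)
  have left: "?T a (fst p + fst q, snd p \<star> snd q)
      = lift2 D Tens (cls D (snd p)) (bigraded_term D ?X' ?Y' (a - fst p) q)"
    if "p \<in> set (expand f)" "q \<in> set (expand g)" for p q
    using f_typed[OF that(1)] g_typed[OF that(2)] tens_zero[OF XY(3,4) f_typed[OF that(1)]]
    by (auto simp: bigraded_term_def shift_degree(1) diag_hom_def lift_simps)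
  have right: "?T a (fst p + fst q, snd p \<star> snd q)
      = lift2 D Tens (bigraded_term D ?X ?Y (a - fst q) p) (cls D (snd q))"
    if "p \<in> set (expand f)" "q \<in> set (expand g)" for p q
    using f_typed[OF that(1)] g_typed[OF that(2)] zero_tens[OF XY(1,2) g_typed[OF that(2)]]
    by (auto simp: bigraded_term_def shift_degree(2) diag_hom_def lift_simps)
  show "component D a (f \<star> g) =
      lsum ?H (\<lambda>p. lift2 D Tens (cls D (snd p)) (component D (a - fst p) g)) (expand f)"
    unfolding sum
  proof (rule lsum_cong)
    fix p assume p: "p \<in> set (expand f)"
    show "lsum ?H (\<lambda>q. ?T a (fst p + fst q, snd p \<star> snd q)) (expand g)
        = lift2 D Tens (cls D (snd p)) (component D (a - fst p) g)"
      unfolding component_def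
      by (subst hom_tens_left_hom[OF XY(3,4) f_typed[OF p]])
        (auto intro!: lsum_cong left p bigraded_term_closed XY)
  qed
  show "component D a (f \<star> g) =
      lsum ?H (\<lambda>q. lift2 D Tens (component D (a - fst q) f) (cls D (snd q))) (expand g)"
    unfolding sum
  proof (subst H.lsum_swap, rule T, rule lsum_cong)
    fix q assume q: "q \<in> set (expand g)"
    show "lsum ?H (\<lambda>p. ?T a (fst p + fst q, snd p \<star> snd q)) (expand f)
        = lift2 D Tens (component D (a - fst q) f) (cls D (snd q))"
      unfolding component_def
      by (subst hom_tens_right_hom[OF XY(1,2) g_typed[OF q]])
        (auto intro!: lsum_cong right q bigraded_term_closed XY)
  qed
qed

section \<open>Components of linear combinations\<close>

lemma component_Plus:
  assumes "well_typed D (Plus f g)"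
  shows "component D a (Plus f g) = lift2 D Plus (component D a f) (component D a g)"
proof -
  have XY: "source D f \<in> lists (simples D)" "target D f \<in> lists (simples D)"
    using assms source_target_in_lists[of D f] by auto
  interpret H: abelian_group "hecke_hom D (source D f) (target D f)" by (rule hom_abelian_group) fact+
  have "lsum (hecke_hom D (source D f) (target D f)) (bigraded_term D (source D f) (target D f) a) (expand f @ expand g)
      = component D a f \<oplus>\<^bsub>hecke_hom D (source D f) (target D f)\<^esub> component D a g"
    using assms H.lsum_append[OF bigraded_term_closed[OF XY] bigraded_term_closed[OF XY]]
    by (simp add: component_def)
  then show ?thesis by (simp add: component_def hecke_hom_simps)
qed

lemma component_Scale:
  assumes "well_typed D f"
  shows "component D a (Scale c f) = lift1 D (Scale c) (component D a f)"
proof -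
  have XY: "source D f \<in> lists (simples D)" "target D f \<in> lists (simples D)"
    using assms source_target_in_lists[of D f] by auto
  let ?H = "hecke_hom D (source D f) (target D f)"
  interpret Md: Module.module scalar_ring ?H by (rule hom_module) fact+
  have "lift1 D (Scale c) (component D a f) = c \<odot>\<^bsub>?H\<^esub> component D a f"
    by (simp add: hecke_hom_simps)
  also have "\<dots> = lsum ?H (\<lambda>p. c \<odot>\<^bsub>?H\<^esub> bigraded_term D (source D f) (target D f) a p) (expand f)"
    unfolding component_def
    by (rule lsum_hom[where \<phi> = "\<lambda>u. c \<odot>\<^bsub>?H\<^esub> u"])
      (simp_all add: hom_abelian_group XY bigraded_term_closed Md.smult_r_distr)
  also have "\<dots> = component D a (Scale c f)"
    unfolding component_def expand.simps lsum_map source.simps target.simps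
  proof (rule lsum_cong)
    fix p assume "p \<in> set (expand f)"
    then have "snd p \<in> diag_hom D (source D f) (target D f)" using assms by (rule expand_typed[rotated])
    moreover have "c \<odot>\<^bsub>?H\<^esub> \<zero>\<^bsub>?H\<^esub> = \<zero>\<^bsub>?H\<^esub>" by (simp add: Md.smult_r_null)
    ultimately show "c \<odot>\<^bsub>?H\<^esub> bigraded_term D (source D f) (target D f) a p
        = bigraded_term D (source D f) (target D f) a (fst p, Scale c (snd p))"
      by (auto simp: bigraded_term_def hecke_hom_simps diag_hom_def lift_simps)
  qed
  finally show ?thesis ..
qed

text \<open>No relation identifies the box of 0 with the zero morphism directly. Scaling it by 0
  gives the zero morphism by the module axioms, and again the box of 0 by
  \<open>box_scale\<close>.\<close>

lemma Box_zero: "cls D (Box 0) = cls D (Zero [] [])"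
proof -
  interpret Md: Module.module scalar_ring "hecke_hom D [] []" by (rule hom_module) simp_all
  have "0 \<odot>\<^bsub>hecke_hom D [] []\<^esub> cls D (Box 0) = \<zero>\<^bsub>hecke_hom D [] []\<^esub>"
    by (rule Md.smult_l_null[simplified]) (auto simp: hecke_hom_simps diag_hom_def poly_ring_def)
  moreover have "cls D (Scale 0 (Box 0)) = cls D (Box (const 0 * 0))"
    by (intro cls_eq_rel hecke_rel.intros) (auto simp: poly_ring_def)
  ultimately show ?thesis by (simp add: hecke_hom_simps lift_simps poly_ring_def)
qed

lemma poly_ring_add: "\<lbrakk>p \<in> poly_ring D; q \<in> poly_ring D\<rbrakk> \<Longrightarrow> p + q \<in> poly_ring D"
  using Poly_Mapping.keys_add[of p q] by (auto simp: poly_ring_def)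

lemma poly_ring_mult: "\<lbrakk>p \<in> poly_ring D; q \<in> poly_ring D\<rbrakk> \<Longrightarrow> p * q \<in> poly_ring D"
  unfolding poly_ring_def
proof clarify
  fix e b assume *: "\<forall>e\<in>Poly_Mapping.keys p. Poly_Mapping.keys e \<subseteq> basis D"
    "\<forall>e\<in>Poly_Mapping.keys q. Poly_Mapping.keys e \<subseteq> basis D"
    and "e \<in> Poly_Mapping.keys (p * q)" and b: "b \<in> Poly_Mapping.keys e"
  then obtain e1 e2 where e: "e = e1 + e2" "e1 \<in> Poly_Mapping.keys p" "e2 \<in> Poly_Mapping.keys q"
    using Poly_Mapping.keys_mult[of p q] by blast
  then show "b \<in> basis D"
    using * b Poly_Mapping.keys_add[of e1 e2] by blast
qed

lemma zero_in_poly_ring: "0 \<in> poly_ring D"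
  by (simp add: poly_ring_def)

lemma poly_ring_sum: "(\<And>x. x \<in> A \<Longrightarrow> f x \<in> poly_ring D) \<Longrightarrow> sum f A \<in> poly_ring D"
  by (induction A rule: infinite_finite_induct) (auto intro: poly_ring_add simp: zero_in_poly_ring)

lemma Box_sum:
  assumes "\<And>x. x \<in> set xs \<Longrightarrow> f x \<in> poly_ring D" "distinct xs"
  shows "lsum (hecke_hom D [] []) (\<lambda>x. cls D (Box (f x))) xs = cls D (Box (sum f (set xs)))"
  using assms
proof (induction xs)
  case (Cons x xs)
  have "cls D (Plus (Box (f x)) (Box (sum f (set xs)))) = cls D (Box (f x + sum f (set xs)))"
    using Cons.prems by (intro cls_eq_rel hecke_rel.intros) (auto intro: poly_ring_add poly_ring_sum)
  then show ?case using Cons by (simp add: hecke_hom_simps lift_simps poly_ring_sum)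
qed (simp add: hecke_hom_simps Box_zero)

text \<open>Expanding does not change the morphism. For boxes this is \<open>box_plus\<close>,
  applied to the decomposition of the polynomial; for products the inner sum is pulled out of one
  factor and then the outer sum out of the other.\<close>

lemma lsum_expand:
  "well_typed D f \<Longrightarrow>
    lsum (hecke_hom D (source D f) (target D f)) (\<lambda>p. cls D (snd p)) (expand f) = cls D f"
proof (induction f)
  case (Box p)
  then show ?case
    using Box_sum[of "sorted_list_of_set (poly_degs p)" "\<lambda>d. homog_part (int d) p" D]
    by (simp add: homog_part_in_poly_ring sum_homog_parts)
next
  case (Comp g f)
  let ?X = "source D f" and ?Y = "target D f" and ?Z = "target D g"
  have XYZ: "?X \<in> lists (simples D)" "?Y \<in> lists (simples D)" "?Z \<in> lists (simples D)"
    using Comp.prems source_target_in_lists[of D f] source_target_in_lists[of D g] by auto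
  interpret H: abelian_group "hecke_hom D ?X ?Z" by (rule hom_abelian_group) fact+
  have f_typed: "snd p \<in> diag_hom D ?X ?Y" if "p \<in> set (expand f)" for p
    using expand_typed[of D f, OF _ that] Comp.prems by simp
  have g_typed: "snd p \<in> diag_hom D ?Y ?Z" if "p \<in> set (expand g)" for p
    using expand_typed[of D g, OF _ that] Comp.prems by simp
  have "lsum (hecke_hom D ?X ?Z) (\<lambda>p. cls D (snd p)) (expand (g \<cdot> f))
      = lsum (hecke_hom D ?X ?Z) (\<lambda>p. lsum (hecke_hom D ?X ?Z) (\<lambda>q. cls D (snd q \<cdot> snd p)) (expand g)) (expand f)"
    using f_typed g_typed by (subst expand.simps, subst H.lsum_concat) (auto simp: hecke_hom_simps diag_hom_def)
  also have "\<dots> = lsum (hecke_hom D ?X ?Z) (\<lambda>p. lift2 D Comp (cls D g) (cls D (snd p))) (expand f)"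
  proof (rule lsum_cong)
    fix p assume p: "p \<in> set (expand f)"
    have "lsum (hecke_hom D ?X ?Z) (\<lambda>q. cls D (snd q \<cdot> snd p)) (expand g)
        = lsum (hecke_hom D ?X ?Z) (\<lambda>q. lift2 D Comp (cls D (snd q)) (cls D (snd p))) (expand g)"
      using f_typed[OF p] g_typed by (intro lsum_cong) (auto simp: lift_simps diag_hom_def)
    also have "\<dots> = lift2 D Comp (lsum (hecke_hom D ?Y ?Z) (\<lambda>q. cls D (snd q)) (expand g)) (cls D (snd p))"
      using XYZ f_typed[OF p] g_typed by (intro hom_comp_right_hom[symmetric]) (auto simp: hecke_hom_simps)
    finally show "lsum (hecke_hom D ?X ?Z) (\<lambda>q. cls D (snd q \<cdot> snd p)) (expand g)
        = lift2 D Comp (cls D g) (cls D (snd p))" using Comp by simp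
  qed
  also have "\<dots> = lift2 D Comp (cls D g) (lsum (hecke_hom D ?X ?Y) (\<lambda>q. cls D (snd q)) (expand f))"
    using XYZ f_typed Comp.prems
    by (intro hom_comp_left_hom[symmetric]) (auto simp: hecke_hom_simps diag_hom_def)
  finally show ?case using Comp by (simp add: lift_simps)
next
  case (Tens f g)
  let ?X = "source D f" and ?Y = "target D f" and ?X' = "source D g" and ?Y' = "target D g"
  have XY: "?X \<in> lists (simples D)" "?Y \<in> lists (simples D)" "?X' \<in> lists (simples D)" "?Y' \<in> lists (simples D)"
    using Tens.prems source_target_in_lists[of D f] source_target_in_lists[of D g] by auto
  let ?H = "hecke_hom D (?X @ ?X') (?Y @ ?Y')"
  interpret H: abelian_group ?H by (rule hom_abelian_group) (simp_all add: append_in_lists_conv XY)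
  have f_typed: "snd p \<in> diag_hom D ?X ?Y" if "p \<in> set (expand f)" for p
    using expand_typed[of D f, OF _ that] Tens.prems by simp
  have g_typed: "snd p \<in> diag_hom D ?X' ?Y'" if "p \<in> set (expand g)" for p
    using expand_typed[of D g, OF _ that] Tens.prems by simp
  have "lsum ?H (\<lambda>p. cls D (snd p)) (expand (f \<star> g))
      = lsum ?H (\<lambda>p. lsum ?H (\<lambda>q. cls D (snd p \<star> snd q)) (expand g)) (expand f)"
    using f_typed g_typed by (subst expand.simps, subst H.lsum_concat) (auto simp: hecke_hom_simps diag_hom_def)
  also have "\<dots> = lsum ?H (\<lambda>p. lift2 D Tens (cls D (snd p)) (cls D g)) (expand f)"
  proof (rule lsum_cong)
    fix p assume p: "p \<in> set (expand f)"
    have "lsum ?H (\<lambda>q. cls D (snd p \<star> snd q)) (expand g)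
        = lsum ?H (\<lambda>q. lift2 D Tens (cls D (snd p)) (cls D (snd q))) (expand g)"
      using f_typed[OF p] g_typed by (intro lsum_cong) (auto simp: lift_simps diag_hom_def)
    also have "\<dots> = lift2 D Tens (cls D (snd p)) (lsum (hecke_hom D ?X' ?Y') (\<lambda>q. cls D (snd q)) (expand g))"
      using XY f_typed[OF p] g_typed by (intro hom_tens_left_hom[symmetric]) (auto simp: hecke_hom_simps)
    finally show "lsum ?H (\<lambda>q. cls D (snd p \<star> snd q)) (expand g)
        = lift2 D Tens (cls D (snd p)) (cls D g)" using Tens by simp
  qed
  also have "\<dots> = lift2 D Tens (lsum (hecke_hom D ?X ?Y) (\<lambda>q. cls D (snd q)) (expand f)) (cls D g)"
    using XY f_typed Tens.prems
    by (intro hom_tens_right_hom[symmetric]) (auto simp: hecke_hom_simps diag_hom_def)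
  finally show ?case using Tens by (simp add: lift_simps)
next
  case (Plus f g)
  have XY: "source D f \<in> lists (simples D)" "target D f \<in> lists (simples D)"
    using Plus.prems source_target_in_lists[of D f] by auto
  interpret H: abelian_group "hecke_hom D (source D f) (target D f)" by (rule hom_abelian_group) fact+
  have "lsum (hecke_hom D (source D f) (target D f)) (\<lambda>p. cls D (snd p)) (expand f @ expand g)
      = lift2 D Plus (cls D f) (cls D g)"
    using Plus expand_typed[of D f] expand_typed[of D g]
    by (subst H.lsum_append) (auto simp: hecke_hom_simps)
  then show ?case using Plus.prems by (simp add: lift_simps)
next
  case (Scale c f)
  have XY: "source D f \<in> lists (simples D)" "target D f \<in> lists (simples D)"
    using Scale.prems source_target_in_lists[of D f] by auto
  let ?H = "hecke_hom D (source D f) (target D f)"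
  interpret Md: Module.module scalar_ring ?H by (rule hom_module) fact+
  have "lsum ?H (\<lambda>p. cls D (Scale c (snd p))) (expand f) = lsum ?H (\<lambda>p. c \<odot>\<^bsub>?H\<^esub> cls D (snd p)) (expand f)"
    using Scale.prems expand_typed[of D f]
    by (intro lsum_cong) (auto simp: hecke_hom_simps lift_simps diag_hom_def)
  also have "\<dots> = c \<odot>\<^bsub>?H\<^esub> lsum ?H (\<lambda>p. cls D (snd p)) (expand f)"
    using Scale.prems expand_typed[of D f]
    by (intro lsum_hom[where \<phi> = "\<lambda>u. c \<odot>\<^bsub>?H\<^esub> u", symmetric])
      (simp_all add: hom_abelian_group XY Md.smult_r_distr, simp add: hecke_hom_simps)
  finally show ?case using Scale by (simp add: hecke_hom_simps lift_simps)
next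
  case (Zero X Y)
  then show ?case by (simp add: hecke_hom_simps)
qed (simp_all add: hecke_hom_simps hom_add_zero diag_hom_def)

section \<open>Homogeneity of the relations\<close>

text \<open>A relation, not a function: \<open>Zero\<close> has every bidegree, and
  \<open>Box 0\<close> has (d,d) for every natural \<open>d\<close>.\<close>

primrec homog :: "('s, 'b, 'k::comm_ring_1) diag \<Rightarrow> int \<times> int \<Rightarrow> bool" where
  "homog (Idn X) a \<longleftrightarrow> a = 0"
| "homog (Box p) a \<longleftrightarrow> (\<exists>d. a = (int d, int d) \<and> homogeneous_poly d p)"
| "homog (Start s) a \<longleftrightarrow> a = (1, 0)"
| "homog (End s) a \<longleftrightarrow> a = (0, 1)"
| "homog (Split s) a \<longleftrightarrow> a = (0, - 1)"
| "homog (Merge s) a \<longleftrightarrow> a = (- 1, 0)"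
| "homog (Vert s t) a \<longleftrightarrow> a = 0"
| "homog (g \<cdot> f) a \<longleftrightarrow> (\<exists>b c. a = b + c \<and> homog f b \<and> homog g c)"
| "homog (f \<star> g) a \<longleftrightarrow> (\<exists>b c. a = b + c \<and> homog f b \<and> homog g c)"
| "homog (Zero X Y) a \<longleftrightarrow> True"
| "homog (Plus f g) a \<longleftrightarrow> homog f a \<and> homog g a"
| "homog (Scale c f) a \<longleftrightarrow> homog f a"

lemma homog_Comp: "\<lbrakk>homog f b; homog g c; a = b + c\<rbrakk> \<Longrightarrow> homog (g \<cdot> f) a"
  unfolding homog.simps by blast

lemma homog_Tens: "\<lbrakk>homog f b; homog g c; a = b + c\<rbrakk> \<Longrightarrow> homog (f \<star> g) a"
  unfolding homog.simps by blast

lemma homog_generators: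
  "homog (Idn X) 0" "homog (Start s) (1, 0)" "homog (End s) (0, 1)" "homog (Split s) (0, - 1)"
  "homog (Merge s) (- 1, 0)" "homog (Vert s t) 0"
  by simp_all

lemma homogeneous_poly_iff: "homogeneous_poly d p \<longleftrightarrow> homog_poly (int d) p"
  by (simp add: homogeneous_poly_def homog_poly_def pdeg_def[symmetric] cong: ball_cong)

lemma homog_expand: "\<lbrakk>homog f a; p \<in> set (expand f)\<rbrakk> \<Longrightarrow> fst p = a"
proof (induction f arbitrary: a p)
  case (Box q)
  then show ?case by (auto simp: homogeneous_poly_iff homog_poly_def poly_degs_def)
next
  case (Comp g f)
  from Comp.prems obtain b c where bc: "a = b + c" "homog f b" "homog g c"
    unfolding homog.simps by blast
  from Comp.prems obtain q r where "p = (fst q + fst r, snd r \<cdot> snd q)"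
    "q \<in> set (expand f)" "r \<in> set (expand g)" by auto
  then show ?case using Comp.IH bc by simp
next
  case (Tens f g)
  from Tens.prems obtain b c where bc: "a = b + c" "homog f b" "homog g c"
    unfolding homog.simps by blast
  from Tens.prems obtain q r where "p = (fst q + fst r, snd q \<star> snd r)"
    "q \<in> set (expand f)" "r \<in> set (expand g)" by auto
  then show ?case using Tens.IH bc by simp
qed auto

lemma expand_homog: "p \<in> set (expand f) \<Longrightarrow> homog (snd p) (fst p)"
proof (induction f arbitrary: p)
  case (Box q)
  then show ?case by (auto simp: homogeneous_poly_iff homog_poly_part)
next
  case (Comp g f)
  from Comp.prems obtain q r where "p = (fst q + fst r, snd r \<cdot> snd q)"
    "q \<in> set (expand f)" "r \<in> set (expand g)" by auto
  then show ?case by (simp only: fst_conv snd_conv) (rule homog_Comp[OF Comp.IH(2) Comp.IH(1) refl])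
next
  case (Tens f g)
  from Tens.prems obtain q r where "p = (fst q + fst r, snd q \<star> snd r)"
    "q \<in> set (expand f)" "r \<in> set (expand g)" by auto
  then show ?case by (simp only: fst_conv snd_conv) (rule homog_Tens[OF Tens.IH(1) Tens.IH(2) refl])
qed auto

text \<open>All terms of the expansion carry the bidegree \<open>b\<close>, so a component is either
  the whole expansion or an empty sum. A well-typed diagram with two different bidegrees is
  therefore zero in the category.\<close>

lemma component_homog:
  assumes wt: "well_typed D f" and "homog f b"
  shows "component D a f = (if a = b then cls D f else cls D (Zero (source D f) (target D f)))"
proof -
  have XY: "source D f \<in> lists (simples D)" "target D f \<in> lists (simples D)"
    using wt source_target_in_lists by auto
  let ?H = "hecke_hom D (source D f) (target D f)"
  interpret H: abelian_group ?H by (rule hom_abelian_group) fact+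
  have T: "bigraded_term D (source D f) (target D f) a p =
      (if a = b then cls D (snd p) else cls D (Zero (source D f) (target D f)))"
    if "p \<in> set (expand f)" for p
    using homog_expand[OF assms(2) that] expand_typed[OF wt that] by (simp add: bigraded_term_def)
  show ?thesis
  proof (cases "a = b")
    case True
    then have "component D a f = lsum ?H (\<lambda>p. cls D (snd p)) (expand f)"
      unfolding component_def by (intro lsum_cong) (use T True in simp)
    then show ?thesis using True lsum_expand[OF wt] by simp
  next
    case False
    then have "component D a f = \<zero>\<^bsub>?H\<^esub>"
      unfolding component_def by (intro H.lsum_zero) (simp add: T hecke_hom_simps)
    then show ?thesis using False by (simp add: hecke_hom_simps)
  qed
qed

section \<open>Relations involving arbitrary polynomials\<close>

definition bidegree_part :: "int \<times> int \<Rightarrow> ('b, 'k::comm_ring_1) polys \<Rightarrow> ('b, 'k) polys" where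
  "bidegree_part a p = (if fst a = snd a then homog_part (fst a) p else 0)"

lemma bidegree_part_in_poly_ring: "p \<in> poly_ring D \<Longrightarrow> bidegree_part a p \<in> poly_ring D"
  by (simp add: bidegree_part_def homog_part_in_poly_ring zero_in_poly_ring)

text \<open>\<open>Sym(V)\<close> lives on the diagonal of the bidegrees, so components off the
  diagonal vanish and the others are the usual homogeneous parts.\<close>

lemma component_Box:
  assumes p: "p \<in> poly_ring D"
  shows "component D a (Box p) = cls D (Box (bidegree_part a p))"
proof -
  have "component D a (Box p) = lsum (hecke_hom D [] []) (\<lambda>d. cls D (Box
      (if a = (int d, int d) then homog_part (int d) p else 0))) (sorted_list_of_set (poly_degs p))"
    unfolding component_def expand.simps lsum_map source.simps target.simps
    by (rule lsum_cong) (auto simp: bigraded_term_def diag_hom_def homog_part_in_poly_ring p Box_zero)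
  also have "\<dots> = cls D (Box (\<Sum>d\<in>poly_degs p. if a = (int d, int d) then homog_part (int d) p else 0))"
    using p by (subst Box_sum) (auto simp: homog_part_in_poly_ring zero_in_poly_ring)
  also have "(\<Sum>d\<in>poly_degs p. if a = (int d, int d) then homog_part (int d) p else 0) = bidegree_part a p"
  proof (cases "fst a = snd a \<and> fst a \<in> int ` poly_degs p")
    case True
    then obtain i where i: "a = (int i, int i)" "i \<in> poly_degs p" by (metis imageE prod.collapse)
    then show ?thesis by (simp add: bidegree_part_def)
  next
    case False
    then show ?thesis
      by (auto simp: bidegree_part_def homog_part_outside intro!: sum.neutral)
  qed
  finally show ?thesis .
qed

lemma component_box_mult:
  assumes p: "p \<in> poly_ring D" and q: "q \<in> poly_ring D"
  shows "component D a (Box p \<cdot> Box q) = component D a (Box (p * q))"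
proof -
  have in_ring: "bidegree_part b p * homog_part j q \<in> poly_ring D" for b j
    using p q by (simp add: poly_ring_mult bidegree_part_in_poly_ring homog_part_in_poly_ring)
  have "component D a (Box p \<cdot> Box q) = lsum (hecke_hom D [] []) (\<lambda>j. lift2 D Comp
      (cls D (Box (bidegree_part (a - (int j, int j)) p))) (cls D (Box (homog_part (int j) q))))
      (sorted_list_of_set (poly_degs q))"
    using p q by (subst component_Comp(1)) (simp_all add: component_Box)
  also have "\<dots> = lsum (hecke_hom D [] []) (\<lambda>j. cls D (Box
      (bidegree_part (a - (int j, int j)) p * homog_part (int j) q))) (sorted_list_of_set (poly_degs q))"
  proof (rule lsum_cong)
    fix j :: nat
    have "cls D (Box (bidegree_part (a - (int j, int j)) p) \<cdot> Box (homog_part (int j) q))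
        = cls D (Box (bidegree_part (a - (int j, int j)) p * homog_part (int j) q))"
      using p q in_ring
      by (intro cls_eq_rel hecke_rel.intros) (simp_all add: bidegree_part_in_poly_ring homog_part_in_poly_ring)
    then show "lift2 D Comp (cls D (Box (bidegree_part (a - (int j, int j)) p))) (cls D (Box (homog_part (int j) q)))
        = cls D (Box (bidegree_part (a - (int j, int j)) p * homog_part (int j) q))"
      using p q by (simp add: lift_simps bidegree_part_in_poly_ring homog_part_in_poly_ring)
  qed
  also have "\<dots> = cls D (Box (\<Sum>j\<in>poly_degs q. bidegree_part (a - (int j, int j)) p * homog_part (int j) q))"
    by (subst Box_sum) (simp_all add: in_ring)
  \<comment> \<open>Subtracting (j,j) preserves the distance from the diagonal: off the diagonal
    both sides vanish, on it this is \<open>homog_part_mult\<close>.\<close>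
  also have "(\<Sum>j\<in>poly_degs q. bidegree_part (a - (int j, int j)) p * homog_part (int j) q) = bidegree_part a (p * q)"
    by (simp add: bidegree_part_def homog_part_mult)
  finally show ?thesis using p q by (simp add: component_Box poly_ring_mult)
qed

lemma demazure_zero: "demazure D s 0 = 0"
  using demazure_add[of D s 0 0] by simp

lemma reflect_sym_zero: "reflect_sym D s 0 = 0"
  using reflect_sym_add[of D s 0 0] by simp

text \<open>The component of the relation for \<open>p\<close> is the same relation for the part of
  \<open>p\<close> in that bidegree: the reflection preserves degrees, and the (1,1) lost by the
  Demazure operator is restored by \<open>Start\<close> and \<open>End\<close>. The last two
  assumptions will come from the typing of the right hand side.\<close>

lemma component_forcing:
  assumes p: "p \<in> poly_ring D" and s: "s \<in> simples D"
    and rp: "reflect_sym D s p \<in> poly_ring D" and dp: "demazure D s p \<in> poly_ring D"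
  shows "component D a (Box p \<star> Idn [s]) = component D a
    (Plus (Idn [s] \<star> Box (reflect_sym D s p)) (Box (demazure D s p) \<star> (Start s \<cdot> End s)))"
proof -
  let ?r = "bidegree_part a (reflect_sym D s p)" and ?d = "bidegree_part (a - (1, 1)) (demazure D s p)"
  have ring: "bidegree_part a p \<in> poly_ring D" "?r \<in> poly_ring D" "?d \<in> poly_ring D"
    using p rp dp by (simp_all add: bidegree_part_in_poly_ring)
  have r: "?r = reflect_sym D s (bidegree_part a p)"
    by (simp add: bidegree_part_def homog_part_reflect_sym reflect_sym_zero)
  have d: "?d = demazure D s (bidegree_part a p)"
    by (simp add: bidegree_part_def homog_part_demazure demazure_zero)
  have "component D a (Box p \<star> Idn [s]) = cls D (Box (bidegree_part a p) \<star> Idn [s])"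
    \<comment> \<open>The other factor expands to a single term, so the component formula is a sum
      of one morphism and zero.\<close>
    using p s ring hom_add_zero[of "Box (bidegree_part a p) \<star> Idn [s]" D "[s]" "[s]"]
    by (subst component_Tens(2)) (simp_all add: component_Box lift_simps hecke_hom_simps diag_hom_def)
  also have "\<dots> = cls D (Plus (Idn [s] \<star> Box ?r) (Box ?d \<star> (Start s \<cdot> End s)))"
    using s ring unfolding r d
    by (intro cls_eq_rel hecke_rel.intros) simp_all
  also have "\<dots> = lift2 D Plus (cls D (Idn [s] \<star> Box ?r)) (cls D (Box ?d \<star> (Start s \<cdot> End s)))"
    using s ring by (simp add: lift_simps)
  also have "cls D (Idn [s] \<star> Box ?r) = component D a (Idn [s] \<star> Box (reflect_sym D s p))"
    using rp s ring hom_add_zero[of "Idn [s] \<star> Box ?r" D "[s]" "[s]"]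
    by (subst component_Tens(1)) (simp_all add: component_Box lift_simps hecke_hom_simps diag_hom_def)
  also have "cls D (Box ?d \<star> (Start s \<cdot> End s)) = component D a (Box (demazure D s p) \<star> (Start s \<cdot> End s))"
    using dp s ring hom_add_zero[of "Box ?d \<star> (Start s \<cdot> End s)" D "[s]" "[s]"]
    by (subst component_Tens(2)) (simp_all add: component_Box lift_simps hecke_hom_simps diag_hom_def)
  also have "lift2 D Plus (component D a (Idn [s] \<star> Box (reflect_sym D s p)))
      (component D a (Box (demazure D s p) \<star> (Start s \<cdot> End s))) = component D a
      (Plus (Idn [s] \<star> Box (reflect_sym D s p)) (Box (demazure D s p) \<star> (Start s \<cdot> End s)))"
    using rp dp s by (subst component_Plus) simp_all
  finally show ?thesis .
qed

lemma component_box_plus: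
  assumes p: "p \<in> poly_ring D" and q: "q \<in> poly_ring D"
  shows "component D a (Plus (Box p) (Box q)) = component D a (Box (p + q))"
proof -
  have "cls D (Plus (Box (bidegree_part a p)) (Box (bidegree_part a q)))
      = cls D (Box (bidegree_part a p + bidegree_part a q))"
    using p q by (intro cls_eq_rel hecke_rel.intros) (simp_all add: bidegree_part_in_poly_ring poly_ring_add)
  moreover have "bidegree_part a p + bidegree_part a q = bidegree_part a (p + q)"
    by (simp add: bidegree_part_def homog_part_add)
  ultimately show ?thesis using p q
    by (simp add: component_Plus component_Box lift_simps bidegree_part_in_poly_ring poly_ring_add)
qed

lemma component_box_scale:
  assumes p: "p \<in> poly_ring D" 
  shows "component D a (Scale c (Box p)) = component D a (Box (const c * p))"
proof -
  have c: "const c * q \<in> poly_ring D" if "q \<in> poly_ring D" for q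
    using that by (intro poly_ring_mult) (auto simp: poly_ring_def const_def)
  have "cls D (Scale c (Box (bidegree_part a p))) = cls D (Box (const c * bidegree_part a p))"
    using p by (intro cls_eq_rel hecke_rel.intros) (simp_all add: bidegree_part_in_poly_ring c)
  moreover have "const c * bidegree_part a p = bidegree_part a (const c * p)"
    by (simp add: bidegree_part_def homog_part_scale)
  ultimately show ?thesis using p
    by (simp add: component_Scale component_Box lift_simps bidegree_part_in_poly_ring c)
qed

section \<open>Bidegrees of cups, caps, Jones-Wenzl diagrams and paths of words\<close>

lemma homog_Cup: "homog (Cup s) (1, - 1)" and homog_Cap: "homog (Cap s) (- 1, 1)"
  unfolding Cup_def Cap_def by (rule homog_Comp homog_generators | simp)+

lemmas homog_intros = homog_Comp homog_Tens homog_generators homog_Cup homog_Cap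

lemma homog_slice_retract:
  "homog (slice_retract s t n (SCap i)) (- 1, 1)" "homog (slice_retract s t n (SCup i)) (1, - 1)"
  unfolding slice_retract.simps Let_def by (rule homog_intros | simp)+

text \<open>\<open>k\<close> is the number of cups minus the number of caps. It is determined by the
  change in the number of strands, so it does not depend on how the matching is drawn.\<close>

lemma homog_retract:
  "draws a b gs M \<Longrightarrow>
    \<exists>k. int b = int a + 2 * k \<and> homog (retract s t a gs :: ('s, 'b, 'k::comm_ring_1) diag) (k, - k)"
proof (induction rule: draws.induct)
  case (1 n)
  show ?case by (rule exI[of _ 0]) (simp add: zero_prod_def)
next
  case (2 a g b gs M)
  then obtain k where k: "int b = int (slice_target a g) + 2 * k"
    "homog (retract s t (slice_target a g) gs :: ('s, 'b, 'k) diag) (k, - k)" by (elim exE conjE)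
  show ?case
  proof (cases g)
    case (SCap i)
    have "homog (retract s t a (g # gs) :: ('s, 'b, 'k) diag) (k - 1, - (k - 1))"
      unfolding retract.simps SCap
      by (rule homog_Comp[OF homog_slice_retract(1) k(2)[unfolded SCap]]) simp
    \<comment> \<open>Validity of the slice provides two strands to cap off; otherwise the natural
      subtraction in \<open>slice_target\<close> would be truncated.\<close>
    moreover have "int b = int a + 2 * (k - 1)" using k(1) 2(1) SCap by (simp add: of_nat_diff)
    ultimately show ?thesis by (intro exI conjI)
  next
    case (SCup i)
    have "homog (retract s t a (g # gs) :: ('s, 'b, 'k) diag) (k + 1, - (k + 1))"
      unfolding retract.simps SCup
      by (rule homog_Comp[OF homog_slice_retract(2) k(2)[unfolded SCup]]) simp
    moreover have "int b = int a + 2 * (k + 1)" using k(1) SCup by simp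
    ultimately show ?thesis by (intro exI conjI)
  qed
qed

lemma homog_jw:
  fixes j :: "('s, 'b, 'k::comm_ring_1) diag"
  shows "jw_diagram D s t j \<Longrightarrow> homog j 0"
proof (induction rule: jw_diagram.induct)
  case (1 s t x n Ms d)
  have "homog (retract s t n (d M) :: ('s, 'b, 'k) diag) 0" if "M \<in> set Ms" for M
  proof -
    have "draws n n (d M) M" using 1 that by blast
    then obtain k where "int n = int n + 2 * k" "homog (retract s t n (d M) :: ('s, 'b, 'k) diag) (k, - k)"
      using homog_retract[of n n "d M" M s t] by blast
    then show ?thesis by (simp add: zero_prod_def)
  qed
  \<comment> \<open>The list of summands is generalized, since the tail of \<open>Ms\<close> no
    longer contains all crossingless matchings.\<close>
  then have "homog (foldr (\<lambda>M. Plus (Scale (x M) (retract s t n (d M)))) Ns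
      (Zero (vword D s t) (vword D s t) :: ('s, 'b, 'k) diag)) 0" if "set Ns \<subseteq> set Ms" for Ns
    using that by (induction Ns) simp_all
  then show ?case by simp
qed

lemma homog_move: "homog (move D u v) 0"
proof (induction D u v rule: move.induct)
  case (1 D x u y v)
  show ?case
  proof (cases "x = y")
    case True
    show ?thesis unfolding move.simps if_P[OF True]
      by (rule homog_Tens[OF homog_generators(1) 1[OF True]]) simp
  next
    case False
    show ?thesis unfolding move.simps if_not_P[OF False]
      by (rule homog_Tens[OF homog_generators(6) homog_generators(1)]) simp
  qed
qed simp_all

text \<open>Vertices and identities have bidegree 0 for any colors, so the words along the path do
  not matter and all Zamolodchikov relations are covered at once.\<close>

lemma homog_path: "homog (path_diag D ws) 0"
proof (induction D ws rule: path_diag.induct)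
  case (1 D u v ws)
  then show ?case unfolding path_diag.simps by (rule homog_Comp[OF homog_move]) simp
qed simp_all

text \<open>Four relations hold for arbitrary polynomials and need their own computation. In each of
  the others a common bidegree of the two sides is exhibited, and then the only nonzero component is
  the relation itself.\<close>

lemma component_hecke_rel:
  assumes rel: "hecke_rel D f g" and wt: "well_typed D f" "well_typed D g"
    and st: "source D f = source D g" "target D f = target D g"
  shows "component D a f = component D a g"
proof -
  have homogeneous: ?thesis if "homog f b" "homog g b" for b
    using component_homog[OF wt(1) that(1)] component_homog[OF wt(2) that(2)] st cls_eq_rel[OF rel wt st]
    by simp
  show ?thesis using rel
  proof (cases rule: hecke_rel.cases)
    case (box_plus p q)
    then show ?thesis using wt by (simp add: component_box_plus)
  next
    case (box_scale c p)
    then show ?thesis using wt by (simp add: component_box_scale)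
  next
    case (box_mult p q)
    then show ?thesis using wt by (simp add: component_box_mult)
  next
    case (forcing p s)
    then show ?thesis using wt by (simp add: component_forcing)
  next
    case box_one
    have "homog (Box 1) 0"
      unfolding homog.simps by (rule exI[of _ 0]) (simp add: homogeneous_poly_def zero_prod_def)
    then show ?thesis using box_one by (intro homogeneous[of 0]) simp_all
  next
    case (barbell s)
    have "homog (Box (linear_poly (simple_root D s))) (1, 1)"
      unfolding homog.simps by (rule exI[of _ 1]) (simp add: homogeneous_poly_iff homog_poly_linear)
    moreover have "homog (End s \<cdot> Start s) (1, 1)"
      by (rule homog_intros | simp)+
    ultimately show ?thesis unfolding barbell by (rule homogeneous[unfolded barbell, rotated])
  next
    case (unit_left s)
    show ?thesis
      by (rule homogeneous[of 0]; unfold unit_left; (rule homog_intros | simp add: zero_prod_def)+)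
  next
    case (unit_right s)
    show ?thesis
      by (rule homogeneous[of 0]; unfold unit_right; (rule homog_intros | simp add: zero_prod_def)+)
  next
    case (counit_left s)
    show ?thesis
      by (rule homogeneous[of 0]; unfold counit_left; (rule homog_intros | simp add: zero_prod_def)+)
  next
    case (counit_right s)
    show ?thesis
      by (rule homogeneous[of 0]; unfold counit_right; (rule homog_intros | simp add: zero_prod_def)+)
  next
    case (associativity s)
    show ?thesis
      by (rule homogeneous[of "(- 2, 0)"]; unfold associativity; (rule homog_intros | simp add: zero_prod_def)+)
  next
    case (coassociativity s)
    show ?thesis
      by (rule homogeneous[of "(0, - 2)"]; unfold coassociativity; (rule homog_intros | simp add: zero_prod_def)+)
  next
    case (frobenius_left s)
    show ?thesis
      by (rule homogeneous[of "(- 1, - 1)"]; unfold frobenius_left; (rule homog_intros | simp add: zero_prod_def)+)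
  next
    case (frobenius_right s)
    show ?thesis
      by (rule homogeneous[of "(- 1, - 1)"]; unfold frobenius_right; (rule homog_intros | simp add: zero_prod_def)+)
  next
    case (needle s)
    \<comment> \<open>The right hand side is \<open>Zero\<close>, which accepts the bidegree of the
      left one.\<close>
    show ?thesis
      by (rule homogeneous[of "(- 1, - 1)"]; unfold needle; (rule homog_intros | simp add: zero_prod_def)+)
  next
    case (rotation d t s)
    \<comment> \<open>One cup and one cap, whose bidegrees are opposite.\<close>
    show ?thesis
      by (rule homogeneous[of 0]; unfold rotation; (rule homog_intros | simp add: zero_prod_def)+)
  next
    case (two_color_associativity d t s)
    show ?thesis
      by (rule homogeneous[of "(- 1, 0)"]; unfold two_color_associativity; (rule homog_intros | simp add: zero_prod_def)+)
  next
    case (jw_composite s t)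
    show ?thesis
      by (rule homogeneous[of 0]; (unfold jw_composite(1))?;
          (rule homog_intros homog_jw[OF jw_composite(2)] | simp add: zero_prod_def)+)
  next
    case (jw_end s t j d)
    show ?thesis
      \<comment> \<open>Each side has exactly one \<open>End\<close>; the vertex and the projector
        add nothing.\<close>
      by (rule homogeneous[of "(0, 1)"]; unfold jw_end(1,2);
          (rule homog_intros homog_jw[OF jw_end(3)] | simp add: zero_prod_def)+)
  next
    case (zamolodchikov_A1_I2 s t u)
    show ?thesis by (rule homogeneous[of 0]; unfold zamolodchikov_A1_I2; rule homog_path)
  next
    case (zamolodchikov_A3 s t u)
    show ?thesis by (rule homogeneous[of 0]; unfold zamolodchikov_A3; rule homog_path)
  next
    case (zamolodchikov_B3 s t u)
    show ?thesis by (rule homogeneous[of 0]; unfold zamolodchikov_B3; rule homog_path)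
  qed
qed

lemma component_cong: "diag_eq D X Y f g \<Longrightarrow> component D a f = component D a g"
proof (induction arbitrary: a rule: diag_eq.induct)
  case (1 f g X Y)
  then show ?case by (intro component_hecke_rel) (auto simp: has_type_iff)
next
  case (2 f g X Y)
  then show ?case by (intro component_structural) (auto simp: has_type_iff)
next
  case (6 X Y f f' Z g g')
  note t = diag_eq_type[OF 6(1), unfolded has_type_iff] diag_eq_type[OF 6(2), unfolded has_type_iff]
  \<comment> \<open>Related diagrams have equal types, so the mixed composite
    \<open>g' \<cdot> f\<close> is well typed and the factors can be replaced one at a time.\<close>
  then have wt: "well_typed D (g \<cdot> f)" "well_typed D (g' \<cdot> f)" "well_typed D (g' \<cdot> f')"
    and st: "source D f' = source D f" "target D g' = target D g" by auto
  have "component D a (g \<cdot> f) = component D a (g' \<cdot> f)"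
    unfolding component_Comp(1)[OF wt(1)] component_Comp(1)[OF wt(2)] st 6(4) ..
  also have "\<dots> = component D a (g' \<cdot> f')"
    unfolding component_Comp(2)[OF wt(2)] component_Comp(2)[OF wt(3)] st 6(3) ..
  finally show ?case .
next
  case (7 X Y f f' X' Y' g g')
  note t = diag_eq_type[OF 7(1), unfolded has_type_iff] diag_eq_type[OF 7(2), unfolded has_type_iff]
  then have wt: "well_typed D (f \<star> g)" "well_typed D (f \<star> g')" "well_typed D (f' \<star> g')"
    and st: "source D f' = source D f" "target D f' = target D f"
      "source D g' = source D g" "target D g' = target D g" by auto
  have "component D a (f \<star> g) = component D a (f \<star> g')"
    unfolding component_Tens(1)[OF wt(1)] component_Tens(1)[OF wt(2)] st 7(4) ..
  also have "\<dots> = component D a (f' \<star> g')"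
    unfolding component_Tens(2)[OF wt(2)] component_Tens(2)[OF wt(3)] st 7(3) ..
  finally show ?case .
next
  case (8 X Y f f' g g')
  note t = diag_eq_type[OF 8(1), unfolded has_type_iff] diag_eq_type[OF 8(2), unfolded has_type_iff]
  then have "well_typed D (Plus f g)" "well_typed D (Plus f' g')" by auto
  then show ?case by (simp only: component_Plus 8)
next
  case (9 X Y f f' c)
  note t = diag_eq_type[OF 9(1), unfolded has_type_iff]
  then have "well_typed D f" "well_typed D f'" by auto
  then show ?case by (simp only: component_Scale 9)
qed simp_all

section \<open>The bigrading\<close>

text \<open>One homogeneous representative is enough; other members of its class may contain terms
  of different bidegrees that cancel.\<close>

definition bigrading ::
    "('s, 'b, 'k::comm_ring_1) realization \<Rightarrow> int \<times> int \<Rightarrow> 's list \<Rightarrow> 's list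
      \<Rightarrow> ('s, 'b, 'k) morphism set" where
  "bigrading D a X Y = cls D ` {f \<in> diag_hom D X Y. homog f a}"

lemma bigrading_closed: "u \<in> bigrading D a X Y \<Longrightarrow> u \<in> carrier (hecke_hom D X Y)"
  by (auto simp: bigrading_def hecke_hom_simps)

lemma bigrading_zero:
  "\<lbrakk>X \<in> lists (simples D); Y \<in> lists (simples D)\<rbrakk> \<Longrightarrow> cls D (Zero X Y) \<in> bigrading D a X Y"
  by (auto simp: bigrading_def diag_hom_def)

lemma bigrading_add:
  assumes "u \<in> bigrading D a X Y" "v \<in> bigrading D a X Y"
  shows "lift2 D Plus u v \<in> bigrading D a X Y"
proof -
  obtain f g where "u = cls D f" "v = cls D g" "f \<in> diag_hom D X Y" "g \<in> diag_hom D X Y"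
    "homog f a" "homog g a" using assms by (auto simp: bigrading_def)
  then show ?thesis unfolding bigrading_def
    by (intro image_eqI[of _ _ "Plus f g"]) (auto simp: diag_hom_def lift_simps)
qed

lemma bigrading_scale:
  assumes "u \<in> bigrading D a X Y"
  shows "lift1 D (Scale c) u \<in> bigrading D a X Y"
proof -
  obtain f where "u = cls D f" "f \<in> diag_hom D X Y" "homog f a"
    using assms by (auto simp: bigrading_def)
  then show ?thesis unfolding bigrading_def
    by (intro image_eqI[of _ _ "Scale c f"]) (auto simp: diag_hom_def lift_simps)
qed

lemma bigrading_submodule:
  assumes "X \<in> lists (simples D)" "Y \<in> lists (simples D)"
  shows "submodule (bigrading D a X Y) scalar_ring (hecke_hom D X Y)"
proof -
  interpret Md: Module.module scalar_ring "hecke_hom D X Y" by (rule hom_module) fact+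
  show ?thesis
  proof (rule Md.submoduleI)
    show "bigrading D a X Y \<subseteq> carrier (hecke_hom D X Y)" by (auto dest: bigrading_closed)
    show "\<zero>\<^bsub>hecke_hom D X Y\<^esub> \<in> bigrading D a X Y"
      using bigrading_zero[OF assms] by (simp add: hecke_hom_simps)
    fix u v c assume u: "u \<in> bigrading D a X Y"
    show scale: "c \<odot>\<^bsub>hecke_hom D X Y\<^esub> u \<in> bigrading D a X Y" for c
      using bigrading_scale[OF u] by (simp add: hecke_hom_simps)
    assume "v \<in> bigrading D a X Y"
    then show "u \<oplus>\<^bsub>hecke_hom D X Y\<^esub> v \<in> bigrading D a X Y"
      using bigrading_add[OF u] by (simp add: hecke_hom_simps)
  next
    fix u assume u: "u \<in> bigrading D a X Y"
    \<comment> \<open>Closure under negatives is closure under the scalar -1.\<close>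
    have "(\<ominus>\<^bsub>scalar_ring\<^esub> \<one>\<^bsub>scalar_ring\<^esub>) \<odot>\<^bsub>hecke_hom D X Y\<^esub> u = \<ominus>\<^bsub>hecke_hom D X Y\<^esub> (\<one>\<^bsub>scalar_ring\<^esub> \<odot>\<^bsub>hecke_hom D X Y\<^esub> u)"
      using bigrading_closed[OF u] by (intro Md.smult_l_minus) simp_all
    also have "\<dots> = \<ominus>\<^bsub>hecke_hom D X Y\<^esub> u"
      using Md.smult_one[OF bigrading_closed[OF u]] by simp
    finally show "\<ominus>\<^bsub>hecke_hom D X Y\<^esub> u \<in> bigrading D a X Y"
      using bigrading_scale[OF u] by (metis hecke_hom_simps(4))
  qed
qed

lemma component_in_bigrading:
  assumes wt: "well_typed D f"
  shows "component D a f \<in> bigrading D a (source D f) (target D f)"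
proof -
  let ?X = "source D f" and ?Y = "target D f"
  have XY: "?X \<in> lists (simples D)" "?Y \<in> lists (simples D)"
    using wt source_target_in_lists by auto
  \<comment> \<open>Induction runs over lists of terms from a fixed expansion, so that homogeneity
    and typing of the terms stay available.\<close>
  have "lsum (hecke_hom D ?X ?Y) (bigraded_term D ?X ?Y a) ps \<in> bigrading D a ?X ?Y"
    if "set ps \<subseteq> set (expand f)" for ps
    using that
  proof (induction ps)
    case Nil
    then show ?case using bigrading_zero[OF XY] by (simp add: hecke_hom_simps)
  next
    case (Cons p ps)
    have "bigraded_term D ?X ?Y a p \<in> bigrading D a ?X ?Y"
      using Cons.prems expand_homog[of p f] bigrading_zero[OF XY]
      by (auto simp: bigraded_term_def bigrading_def)
    then show ?case using Cons bigrading_add by (simp add: hecke_hom_simps)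
  qed
  then show ?thesis by (simp add: component_def)
qed

section \<open>Decomposition of morphisms into components\<close>

lemma component_support:
  assumes wt: "well_typed D f" and "a \<notin> fst ` set (expand f)"
  shows "component D a f = \<zero>\<^bsub>hecke_hom D (source D f) (target D f)\<^esub>"
proof -
  interpret H: abelian_group "hecke_hom D (source D f) (target D f)"
    using wt source_target_in_lists[of D f] by (intro hom_abelian_group) auto
  have "fst p \<noteq> a" if "p \<in> set (expand f)" for p using assms(2) that by force
  then show ?thesis unfolding component_def
    by (intro H.lsum_zero) (simp add: bigraded_term_def hecke_hom_simps)
qed

text \<open>Among all bidegrees, each term of the expansion contributes to exactly one, its own.
  Summing over bidegrees therefore returns the full expansion, and \<open>lsum_expand\<close>
  applies.\<close>

lemma finsum_component:
  assumes wt: "well_typed D f"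
  shows "finsum (hecke_hom D (source D f) (target D f)) (\<lambda>a. component D a f) (fst ` set (expand f)) = cls D f"
proof -
  let ?X = "source D f" and ?Y = "target D f"
  let ?H = "hecke_hom D ?X ?Y" and ?A = "fst ` set (expand f)"
  have XY: "?X \<in> lists (simples D)" "?Y \<in> lists (simples D)"
    using wt source_target_in_lists by auto
  interpret H: abelian_group ?H by (rule hom_abelian_group) fact+
  note T = bigraded_term_closed[OF XY]
  have "finsum ?H (\<lambda>a. lsum ?H (bigraded_term D ?X ?Y a) ps) ?A = lsum ?H (\<lambda>p. cls D (snd p)) ps"
    if "set ps \<subseteq> set (expand f)" for ps
    using that
  proof (induction ps)
    case (Cons p ps)
    have p: "snd p \<in> diag_hom D ?X ?Y" "fst p \<in> ?A" "cls D (snd p) \<in> carrier ?H"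
      using Cons.prems expand_typed[OF wt] by (auto simp: hecke_hom_simps)
    have "finsum ?H (\<lambda>a. bigraded_term D ?X ?Y a p) ?A = finsum ?H (\<lambda>a. if fst p = a then cls D (snd p) else \<zero>\<^bsub>?H\<^esub>) ?A"
      using p H.zero_closed by (intro H.finsum_cong') (simp_all add: bigraded_term_def hecke_hom_simps(2))
    also have "\<dots> = cls D (snd p)"
      using p by (intro H.add.finprod_singleton) auto
    finally have "finsum ?H (\<lambda>a. bigraded_term D ?X ?Y a p) ?A = cls D (snd p)" .
    then show ?case using Cons
      by (simp add: H.finsum_addf T H.lsum_closed Pi_def)
  qed (simp add: H.finsum_zero)
  from this[OF order_refl] show ?thesis
    using lsum_expand[OF wt] by (simp add: component_def)
qed

text \<open>Components as maps on morphisms: \<open>component_cong\<close> makes the chosen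
  representative irrelevant. This form is needed to take the component of a morphism that is given
  only as a sum in the Hom space.\<close>

definition project :: "('s, 'b, 'k::comm_ring_1) realization \<Rightarrow> int \<times> int
    \<Rightarrow> ('s, 'b, 'k) morphism \<Rightarrow> ('s, 'b, 'k) morphism" where
  "project D a u = component D a (SOME f. well_typed D f \<and> cls D f = u)"

lemma project_cls: "well_typed D f \<Longrightarrow> project D a (cls D f) = component D a f"
  unfolding project_def
  by (rule someI2[of _ f]) (auto dest!: cls_eqD component_cong)

lemma project_bigrading:
  assumes "u \<in> bigrading D b X Y"
  shows "project D a u = (if a = b then u else \<zero>\<^bsub>hecke_hom D X Y\<^esub>)"
  using assms by (auto simp: bigrading_def diag_hom_def project_cls component_homog hecke_hom_simps)

text \<open>The source of uniqueness: the summands of any homogeneous decomposition can be read off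
  from its sum.\<close>

lemma project_finsum:
  assumes XY: "X \<in> lists (simples D)" "Y \<in> lists (simples D)"
    and "finite A" and h: "\<And>a. a \<in> A \<Longrightarrow> h a \<in> bigrading D a X Y"
  shows "project D a (finsum (hecke_hom D X Y) h A) = (if a \<in> A then h a else \<zero>\<^bsub>hecke_hom D X Y\<^esub>)"
proof -
  let ?H = "hecke_hom D X Y"
  interpret H: abelian_group ?H by (rule hom_abelian_group) fact+
  have add: "project D a (u \<oplus>\<^bsub>?H\<^esub> v) = project D a u \<oplus>\<^bsub>?H\<^esub> project D a v"
    if "u \<in> carrier ?H" "v \<in> carrier ?H" for u v
  proof -
    obtain f g where fg: "u = cls D f" "v = cls D g" "well_typed D (Plus f g)"
      using \<open>u \<in> carrier ?H\<close> \<open>v \<in> carrier ?H\<close> by (auto simp: hecke_hom_simps diag_hom_def)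
    moreover from fg have "u \<oplus>\<^bsub>?H\<^esub> v = cls D (Plus f g)" by (simp add: hecke_hom_simps lift_Plus)
    moreover from fg have "well_typed D f" "well_typed D g" by simp_all
    ultimately show ?thesis by (simp only: project_cls component_Plus hecke_hom_simps)
  qed
  show ?thesis using assms(3) h
  proof (induction A rule: finite_induct)
    case empty
    \<comment> \<open>The zero morphism lies in every bidegree, so it may be regarded as one of
      bidegree \<open>a\<close>.\<close>
    then show ?case using project_bigrading[OF bigrading_zero[OF XY], of a a] by (simp add: hecke_hom_simps)
  next
    case (insert b A)
    have hA: "h \<in> A \<rightarrow> carrier ?H" and hb: "h b \<in> carrier ?H"
      using bigrading_closed[OF insert.prems] by simp_all
    then have "project D a (finsum ?H h (insert b A)) = project D a (h b) \<oplus>\<^bsub>?H\<^esub> project D a (finsum ?H h A)"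
      using insert.hyps by (simp add: add H.finsum_closed)
    also have "\<dots> = (if a = b then h b else \<zero>\<^bsub>?H\<^esub>) \<oplus>\<^bsub>?H\<^esub> (if a \<in> A then h a else \<zero>\<^bsub>?H\<^esub>)"
      using insert project_bigrading[of "h b" D b X Y a] by simp
    also have "\<dots> = (if a \<in> insert b A then h a else \<zero>\<^bsub>?H\<^esub>)"
    proof (cases "a \<in> A")
      case True
      then have "h a \<in> carrier ?H" using hA by (rule funcset_mem[rotated])
      then show ?thesis using True insert.hyps(2) by (cases "a = b") simp_all
    qed (use hb in simp)
    finally show ?case .
  qed
qed

lemma bigrading_graded: "graded_linear_monoidal_category (hecke D) (bigrading D)"
proof (rule graded_linear_monoidal_category.intro[OF hecke_category],
    rule graded_linear_monoidal_category_axioms.intro)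
  fix X Y a assume "X \<in> Obj (hecke D)" "Y \<in> Obj (hecke D)"
  then show "submodule (bigrading D a X Y) scalar_ring (Hom (hecke D) X Y)"
    by (simp add: bigrading_submodule)
next
  fix X Y u assume "X \<in> Obj (hecke D)" "Y \<in> Obj (hecke D)" "u \<in> hom_set (hecke D) X Y"
  then have XY: "X \<in> lists (simples D)" "Y \<in> lists (simples D)" and u: "u \<in> carrier (hecke_hom D X Y)"
    by simp_all
  let ?H = "hecke_hom D X Y"
  interpret H: abelian_group ?H by (rule hom_abelian_group) fact+
  obtain f where f: "well_typed D f" "source D f = X" "target D f = Y" "u = cls D f"
    using u by (auto simp: hecke_hom_simps diag_hom_def)
  let ?c = "\<lambda>a. component D a f"
  have c: "?c a \<in> bigrading D a X Y" for a using component_in_bigrading f by blast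
  \<comment> \<open>Only an inclusion: terms of the same bidegree in the expansion may cancel. The
    sum over all bidegrees in the expansion is then cut down to the nonzero components.\<close>
  have sub: "{a. ?c a \<noteq> \<zero>\<^bsub>?H\<^esub>} \<subseteq> fst ` set (expand f)"
    using component_support[OF f(1)] f(2,3) by blast
  have "finsum ?H ?c {a. ?c a \<noteq> \<zero>\<^bsub>?H\<^esub>} = finsum ?H ?c (fst ` set (expand f))"
    by (rule H.add.finprod_mono_neutral_cong_left) (use sub bigrading_closed[OF c] in auto)
  then have sum: "u = finsum ?H ?c {a. ?c a \<noteq> \<zero>\<^bsub>?H\<^esub>}"
    using finsum_component[OF f(1)] f by simp
  have fin: "finite {a. ?c a \<noteq> \<zero>\<^bsub>?H\<^esub>}" using sub by (rule finite_subset) simp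
  show "\<exists>!h. (\<forall>a. h a \<in> bigrading D a X Y) \<and> finite {a. h a \<noteq> \<zero>\<^bsub>Hom (hecke D) X Y\<^esub>} \<and>
      u = finsum (Hom (hecke D) X Y) h {a. h a \<noteq> \<zero>\<^bsub>Hom (hecke D) X Y\<^esub>}"
    unfolding hecke_simps
  proof (rule ex1I[of _ ?c])
    show "(\<forall>a. ?c a \<in> bigrading D a X Y) \<and> finite {a. ?c a \<noteq> \<zero>\<^bsub>?H\<^esub>} \<and>
        u = finsum ?H ?c {a. ?c a \<noteq> \<zero>\<^bsub>?H\<^esub>}"
      using c fin sum by blast
    fix h assume h: "(\<forall>a. h a \<in> bigrading D a X Y) \<and> finite {a. h a \<noteq> \<zero>\<^bsub>?H\<^esub>} \<and>
        u = finsum ?H h {a. h a \<noteq> \<zero>\<^bsub>?H\<^esub>}"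
    then have u: "u = finsum ?H h {a. h a \<noteq> \<zero>\<^bsub>?H\<^esub>}" by blast
    show "h = ?c"
    proof
      fix a
      have "?c a = project D a u" using project_cls[OF f(1)] f(4) by simp
      \<comment> \<open>Outside its support \<open>h\<close> vanishes, so both cases of
        \<open>project_finsum\<close> give \<open>h a\<close>.\<close>
      also have "\<dots> = h a"
        unfolding u using project_finsum[OF XY, of "{a. h a \<noteq> \<zero>\<^bsub>?H\<^esub>}" h a] h by simp
      finally show "h a = ?c a" ..
    qed
  qed
next
  fix X assume "X \<in> Obj (hecke D)"
  then show "ident (hecke D) X \<in> bigrading D 0 X X"
    by (auto simp: bigrading_def diag_hom_def)
next
  fix X Y Z u v a b
  assume "u \<in> bigrading D a X Y" "v \<in> bigrading D b Y Z"
  then obtain f g where "u = cls D f" "v = cls D g" "f \<in> diag_hom D X Y" "g \<in> diag_hom D Y Z"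
    "homog f a" "homog g b" by (auto simp: bigrading_def)
  then show "ccomp (hecke D) v u \<in> bigrading D (a + b) X Z" unfolding bigrading_def
    by (intro image_eqI[of _ _ "g \<cdot> f"] CollectI conjI homog_Comp[OF _ _ refl])
      (auto simp: diag_hom_def lift_simps)
next
  fix X Y X' Y' u v a b
  assume "u \<in> bigrading D a X Y" "v \<in> bigrading D b X' Y'"
  then obtain f g where "u = cls D f" "v = cls D g" "f \<in> diag_hom D X Y" "g \<in> diag_hom D X' Y'"
    "homog f a" "homog g b" by (auto simp: bigrading_def)
  then show "mtens (hecke D) u v \<in> bigrading D (a + b) (otens (hecke D) X X') (otens (hecke D) Y Y')"
    unfolding bigrading_def
    by (intro image_eqI[of _ _ "f \<star> g"] CollectI conjI homog_Tens[OF _ _ refl])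
      (auto simp: diag_hom_def lift_simps)
qed

section \<open>Comparison with the original grading\<close>

lemma has_degree_has_type: "has_degree D n X Y f \<Longrightarrow> has_type D X Y f"
  by (induction rule: has_degree.induct) (auto intro: has_type.intros)

text \<open>On generators the coordinates of the bidegree add up to the original degree; a
  polynomial part in (d,d) gives 2d. \<open>Zero\<close> is allowed every degree by
  \<open>has_degree\<close>, which is harmless because it expands to nothing.\<close>

lemma has_degree_expand: "\<lbrakk>has_degree D n X Y f; p \<in> set (expand f)\<rbrakk> \<Longrightarrow> fst (fst p) + snd (fst p) = n"
proof (induction arbitrary: p rule: has_degree.induct)
  case (2 p d)
  then show ?case by (auto simp: homogeneous_poly_iff homog_poly_def poly_degs_def)
next
  case (8 a X Y f b Z g)
  from 8(5) obtain q r where "p = (fst q + fst r, snd r \<cdot> snd q)"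
    "q \<in> set (expand f)" "r \<in> set (expand g)" by auto
  then show ?case using 8(3)[of q] 8(4)[of r] by simp
next
  case (9 a X Y f b X' Y' g)
  from 9(5) obtain q r where "p = (fst q + fst r, snd q \<star> snd r)"
    "q \<in> set (expand f)" "r \<in> set (expand g)" by auto
  then show ?case using 9(3)[of q] 9(4)[of r] by simp
qed auto

lemma homog_has_degree:
  "\<lbrakk>well_typed D f; homog f a\<rbrakk> \<Longrightarrow> has_degree D (fst a + snd a) (source D f) (target D f) f"
proof (induction f arbitrary: a)
  case (Box p)
  then obtain d where "a = (int d, int d)" "homogeneous_poly d p" by auto
  then show ?case using Box.prems has_degree.intros(2)[of p D d] by simp
next
  case (Comp g f)
  obtain b c where "a = b + c" "homog f b" "homog g c" using Comp.prems unfolding homog.simps by blast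
  then show ?case
    using has_degree.intros(8)[of D "fst b + snd b" "source D f" "target D f" f "fst c + snd c" "target D g" g]
      Comp.IH(1)[of c] Comp.IH(2)[of b] Comp.prems by (simp add: algebra_simps)
next
  case (Tens f g)
  obtain b c where "a = b + c" "homog f b" "homog g c" using Tens.prems unfolding homog.simps by blast
  then show ?case
    using has_degree.intros(9)[of D "fst b + snd b" "source D f" "target D f" f "fst c + snd c" "source D g" "target D g" g]
      Tens.IH(1)[of b] Tens.IH(2)[of c] Tens.prems by (simp add: algebra_simps)
qed (auto intro: has_degree.intros simp: zero_prod_def)

lemma original_grading_finsum:
  assumes XY: "X \<in> lists (simples D)" "Y \<in> lists (simples D)"
    and "finite A" and "\<And>a. a \<in> A \<Longrightarrow> h a \<in> original_grading D n X Y"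
  shows "finsum (hecke_hom D X Y) h A \<in> original_grading D n X Y"
  using assms(3,4)
proof (induction A rule: finite_induct)
  case empty
  interpret H: abelian_group "hecke_hom D X Y" by (rule hom_abelian_group) fact+
  have "cls D (Zero X Y) \<in> original_grading D n X Y"
    using has_degree.intros(10)[OF XY] by (auto simp: original_grading_def)
  then show ?case by (simp add: hecke_hom_simps)
next
  case (insert a A)
  interpret H: abelian_group "hecke_hom D X Y" by (rule hom_abelian_group) fact+
  have carr: "h b \<in> carrier (hecke_hom D X Y)" if "b \<in> insert a A" for b
    using insert.prems[OF that] has_degree_has_type
    by (fastforce simp: original_grading_def hecke_hom_simps diag_hom_def has_type_iff)
  obtain f where f: "h a = cls D f" "has_degree D n X Y f"
    using insert.prems[of a] by (auto simp: original_grading_def)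
  have "finsum (hecke_hom D X Y) h A \<in> original_grading D n X Y"
    by (rule insert.IH) (simp add: insert.prems)
  then obtain g where g: "finsum (hecke_hom D X Y) h A = cls D g" "has_degree D n X Y g"
    by (auto simp: original_grading_def)
  have "well_typed D (Plus f g)"
    using has_degree_has_type[OF f(2)] has_degree_has_type[OF g(2)] by (simp add: has_type_iff)
  moreover have "finsum (hecke_hom D X Y) h (insert a A)
      = h a \<oplus>\<^bsub>hecke_hom D X Y\<^esub> finsum (hecke_hom D X Y) h A"
    using insert.hyps carr by (intro H.finsum_insert) auto
  ultimately have "finsum (hecke_hom D X Y) h (insert a A) = cls D (Plus f g)"
    unfolding f(1) g(1) by (simp add: hecke_hom_simps lift_Plus)
  then show ?case using has_degree.intros(11)[OF f(2) g(2)] by (auto simp: original_grading_def)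
qed

text \<open>A diagram of degree \<open>n\<close> may still mix bidegrees, but only on the line
  \<open>i + j = n\<close>, and its components provide the required sum. Conversely a bihomogeneous
  diagram is homogeneous, and the parts of the original grading are closed under finite
  sums.\<close>

lemma original_grading_induced:
  assumes XY: "X \<in> lists (simples D)" "Y \<in> lists (simples D)"
  shows "original_grading D n X Y = induced_grading (\<lambda>(i, j). i + j) (hecke D) (bigrading D) n X Y"
proof
  show "original_grading D n X Y \<subseteq> induced_grading (\<lambda>(i, j). i + j) (hecke D) (bigrading D) n X Y"
  proof
    fix u assume "u \<in> original_grading D n X Y"
    then obtain f where f: "u = cls D f" "has_degree D n X Y f" by (auto simp: original_grading_def)
    then have t: "well_typed D f" "source D f = X" "target D f = Y"
      using has_degree_has_type[OF f(2)] by (simp_all add: has_type_iff)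
    have "u = finsum (hecke_hom D X Y) (\<lambda>a. component D a f) (fst ` set (expand f))"
      using finsum_component[OF t(1)] t f by simp
    moreover have "component D a f \<in> bigrading D a X Y" for a
      using component_in_bigrading[OF t(1)] t by simp
    moreover have "(\<lambda>(i, j). i + j) a = n" if "a \<in> fst ` set (expand f)" for a
      using has_degree_expand[OF f(2)] that by (auto simp: case_prod_beta)
    ultimately show "u \<in> induced_grading (\<lambda>(i, j). i + j) (hecke D) (bigrading D) n X Y"
      unfolding induced_grading_def hecke_simps by blast
  qed
  show "induced_grading (\<lambda>(i, j). i + j) (hecke D) (bigrading D) n X Y \<subseteq> original_grading D n X Y"
  proof
    fix u assume "u \<in> induced_grading (\<lambda>(i, j). i + j) (hecke D) (bigrading D) n X Y"
    then obtain h A where u: "u = finsum (hecke_hom D X Y) h A" "finite A"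
      and h: "\<And>a. a \<in> A \<Longrightarrow> fst a + snd a = n \<and> h a \<in> bigrading D a X Y"
      by (auto simp: induced_grading_def case_prod_beta)
    have "h a \<in> original_grading D n X Y" if "a \<in> A" for a
      using h[OF that] homog_has_degree by (fastforce simp: bigrading_def original_grading_def diag_hom_def)
    then show "u \<in> original_grading D n X Y"
      unfolding u(1) by (intro original_grading_finsum XY u)
  qed
qed

lemma linear_poly_in_poly_ring: "v \<in> vspace D \<Longrightarrow> linear_poly v \<in> poly_ring D"
  unfolding linear_poly_def
  by (intro poly_ring_sum poly_ring_mult) (auto simp: vspace_def poly_ring_def const_def var_def)

theorem theorem1p1:
  fixes W :: "'s monoid" and D :: "('s, 'b, 'k::comm_ring_1) realization"
  assumes "coxeter_system W (simples D) (cox D)"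
    and "is_realization W D"
    and "well_defined D"
  shows "\<exists>G :: int \<times> int \<Rightarrow> 's list \<Rightarrow> 's list \<Rightarrow> ('s, 'b, 'k) morphism set.
    graded_linear_monoidal_category (hecke D) G \<and>
    (\<forall>s\<in>simples D.
       cls D (Start s) \<in> G (1, 0) [] [s] \<and>
       cls D (End s) \<in> G (0, 1) [s] [] \<and>
       cls D (Split s) \<in> G (0, - 1) [s] [s, s] \<and>
       cls D (Merge s) \<in> G (- 1, 0) [s, s] [s]) \<and>
    (\<forall>s\<in>simples D. \<forall>t\<in>simples D. s \<noteq> t \<and> cox D s t \<noteq> \<infinity> \<longrightarrow>
       cls D (Vert s t) \<in> G (0, 0) (vword D s t) (vword D t s)) \<and>
    (\<forall>v\<in>vspace D. cls D (Box (linear_poly v)) \<in> G (1, 1) [] []) \<and>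
    (\<forall>n. \<forall>X\<in>Obj (hecke D). \<forall>Y\<in>Obj (hecke D).
       original_grading D n X Y = induced_grading (\<lambda>(i, j). i + j) (hecke D) G n X Y)"
proof (rule exI[of _ "bigrading D"], intro conjI ballI allI impI)
  show "graded_linear_monoidal_category (hecke D) (bigrading D)" by (rule bigrading_graded)
next
  fix v assume "v \<in> vspace D"
  moreover have "homog (Box (linear_poly v)) (1, 1)"
    unfolding homog.simps by (rule exI[of _ 1]) (simp add: homogeneous_poly_iff homog_poly_linear)
  ultimately show "cls D (Box (linear_poly v)) \<in> bigrading D (1, 1) [] []"
    unfolding bigrading_def by (intro imageI) (simp add: diag_hom_def linear_poly_in_poly_ring)
next
  fix n X Y assume "X \<in> Obj (hecke D)" "Y \<in> Obj (hecke D)"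
  then show "original_grading D n X Y = induced_grading (\<lambda>(i, j). i + j) (hecke D) (bigrading D) n X Y"
    by (intro original_grading_induced) simp_all
qed (auto simp: bigrading_def diag_hom_def zero_prod_def intro!: imageI)

end
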